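(* There exist finite Coxeter groups $C, A_1, B_1, A_2, B_2$, where $C$ is (identified with) a special subgroup of each of $A_1,B_1,A_2,B_2$, such that the amalgamated products $W=A_1\ast_C B_1$ and $W'=A_2\ast_C B_2$ (amalgamated along these identifications) are Coxeter groups that are $\mathrm{AE}$-equivalent but not isomorphic.
   Context: A Coxeter group is a group with a presentation $\langle S\mid (ss')^{m(s,s')}=1\rangle$, $m(s,s')=m(s',s)\in\{1,\dots,\infty\}$, $m(s,s')=1$ iff $s=s'$. A special subgroup of a Coxeter system $(W,S)$ is a subgroup generated by a subset of $S$. Two groups are $\mathrm{AE}$-equivalent if they satisfy the same first-order sentences of the form $\forall\bar x\exists\bar y\,\theta(\bar x,\bar y)$ with $\theta$ quantifier-free. *)

theory Defs
  imports "HOL-Algebra.Algebra" "HOL-Library.Extended_Nat"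
begin

text \<open>A word over generators of type 'x: a letter (x, True) stands for x,
  (x, False) for the inverse of x.\<close>

type_synonym 'x word = "('x \<times> bool) list"

inductive pres_eq :: "'x word set \<Rightarrow> 'x word \<Rightarrow> 'x word \<Rightarrow> bool" for R where
  pe_refl: "pres_eq R w w"
| pe_sym: "pres_eq R u v \<Longrightarrow> pres_eq R v u"
| pe_trans: "pres_eq R u v \<Longrightarrow> pres_eq R v w \<Longrightarrow> pres_eq R u w"
| pe_cancel: "pres_eq R (u @ [(x, b), (x, \<not> b)] @ v) (u @ v)"
| pe_rel: "r \<in> R \<Longrightarrow> pres_eq R (u @ r @ v) (u @ v)"

definition pres_class :: "'x word set \<Rightarrow> 'x word \<Rightarrow> 'x word set" where
  "pres_class R w = {v. pres_eq R w v}"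

text \<open>The group with generating set Gens and set of relators R
  (the relators are words in the letters of Gens).\<close>
definition pres_group :: "'x set \<Rightarrow> 'x word set \<Rightarrow> ('x word set) monoid" where
  "pres_group Gens R =
     \<lparr> carrier = pres_class R ` {w. set w \<subseteq> Gens \<times> UNIV},
       monoid.mult = (\<lambda>P Q. pres_class R ((SOME u. u \<in> P) @ (SOME v. v \<in> Q))),
       one = pres_class R [] \<rparr>"

definition coxeter_matrix :: "'x set \<Rightarrow> ('x \<Rightarrow> 'x \<Rightarrow> enat) \<Rightarrow> bool" where
  "coxeter_matrix S m \<longleftrightarrow>
     (\<forall>s\<in>S. \<forall>t\<in>S. m s t = m t s \<and> m s t \<ge> 1 \<and> (m s t = 1 \<longleftrightarrow> s = t))"

definition coxeter_relators :: "'x set \<Rightarrow> ('x \<Rightarrow> 'x \<Rightarrow> enat) \<Rightarrow> 'x word set" where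
  "coxeter_relators S m =
     {concat (replicate k [(s, True), (t, True)]) | s t k. s \<in> S \<and> t \<in> S \<and> m s t = enat k}"

definition coxeter_pres :: "'x set \<Rightarrow> ('x \<Rightarrow> 'x \<Rightarrow> enat) \<Rightarrow> ('x word set) monoid" where
  "coxeter_pres S m = pres_group S (coxeter_relators S m)"

definition coxeter_system :: "('g, 'b) monoid_scheme \<Rightarrow> 'g set \<Rightarrow> ('g \<Rightarrow> 'g \<Rightarrow> enat) \<Rightarrow> bool" where
  "coxeter_system G S m \<longleftrightarrow> group G \<and> S \<subseteq> carrier G \<and> coxeter_matrix S m \<and>
     (\<exists>\<phi>. \<phi> \<in> iso (coxeter_pres S m) G \<and>
          (\<forall>s\<in>S. \<phi> (pres_class (coxeter_relators S m) [(s, True)]) = s))"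

definition is_coxeter_group :: "('g, 'b) monoid_scheme \<Rightarrow> bool" where
  "is_coxeter_group G \<longleftrightarrow> (\<exists>S m. coxeter_system G S m)"

definition finite_coxeter_group :: "('g, 'b) monoid_scheme \<Rightarrow> bool" where
  "finite_coxeter_group G \<longleftrightarrow> is_coxeter_group G \<and> finite (carrier G)"

definition special_embedding ::
  "('c, 'x) monoid_scheme \<Rightarrow> ('a, 'y) monoid_scheme \<Rightarrow> ('c \<Rightarrow> 'a) \<Rightarrow> bool" where
  "special_embedding C A i \<longleftrightarrow> i \<in> hom C A \<and> inj_on i (carrier C) \<and>
     (\<exists>S m T. coxeter_system A S m \<and> T \<subseteq> S \<and> i ` carrier C = generate A T)"

definition amalgam ::
  "('a, 'x) monoid_scheme \<Rightarrow> ('c, 'z) monoid_scheme \<Rightarrow> ('b, 'y) monoid_scheme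
     \<Rightarrow> ('c \<Rightarrow> 'a) \<Rightarrow> ('c \<Rightarrow> 'b) \<Rightarrow> (('a + 'b) word set) monoid" where
  "amalgam A C B i j = pres_group (carrier A <+> carrier B)
     ({[(Inl a, True), (Inl a', True), (Inl (a \<otimes>\<^bsub>A\<^esub> a'), False)] | a a'.
          a \<in> carrier A \<and> a' \<in> carrier A}
      \<union> {[(Inr b, True), (Inr b', True), (Inr (b \<otimes>\<^bsub>B\<^esub> b'), False)] | b b'.
          b \<in> carrier B \<and> b' \<in> carrier B}
      \<union> {[(Inl (i c), True), (Inr (j c), False)] | c. c \<in> carrier C})"

datatype gterm = GVar nat | GOne | GMul gterm gterm | GInv gterm

datatype gqf = QEq gterm gterm | QNot gqf | QAnd gqf gqf | QOr gqf gqf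

fun gterm_vars :: "gterm \<Rightarrow> nat set" where
  "gterm_vars (GVar v) = {v}"
| "gterm_vars GOne = {}"
| "gterm_vars (GMul s t) = gterm_vars s \<union> gterm_vars t"
| "gterm_vars (GInv t) = gterm_vars t"

fun gqf_vars :: "gqf \<Rightarrow> nat set" where
  "gqf_vars (QEq s t) = gterm_vars s \<union> gterm_vars t"
| "gqf_vars (QNot p) = gqf_vars p"
| "gqf_vars (QAnd p q) = gqf_vars p \<union> gqf_vars q"
| "gqf_vars (QOr p q) = gqf_vars p \<union> gqf_vars q"

fun gterm_eval :: "('g, 'b) monoid_scheme \<Rightarrow> (nat \<Rightarrow> 'g) \<Rightarrow> gterm \<Rightarrow> 'g" where
  "gterm_eval G \<rho> (GVar v) = \<rho> v"
| "gterm_eval G \<rho> GOne = \<one>\<^bsub>G\<^esub>"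
| "gterm_eval G \<rho> (GMul s t) = gterm_eval G \<rho> s \<otimes>\<^bsub>G\<^esub> gterm_eval G \<rho> t"
| "gterm_eval G \<rho> (GInv t) = inv\<^bsub>G\<^esub> (gterm_eval G \<rho> t)"

fun gqf_sat :: "('g, 'b) monoid_scheme \<Rightarrow> (nat \<Rightarrow> 'g) \<Rightarrow> gqf \<Rightarrow> bool" where
  "gqf_sat G \<rho> (QEq s t) = (gterm_eval G \<rho> s = gterm_eval G \<rho> t)"
| "gqf_sat G \<rho> (QNot p) = (\<not> gqf_sat G \<rho> p)"
| "gqf_sat G \<rho> (QAnd p q) = (gqf_sat G \<rho> p \<and> gqf_sat G \<rho> q)"
| "gqf_sat G \<rho> (QOr p q) = (gqf_sat G \<rho> p \<or> gqf_sat G \<rho> q)"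

text \<open>The sentence  forall x_0..x_(n-1) exists y_0..y_(k-1). theta, where variable
  v < n denotes x_v and variable n + l denotes y_l.\<close>
definition AE_sentence :: "nat \<Rightarrow> nat \<Rightarrow> gqf \<Rightarrow> bool" where
  "AE_sentence n k \<theta> \<longleftrightarrow> gqf_vars \<theta> \<subseteq> {..<n + k}"

definition AE_holds :: "('g, 'b) monoid_scheme \<Rightarrow> nat \<Rightarrow> nat \<Rightarrow> gqf \<Rightarrow> bool" where
  "AE_holds G n k \<theta> \<longleftrightarrow>
     (\<forall>xs. (\<forall>v<n. xs v \<in> carrier G) \<longrightarrow>
        (\<exists>ys. (\<forall>l<k. ys l \<in> carrier G) \<and>
              gqf_sat G (\<lambda>v. if v < n then xs v else ys (v - n)) \<theta>))"

definition AE_equivalent :: "('g, 'b) monoid_scheme \<Rightarrow> ('h, 'c) monoid_scheme \<Rightarrow> bool" where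
  "AE_equivalent G H \<longleftrightarrow>
     (\<forall>n k \<theta>. AE_sentence n k \<theta> \<longrightarrow> (AE_holds G n k \<theta> \<longleftrightarrow> AE_holds H n k \<theta>))"

end

theory Submission
  imports Defs "HOL-Library.Product_Plus"
begin

text \<open>
  Adjoin to a group containing \<open>A\<close>, \<open>B\<close> and \<open>C\<close> two stable letters \<open>t\<close>, \<open>s\<close> centralizing \<open>C\<close>. Then
  \<open>W = \<langle>A, t B t\<^sup>-\<^sup>1\<rangle>\<close> is the amalgam of \<open>A\<close> and \<open>B\<close> over \<open>C\<close>, and \<open>E = \<langle>W, s\<rangle>\<close> is the HNN extension of \<open>W\<close> by a letter
  centralizing \<open>C\<close>. The group acts on the tree of the free group spanned by the conjugates of \<open>s\<close> and \<open>t\<close>.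

  \<^item> \<open>W\<close> and \<open>E\<close> are \<open>AE\<close>-equivalent by an argument in the style of Merzljakov: substitute for \<open>s\<close> an element \<open>n\<close> of \<open>W\<close>
  that centralizes \<open>C\<close> and whose syllables form a long sequence without repeated windows. Given a solution in \<open>W\<close> of a
  formula whose parameters contain \<open>n\<close>, some window of \<open>n\<close> is carried along rigidly, and replacing its
  middle edge by \<open>s\<close> turns this solution into one in \<open>E\<close>. Such an \<open>n\<close> exists as soon as \<open>A\<close> and \<open>B\<close> contain suitable elements
  normalizing \<open>C\<close>.

  \<^item> The extended groups do not see how \<open>C\<close> is twisted between the two factors: if \<open>u\<close> conjugates \<open>B'\<close> to \<open>B\<close> and
  normalizes \<open>C\<close>, and both amalgams contain elements inducing on \<open>C\<close> the effect of \<open>u\<close> and of its inverse, then the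
  extensions of the two amalgams are isomorphic, while the amalgams need not be.

  \<^item> In an amalgam of finite groups every finite subgroup fixes a vertex of the tree, and two vertex groups generate only if
  the vertices are adjacent. An isomorphism of the amalgams therefore restricts to the factors, and it preserves the
  existence of a nontrivial element of \<open>C\<close> that commutes with elements of order five in both factors.

  The example lives in the symmetric group \<open>S\<^sub>9\<close>, with \<open>A = S\<^sub>4 \<times> S\<^sub>5\<close>, \<open>B = S\<^sub>2 \<times> S\<^sub>6\<close>, \<open>B' = S\<^sub>6 \<times> S\<^sub>2\<close>,
  and \<open>C\<close> generated by the transpositions \<open>(0 1)\<close>, \<open>(2 3)\<close>, \<open>(4 5)\<close>, \<open>(6 7)\<close>. Groups are written additively throughout, as
  subgroups of noncommutative \<open>group_add\<close> types.
\<close>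

text \<open>The witnesses of an \<open>AE\<close> formula are known only after \<open>n\<close> has
  been fixed, and they may involve \<open>n\<close> in uncontrolled ways; only their number is
  bounded in advance. So \<open>n\<close> is made so long that, by counting, one of its edges is
  good: every element met that crosses a translate of this edge contains the whole window around it.
  As windows do not repeat, these translates can be followed, and inserting a conjugate of
  \<open>s\<close> at each of them is additive on the finite set in play. Injectivity is free, since
  putting \<open>s\<close> to 0 undoes the insertion. The letters \<open>t\<close> and
  \<open>s\<close> replace the Bass-Serre tree by the Cayley tree of a free group: vertices are
  reduced words, and crossing an edge is a condition on prefixes. The pattern comes in blocks of
  four because the chosen products have fourth power 0, so that \<open>n\<close> centralizes
  \<open>C\<close> and does not merely normalize it. The letter \<open>s\<close> hides the twist
  because it can absorb an element \<open>m\<close> of the amalgam that induces the twist on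
  \<open>C\<close>. A presentation is tested against permutations of its own classes only, because
  no type variable can range over all groups inside a statement.\<close>

lemmas grp = add.assoc minus_add diff_conv_add_uminus
lemmas grps = grp minus_minus minus_add_cancel add_minus_cancel left_minus right_minus
  add_0_left add_0_right minus_zero

section \<open>Reduced words and multiplication in a free group\<close>

definition linv :: "'x \<times> bool \<Rightarrow> 'x \<times> bool" where
  "linv l = (fst l, \<not> snd l)"

fun cons_red :: "'x \<times> bool \<Rightarrow> 'x word \<Rightarrow> 'x word" where
  "cons_red l [] = [l]"
| "cons_red l (m # v) = (if m = linv l then v else l # m # v)"

fun reduced :: "'x word \<Rightarrow> bool" where
  "reduced [] = True"
| "reduced [l] = True"
| "reduced (l # m # v) = (m \<noteq> linv l \<and> reduced (m # v))"

text \<open>For reduced \<open>v\<close> this is the reduced form of \<open>w @ v\<close>, whether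
  or not \<open>w\<close> is reduced.\<close>

definition lapp :: "'x word \<Rightarrow> 'x word \<Rightarrow> 'x word" where
  "lapp w v = foldr cons_red w v"

lemma linv_linv [simp]: "linv (linv l) = l"
  by (simp add: linv_def)

lemma linv_eq_iff: "linv l = m \<longleftrightarrow> l = linv m"
  by auto

lemma linv_neq [simp]: "l \<noteq> linv l"
  by (auto simp: linv_def prod_eq_iff)

lemma lapp_simps [simp]: "lapp [] v = v" "lapp (l # w) v = cons_red l (lapp w v)"
  by (simp_all add: lapp_def)

lemma lapp_append: "lapp (u @ w) v = lapp u (lapp w v)"
  by (simp add: lapp_def)

lemma reduced_Cons: "reduced (l # v) \<longleftrightarrow> reduced v \<and> (\<forall>m v'. v = m # v' \<longrightarrow> m \<noteq> linv l)"
  by (cases v) auto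

lemma reduced_cons_red [simp]: "reduced v \<Longrightarrow> reduced (cons_red l v)"
  by (cases v) (auto simp: reduced_Cons)

lemma reduced_lapp [simp]: "reduced v \<Longrightarrow> reduced (lapp w v)"
  by (induction w) auto

text \<open>If \<open>v\<close> starts with \<open>l\<close>, the inner step deletes it; reducedness
  keeps the rest from starting with \<open>linv l\<close>, so the outer step puts \<open>l\<close>
  back.\<close>

lemma cons_red_linv [simp]: "reduced v \<Longrightarrow> cons_red l (cons_red (linv l) v) = v"
  by (cases v) (auto simp: reduced_Cons neq_Nil_conv linv_eq_iff split: if_splits, (cases "tl v"; auto simp: reduced_Cons)+)

lemma cons_red_id: "reduced (l # v) \<Longrightarrow> cons_red l v = l # v"
  by (cases v) auto

lemma lapp_Nil [simp]: "reduced w \<Longrightarrow> lapp w [] = w"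
  by (induction w) (auto simp: reduced_Cons cons_red_id)

lemma lapp_id: "reduced (w @ v) \<Longrightarrow> lapp w v = w @ v"
  by (induction w) (auto simp: reduced_Cons cons_red_id)

lemma lapp_cons_red: "reduced z \<Longrightarrow> lapp (cons_red l w) z = cons_red l (lapp w z)"
  by (cases w) auto

lemma lapp_assoc: "reduced z \<Longrightarrow> lapp (lapp w v) z = lapp w (lapp v z)"
  by (induction w) (auto simp: lapp_cons_red)

definition winv :: "'x word \<Rightarrow> 'x word" where
  "winv w = rev (map linv w)"

lemma winv_simps [simp]: "winv [] = []" "winv (l # w) = winv w @ [linv l]" "length (winv w) = length w"
  by (simp_all add: winv_def)

lemma winv_append: "winv (u @ v) = winv v @ winv u"
  by (simp add: winv_def)

lemma winv_winv [simp]: "winv (winv w) = w"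
  by (simp add: winv_def rev_map[symmetric] comp_def)

lemma lapp_winv_left: "reduced v \<Longrightarrow> lapp (winv w) (lapp w v) = v"
proof (induction w arbitrary: v)
  case (Cons l w)
  have "cons_red (linv l) (cons_red l (lapp w v)) = lapp w v"
    using cons_red_linv[of "lapp w v" "linv l"] Cons.prems by simp
  then show ?case using Cons by (simp add: lapp_append)
qed simp

lemma reduced_append_Cons:
  "reduced (u @ l # v) \<longleftrightarrow> reduced (u @ [l]) \<and> reduced (l # v)"
  by (induction u rule: reduced.induct) (auto simp: reduced_Cons)

lemma reduced_appendD: "reduced (u @ v) \<Longrightarrow> reduced u \<and> reduced v"
  by (induction u rule: reduced.induct) (auto simp: reduced_Cons)

lemma reduced_snoc:
  "reduced (u @ [l]) \<longleftrightarrow> reduced u \<and> (u \<noteq> [] \<longrightarrow> last u \<noteq> linv l)"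
  by (induction u rule: reduced.induct) (auto simp: reduced_Cons linv_eq_iff)

lemma reduced_winv [simp]: "reduced (winv w) = reduced w"
proof -
  have "reduced w \<Longrightarrow> reduced (winv w)" for w :: "'x word"
  proof (induction w)
    case (Cons l w)
    then have *: "reduced (winv w)" by (simp add: reduced_Cons)
    show ?case
    proof (cases w)
      case (Cons m v)
      then have "m \<noteq> linv l" using \<open>reduced (l # w)\<close> by simp
      then have "linv m \<noteq> l" by auto
      then show ?thesis
        using * reduced_snoc[of "winv w" "linv l"] by (simp add: Cons del: append_assoc)
    qed simp
  qed simp
  from this[of w] this[of "winv w"] show ?thesis by auto
qed

lemma reduced_take: "reduced w \<Longrightarrow> reduced (take i w)"
  by (metis append_take_drop_id reduced_appendD)

lemma reduced_drop: "reduced w \<Longrightarrow> reduced (drop i w)"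
  by (metis append_take_drop_id reduced_appendD)

subsection \<open>A free group extended by a group permuting its basis\<close>

type_synonym 'h letter = "bool \<times> 'h set"

definition xact :: "'h::group_add \<Rightarrow> 'h letter \<Rightarrow> 'h letter" where
  "xact h x = (fst x, (+) h ` snd x)"

definition lact :: "'h::group_add \<Rightarrow> 'h letter \<times> bool \<Rightarrow> 'h letter \<times> bool" where
  "lact h l = (xact h (fst l), snd l)"

lemma xact_0 [simp]: "xact 0 x = x"
  by (simp add: xact_def)

lemma xact_add: "xact h (xact k x) = xact (h + k) x"
  by (simp add: xact_def image_image add.assoc)

lemma lact_0 [simp]: "lact 0 l = l"
  by (simp add: lact_def)

lemma lact_0_fun [simp]: "lact 0 = id"
  by (rule ext) simp

lemma lact_add: "lact h (lact k l) = lact (h + k) l"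
  by (simp add: lact_def xact_add)

lemma lact_comp: "lact h \<circ> lact k = lact (h + k)"
  by (rule ext) (simp add: lact_add)

lemma lact_inj [simp]: "lact h l = lact h m \<longleftrightarrow> l = m"
  by (metis lact_0 lact_add left_minus)

lemma inj_lact [simp]: "inj (lact h)"
  by (rule injI) simp

lemma lact_linv: "lact h (linv l) = linv (lact h l)"
  by (simp add: lact_def linv_def)

lemma snd_lact [simp]: "snd (lact h l) = snd l"
  by (simp add: lact_def)

lemma map_cons_red: "map (lact h) (cons_red l v) = cons_red (lact h l) (map (lact h) v)"
  by (cases v) (auto simp: lact_linv[symmetric])

lemma map_lapp: "map (lact h) (lapp w v) = lapp (map (lact h) w) (map (lact h) v)"
  by (induction w) (auto simp: map_cons_red)

lemma reduced_map_lact [simp]: "reduced (map (lact h) w) = reduced w"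
  by (induction w rule: reduced.induct) (auto simp: lact_linv[symmetric])

lemma map_winv: "map (lact h) (winv w) = winv (map (lact h) w)"
  by (simp add: winv_def rev_map lact_linv)

text \<open>The semidirect product of the free group on the letters with the group \<open>'h\<close>
  that permutes them: a pair is the word followed by the element.\<close>

typedef (overloaded) 'h gg = "{(w :: ('h letter) word, h :: 'h). reduced w}"
  by (rule exI[of _ "([], undefined)"]) simp

definition wd :: "'h gg \<Rightarrow> ('h letter) word" where "wd g = fst (Rep_gg g)"
definition hp :: "'h gg \<Rightarrow> 'h" where "hp g = snd (Rep_gg g)"
definition mk :: "('h letter) word \<Rightarrow> 'h \<Rightarrow> 'h gg" where "mk w h = Abs_gg (w, h)"

lemma reduced_wd [simp]: "reduced (wd g)"
  using Rep_gg[of g] by (auto simp: wd_def)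

lemma wd_mk [simp]: "reduced w \<Longrightarrow> wd (mk w h) = w"
  by (simp add: wd_def mk_def Abs_gg_inverse)

lemma hp_mk [simp]: "reduced w \<Longrightarrow> hp (mk w h) = h"
  by (simp add: hp_def mk_def Abs_gg_inverse)

lemma gg_eqI: "wd g = wd g' \<Longrightarrow> hp g = hp g' \<Longrightarrow> g = g'"
  by (metis Rep_gg_inject hp_def prod_eqI wd_def)

instantiation gg :: (group_add) group_add
begin

definition zero_gg :: "'a gg" where "0 = mk [] 0"
definition plus_gg :: "'a gg \<Rightarrow> 'a gg \<Rightarrow> 'a gg" where
  "g + g' = mk (lapp (wd g) (map (lact (hp g)) (wd g'))) (hp g + hp g')"
definition uminus_gg :: "'a gg \<Rightarrow> 'a gg" where
  "- g = mk (winv (map (lact (- hp g)) (wd g))) (- hp g)"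
definition minus_gg :: "'a gg \<Rightarrow> 'a gg \<Rightarrow> 'a gg" where
  "g - (g' :: 'a gg) = g + - g'"

lemma wd_plus_gg: "wd (g + g') = lapp (wd g) (map (lact (hp g)) (wd g'))" for g :: "'a gg"
  by (simp add: plus_gg_def)

lemma hp_plus_gg: "hp (g + g') = hp g + hp g'" for g :: "'a gg"
  by (simp add: plus_gg_def)

instance
proof
  fix a b c :: "'a gg"
  show "a + b + c = a + (b + c)"
    by (rule gg_eqI)
      (simp_all add: wd_plus_gg hp_plus_gg map_lapp lapp_assoc lact_comp add.assoc)
  show "0 + a = a"
    by (rule gg_eqI) (simp_all add: wd_plus_gg hp_plus_gg zero_gg_def)
  show "a + 0 = a"
    by (rule gg_eqI) (simp_all add: wd_plus_gg hp_plus_gg zero_gg_def)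
  show "- a + a = 0"
  proof (rule gg_eqI)
    show "wd (- a + a) = wd (0::'a gg)"
      using lapp_winv_left[of "[]" "map (lact (- hp a)) (wd a)"]
      by (simp add: wd_plus_gg zero_gg_def uminus_gg_def)
  qed (simp add: hp_plus_gg zero_gg_def uminus_gg_def)
  show "a + - b = a - b"
    by (simp add: minus_gg_def)
qed

end

lemma wd_0 [simp]: "wd (0 :: 'h::group_add gg) = []" and hp_0 [simp]: "hp (0 :: 'h::group_add gg) = 0"
  by (simp_all add: zero_gg_def)

lemma wd_plus: "wd (g + g') = lapp (wd g) (map (lact (hp g)) (wd g'))" for g :: "'h::group_add gg"
  by (simp add: plus_gg_def)

lemma hp_plus [simp]: "hp (g + g') = hp g + hp g'" for g :: "'h::group_add gg"
  by (simp add: plus_gg_def)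

lemma wd_uminus: "wd (- g) = winv (map (lact (- hp g)) (wd g))" for g :: "'h::group_add gg"
  by (simp add: uminus_gg_def)

lemma hp_uminus [simp]: "hp (- g) = - hp g" for g :: "'h::group_add gg"
  by (simp add: uminus_gg_def)

lemma hp_diff [simp]: "hp (g - g') = hp g - hp g'" for g :: "'h::group_add gg"
  by (simp add: diff_conv_add_uminus del: add_uminus_conv_diff)

definition hh :: "'h \<Rightarrow> 'h gg" where "hh h = mk [] h"
definition vx :: "('h::group_add letter) word \<Rightarrow> 'h gg" where "vx p = mk p 0"
definition lt :: "'h::group_add letter \<Rightarrow> 'h gg" where "lt x = mk [(x, True)] 0"

lemma wd_hh [simp]: "wd (hh h) = []" and hp_hh [simp]: "hp (hh h) = h"
  by (simp_all add: hh_def)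

lemma wd_vx [simp]: "reduced p \<Longrightarrow> wd (vx p) = p" and hp_vx [simp]: "reduced p \<Longrightarrow> hp (vx p) = 0"
  by (simp_all add: vx_def)

lemma wd_lt [simp]: "wd (lt x) = [(x, True)]" and hp_lt [simp]: "hp (lt x) = 0"
  by (simp_all add: lt_def)

lemma hh_0 [simp]: "hh 0 = (0 :: 'h::group_add gg)"
  by (rule gg_eqI) simp_all

lemma hh_add: "hh (h + k) = hh h + (hh k :: 'h::group_add gg)"
  by (rule gg_eqI) (simp_all add: wd_plus)

lemma hh_uminus: "hh (- h) = - (hh h :: 'h::group_add gg)"
  by (rule gg_eqI) (simp_all add: wd_uminus)

lemma hh_inj [simp]: "hh h = hh k \<longleftrightarrow> h = k"
  by (metis hp_hh)

lemma wd_Nil_iff: "wd g = [] \<longleftrightarrow> (\<exists>h. g = hh h)"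
  by (metis gg_eqI hp_hh wd_hh)

lemma wd_add_hh [simp]: "wd (g + hh h) = wd (g :: 'h::group_add gg)"
  by (simp add: wd_plus)

lemma hh_lt: "hh h + lt x + - hh h = (lt (xact h x) :: 'h::group_add gg)"
  by (rule gg_eqI) (simp_all add: wd_plus wd_uminus lact_def del: add_uminus_conv_diff)

subsection \<open>Cocycles along paths\<close>

text \<open>The vertices of the tree are the reduced words, that is, the left cosets of
  \<open>range hh\<close>, which is the stabilizer of the root \<open>[]\<close>.\<close>

definition vact :: "'h::group_add gg \<Rightarrow> ('h letter) word \<Rightarrow> ('h letter) word" where
  "vact g p = lapp (wd g) (map (lact (hp g)) p)"

type_synonym 'h edge = "('h letter) word \<times> 'h letter"

definition eact :: "'h::group_add gg \<Rightarrow> 'h edge \<Rightarrow> 'h edge" where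
  "eact g e = (vact g (fst e), xact (hp g) (snd e))"

lemma vact_wd: "vact g (wd k) = wd (g + k)"
  by (simp add: vact_def wd_plus)

lemma reduced_vact [simp]: "reduced p \<Longrightarrow> reduced (vact g p)"
  by (simp add: vact_def)

lemma vact_0 [simp]: "vact 0 p = p"
  by (simp add: vact_def)

lemma vact_Nil [simp]: "vact g [] = wd g"
  by (simp add: vact_def)

lemma vact_add: "reduced p \<Longrightarrow> vact (g + k) p = vact g (vact k p)"
  by (simp add: vact_def wd_plus lapp_assoc map_lapp lact_comp)

lemma eact_0 [simp]: "eact 0 e = e"
  by (simp add: eact_def)

lemma eact_add: "reduced (fst e) \<Longrightarrow> eact (g + k) e = eact g (eact k e)"
  by (simp add: eact_def vact_add xact_add)

lemma reduced_eact [simp]: "reduced (fst e) \<Longrightarrow> reduced (fst (eact g e))"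
  by (simp add: eact_def)

lemma eact_minus [simp]: "reduced (fst e) \<Longrightarrow> eact (- g) (eact g e) = e" "reduced (fst e) \<Longrightarrow> eact g (eact (- g) e) = e"
  by (simp_all add: eact_add[symmetric])

lemma vact_lapp: "reduced v \<Longrightarrow> vact g (lapp p v) = lapp (vact g p) (map (lact (hp g)) v)"
  by (simp add: vact_def map_lapp lapp_assoc)

text \<open>Every edge is stored with its positive orientation, so a negative letter crosses the
  edge that starts at the vertex it leads to.\<close>

definition ledge :: "('h letter) word \<Rightarrow> 'h letter \<times> bool \<Rightarrow> 'h edge" where
  "ledge p l = (if snd l then p else lapp p [l], fst l)"

fun Phi :: "('h edge \<Rightarrow> 'k::group_add) \<Rightarrow> ('h letter) word \<Rightarrow> ('h letter) word \<Rightarrow> 'k" where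
  "Phi Z p [] = 0"
| "Phi Z p (l # w) = (if snd l then Z (ledge p l) else - Z (ledge p l)) + Phi Z (lapp p [l]) w"

lemma reduced_ledge [simp]: "reduced p \<Longrightarrow> reduced (fst (ledge p l))"
  by (simp add: ledge_def)

lemma lapp_linv_right: "reduced p \<Longrightarrow> lapp (lapp p [l]) [linv l] = p"
  by (simp add: lapp_assoc)

lemma ledge_linv: "reduced p \<Longrightarrow> ledge (lapp p [l]) (linv l) = ledge p l"
  using lapp_linv_right[of p l] by (auto simp: ledge_def linv_def)

text \<open>The two steps cross one edge in opposite directions and contribute a value and its
  negative. Hence the sum along a path survives reduction of the path.\<close>

lemma Phi_cancel: "reduced p \<Longrightarrow> Phi Z p (l # linv l # w) = Phi Z p w"
  using ledge_linv[of p l] lapp_linv_right[of p l]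
  by (auto simp: linv_def add.assoc[symmetric])

lemma Phi_cons_red: "reduced p \<Longrightarrow> Phi Z p (cons_red l v) = Phi Z p (l # v)"
  by (cases v) (auto simp: Phi_cancel simp del: Phi.simps)

definition pend :: "'x word \<Rightarrow> 'x word \<Rightarrow> 'x word" where
  "pend p w = foldl (\<lambda>p l. lapp p [l]) p w"

lemma pend_simps [simp]: "pend p [] = p" "pend p (l # w) = pend (lapp p [l]) w"
  by (simp_all add: pend_def)

lemma pend_lapp: "reduced w \<Longrightarrow> reduced p \<Longrightarrow> pend p w = lapp p w"
proof (induction w arbitrary: p)
  case (Cons l w)
  then have "reduced w" by (simp add: reduced_Cons)
  with Cons show ?case
    by (simp add: lapp_assoc cons_red_id)
qed simp

lemma Phi_append: "reduced p \<Longrightarrow> Phi Z p (w @ v) = Phi Z p w + Phi Z (pend p w) v"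
  by (induction w arbitrary: p) (auto simp: add.assoc)

lemma Phi_lapp: "reduced p \<Longrightarrow> Phi Z p (lapp w v) = Phi Z p (w @ v)"
  by (induction w arbitrary: p) (auto simp: Phi_cons_red)

lemma ledge_act: "reduced p \<Longrightarrow> ledge (vact g p) (lact (hp g) l) = eact g (ledge p l)"
  by (simp add: ledge_def eact_def lact_def vact_lapp)

lemma Phi_act: "reduced p \<Longrightarrow> Phi Z (vact g p) (map (lact (hp g)) w) = Phi (Z \<circ> eact g) p w"
proof (induction w arbitrary: p)
  case (Cons l w)
  have "lapp (vact g p) [lact (hp g) l] = vact g (lapp p [l])"
    by (simp add: vact_lapp)
  then show ?case using Cons by (simp add: ledge_act)
qed simp

fun trav :: "('h letter) word \<Rightarrow> ('h letter) word \<Rightarrow> ('h edge) set" where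
  "trav p [] = {}"
| "trav p (l # w) = insert (ledge p l) (trav (lapp p [l]) w)"

lemma Phi_cong: "(\<And>e. e \<in> trav p w \<Longrightarrow> Z e = Z' e) \<Longrightarrow> Phi Z p w = Phi Z' p w"
  by (induction w arbitrary: p) auto

lemma trav_reduced: "reduced p \<Longrightarrow> e \<in> trav p w \<Longrightarrow> reduced (fst e)"
proof (induction w arbitrary: p)
  case (Cons l w)
  then show ?case using Cons.IH[of "lapp p [l]"] by auto
qed simp

lemma hom_0:
  assumes "\<And>x y. f (x + y) = f x + f y"
  shows "f (0::'a::group_add) = (0::'b::group_add)"
proof -
  have "f 0 + f 0 = f 0 + 0" using assms[of 0 0] by simp
  then show ?thesis by (simp only: add_left_cancel)
qed

lemma hom_uminus:
  assumes "\<And>x y. f (x + y) = f x + (f y :: 'b::group_add)"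
  shows "f (- x :: 'a::group_add) = - f x"
proof -
  have "f (- x) + f x = 0" using assms[of "- x" x] hom_0[of f] assms by simp
  then show ?thesis by (metis add.inverse_unique minus_minus)
qed

lemma Phi_hom:
  assumes "\<And>x y. f (x + y) = f x + f y"
  shows "Phi (\<lambda>e. f (Z e)) p w = f (Phi Z p w)"
proof -
  have "f 0 = 0" "\<And>x. f (- x) = - f x"
    using hom_0[of f] hom_uminus[of f] assms by auto
  then show ?thesis
    by (induction w arbitrary: p) (simp_all add: assms)
qed

definition coc :: "('h::group_add edge \<Rightarrow> 'k::group_add) \<Rightarrow> 'h gg \<Rightarrow> 'k" where
  "coc Z g = Phi Z [] (wd g)"

text \<open>Up to backtracking, the path to \<open>g + k\<close> is the path to \<open>g\<close>
  followed by the \<open>g\<close>-translate of the path to \<open>k\<close>. If \<open>Z\<close>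
  turns translation by \<open>g\<close> into conjugation by \<open>g\<close>, this makes
  \<open>coc Z g + g\<close> additive, which is how the insertion of \<open>s\<close> will
  work.\<close>

lemma coc_add: "coc Z (g + k) = coc Z g + coc (Z \<circ> eact g) k"
proof -
  have "Phi Z [] (wd (g + k)) = Phi Z [] (wd g) + Phi Z (wd g) (map (lact (hp g)) (wd k))"
    by (simp add: wd_plus Phi_lapp Phi_append pend_lapp)
  also have "Phi Z (wd g) (map (lact (hp g)) (wd k)) = Phi (Z \<circ> eact g) [] (wd k)"
    using Phi_act[of "[]" Z g "wd k"] by simp
  finally show ?thesis by (simp add: coc_def)
qed

subsection \<open>Substitution homomorphisms\<close>

fun evt :: "('x \<Rightarrow> 'k::group_add) \<Rightarrow> 'x word \<Rightarrow> 'k" where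
  "evt f [] = 0"
| "evt f (l # w) = (if snd l then f (fst l) else - f (fst l)) + evt f w"

lemma evt_append [simp]: "evt f (u @ v) = evt f u + evt f v"
  by (induction u) (auto simp: add.assoc)

lemma evt_cons_red: "evt f (cons_red l v) = evt f (l # v)"
  by (cases v) (auto simp: linv_def add.assoc[symmetric])

lemma evt_lapp: "evt f (lapp u v) = evt f (u @ v)"
  by (induction u) (auto simp: evt_cons_red)

definition lam :: "'h set \<Rightarrow> (bool \<Rightarrow> 'h gg) \<Rightarrow> ('h::group_add) letter \<Rightarrow> 'h gg" where
  "lam C f x = (if \<exists>h. snd x = (+) h ` C
     then (let h = (SOME h. snd x = (+) h ` C) in hh h + f (fst x) + - hh h) else 0)"

definition sub :: "'h set \<Rightarrow> (bool \<Rightarrow> 'h gg) \<Rightarrow> ('h::group_add) gg \<Rightarrow> 'h gg" where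
  "sub C f g = evt (lam C f) (wd g) + hh (hp g)"

definition is_subgroup :: "'g::group_add set \<Rightarrow> bool" where
  "is_subgroup U \<longleftrightarrow> 0 \<in> U \<and> (\<forall>x\<in>U. \<forall>y\<in>U. x + y \<in> U) \<and> (\<forall>x\<in>U. - x \<in> U)"

definition centralizes :: "'g::group_add \<Rightarrow> 'g set \<Rightarrow> bool" where
  "centralizes x U \<longleftrightarrow> (\<forall>c\<in>U. c + x = x + c)"

lemma coset_eqD:
  assumes "is_subgroup C" "(+) h ` C = (+) k ` C"
  shows "- h + k \<in> C"
proof -
  have "k \<in> (+) k ` C"
    using assms(1) by (auto simp: is_subgroup_def image_iff intro: bexI[of _ 0])
  then obtain c where "c \<in> C" "k = h + c"
    using assms(2) by auto
  then show ?thesis by (simp add: add.assoc[symmetric])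
qed

lemma coset_eqI:
  assumes "is_subgroup C" "- h + k \<in> C"
  shows "(+) h ` C = (+) k ` C"
proof -
  have *: "(+) k ` C \<subseteq> (+) h ` C" if "- h + k \<in> C" for h k
  proof
    fix x assume "x \<in> (+) k ` C"
    then obtain c where "c \<in> C" "x = k + c" by auto
    then have "x = h + ((- h + k) + c)" "(- h + k) + c \<in> C"
      using that assms(1) by (auto simp: add.assoc is_subgroup_def)
    then show "x \<in> (+) h ` C" by blast
  qed
  have "- (- h + k) \<in> C"
    using assms by (auto simp: is_subgroup_def)
  then have "- k + h \<in> C" by (simp only: minus_add minus_minus)
  then show ?thesis using * assms(2) by blast
qed

lemma lam_coset:
  assumes C: "is_subgroup C" and f: "centralizes (f b) (hh ` C)"
  shows "lam C f (b, (+) h ` C) = hh h + f b + - hh h"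
proof -
  define k where "k = (SOME k. (+) h ` C = (+) k ` C)"
  have "(+) h ` C = (+) k ` C" unfolding k_def by (rule someI[of _ h]) simp
  then have "- h + k \<in> C" using C coset_eqD by blast
  then have "hh (- h + k) + f b = f b + hh (- h + k)"
    using f by (auto simp: centralizes_def)
  then have "hh k + f b = hh h + f b + hh (- h) + hh k"
    by (simp add: hh_add hh_uminus grp del: add_uminus_conv_diff) (metis minus_add_cancel add.assoc)
  then have "hh k + f b + - hh k = hh h + f b + - hh h"
    by (simp add: hh_uminus grp del: add_uminus_conv_diff)
  moreover have "lam C f (b, (+) h ` C) = hh k + f b + - hh k"
    by (auto simp: lam_def k_def Let_def)
  ultimately show ?thesis by simp
qed

lemma lam_xact:
  assumes C: "is_subgroup C" and f: "\<And>b. centralizes (f b) (hh ` C)"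
  shows "lam C f (xact h x) = hh h + lam C f x + - hh h"
proof (cases "\<exists>k. snd x = (+) k ` C")
  case True
  then obtain b k where x: "x = (b, (+) k ` C)" by (metis prod.collapse)
  have "xact h x = (b, (+) (h + k) ` C)"
    by (simp add: x xact_def image_image add.assoc)
  then have "lam C f (xact h x) = hh (h + k) + f b + - hh (h + k)"
    by (simp only: lam_coset[OF C f])
  also have "\<dots> = hh h + lam C f x + - hh h"
    by (simp only: x lam_coset[OF C f] hh_add grps)
  finally show ?thesis .
next
  case False
  moreover have "\<not> (\<exists>k. snd (xact h x) = (+) k ` C)"
  proof
    assume "\<exists>k. snd (xact h x) = (+) k ` C"
    then obtain k where "(+) h ` snd x = (+) k ` C" by (auto simp: xact_def)
    then have "(+) (- h) ` (+) h ` snd x = (+) (- h + k) ` C"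
      by (simp add: image_image add.assoc)
    then have "snd x = (+) (- h + k) ` C" by (simp add: image_image add.assoc[symmetric])
    then show False using False by blast
  qed
  ultimately show ?thesis by (simp add: lam_def)
qed

lemma evt_lam_map:
  assumes C: "is_subgroup C" and f: "\<And>b. centralizes (f b) (hh ` C)"
  shows "evt (lam C f) (map (lact h) w) = hh h + evt (lam C f) w + - hh h"
  proof (induction w)
  case (Cons l w)
  then show ?case
    by (cases "snd l") (simp_all only: list.map evt.simps lact_def fst_conv snd_conv if_True if_False lam_xact[OF C f] grps)
qed simp

lemma sub_add:
  assumes C: "is_subgroup C" and f: "\<And>b. centralizes (f b) (hh ` C)"
  shows "sub C f (g + k) = sub C f g + sub C f k"
  by (simp only: sub_def wd_plus hp_plus evt_lapp evt_append evt_lam_map[OF C f] hh_add grps)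

lemma sub_hh [simp]: "sub C f (hh h) = hh h"
  by (simp add: sub_def)

lemma sub_lt: 
  assumes C: "is_subgroup C" and f: "centralizes (f b) (hh ` C)"
  shows "sub C f (lt (b, C)) = f b"
  using lam_coset[where h = 0 and f = f and b = b, OF C f] by (simp add: sub_def)

inductive_set gen :: "'g::group_add set \<Rightarrow> 'g set" for S where
  gen_0: "0 \<in> gen S"
| gen_add: "x \<in> S \<Longrightarrow> y \<in> gen S \<Longrightarrow> x + y \<in> gen S"
| gen_minus: "x \<in> S \<Longrightarrow> y \<in> gen S \<Longrightarrow> - x + y \<in> gen S"

lemma gen_base: "x \<in> S \<Longrightarrow> x \<in> gen S"
  using gen_add[of x S 0] gen_0 by auto

lemma gen_plus: "x \<in> gen S \<Longrightarrow> y \<in> gen S \<Longrightarrow> x + y \<in> gen S"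
  by (induction rule: gen.induct) (auto simp: add.assoc intro: gen.intros)

lemma gen_uminus: "x \<in> gen S \<Longrightarrow> - x \<in> gen S"
proof (induction rule: gen.induct)
  case (gen_add x y)
  have "- x \<in> gen S" using gen_minus[OF gen_add.hyps(1) gen_0] by simp
  then show ?case using gen_plus[OF gen_add.IH] by (simp only: minus_add)
next
  case (gen_minus x y)
  show ?case using gen_plus[OF gen_minus.IH gen_base[OF gen_minus.hyps(1)]]
    by (simp only: minus_add minus_minus)
qed (simp add: gen_0)

lemma subgroup_gen [simp]: "is_subgroup (gen S)"
  by (auto simp: is_subgroup_def gen_0 gen_plus gen_uminus)

lemma gen_least: "is_subgroup U \<Longrightarrow> S \<subseteq> U \<Longrightarrow> gen S \<subseteq> U"
proof
  fix x assume "is_subgroup U" "S \<subseteq> U" "x \<in> gen S"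
  from this(3,1,2) show "x \<in> U"
    by (induction rule: gen.induct) (auto simp: is_subgroup_def)
qed

lemma gen_mono: "S \<subseteq> T \<Longrightarrow> gen S \<subseteq> gen T"
  by (meson gen_base gen_least subgroup_gen subset_iff)

lemma hom_gen:
  assumes "\<And>x y. f (x + y) = f x + (f y :: 'b::group_add)" "\<And>x. x \<in> S \<Longrightarrow> f x \<in> U" "is_subgroup U" "x \<in> gen S"
  shows "f (x :: 'a::group_add) \<in> U"
  using assms(4)
  by (induction rule: gen.induct)
    (use assms(1-3) hom_0[of f] hom_uminus[of f] in \<open>auto simp: is_subgroup_def\<close>)

lemma hom_gen_eq:
  assumes "\<And>x y. f (x + y) = f x + (f y :: 'b::group_add)" "\<And>x y. g (x + y) = g x + (g y :: 'b::group_add)"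
    "\<And>x. x \<in> S \<Longrightarrow> f x = g x" "x \<in> gen S"
  shows "f (x :: 'a::group_add) = g x"
  using assms(4)
  by (induction rule: gen.induct)
    (use assms(1-3) hom_0[of f] hom_uminus[of f] hom_0[of g] hom_uminus[of g] in auto)

subsection \<open>A sequence without repeated windows\<close>

text \<open>Blocks of four consecutive indices carry one mark, and the block numbers that are marked
  are the nonzero squares. The gaps between them strictly grow, so a long part of the pattern
  reveals its position.\<close>

definition sqd :: "nat \<Rightarrow> bool" where
  "sqd k \<longleftrightarrow> (\<exists>r\<ge>1. k div 4 = r * r)"

lemma sqd_start: "r \<ge> 1 \<Longrightarrow> sqd (4 * (r * r))"
  by (auto simp: sqd_def)

lemma not_sqd_before_start:
  assumes "r \<ge> 1"
  shows "\<not> sqd (4 * (r * r) - 1)"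
proof
  assume "sqd (4 * (r * r) - 1)"
  then obtain r' where r': "r' \<ge> 1" "(4 * (r * r) - 1) div 4 = r' * r'" by (auto simp: sqd_def)
  have "r * r \<ge> 1" using assms by simp
  then have "(4 * (r * r) - 1) div 4 = r * r - 1" by linarith
  then have *: "r * r = r' * r' + 1" using r' \<open>r * r \<ge> 1\<close> by linarith
  then have "r' < r" by (metis add_lessD1 less_add_one mult_less_cancel2 mult_le_mono not_le_imp_less not_less)
  then have "(r' + 1) * (r' + 1) \<le> r * r" by (intro mult_le_mono) auto
  then show False using * r'(1) by (simp add: algebra_simps)
qed

lemma sqd_startD:
  assumes "sqd x" "\<not> sqd (x - 1)" "x \<ge> 1"
  shows "\<exists>r\<ge>1. x = 4 * (r * r)"
proof -
  obtain r where r: "r \<ge> 1" "x div 4 = r * r" using assms(1) by (auto simp: sqd_def)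
  then have "(x - 1) div 4 \<noteq> x div 4" using assms(2) by (auto simp: sqd_def)
  moreover have "(y - 1) div 4 \<noteq> y div 4 \<Longrightarrow> y \<ge> 1 \<Longrightarrow> y = 4 * (y div 4)" for y :: nat
    by presburger
  ultimately have "x = 4 * (r * r)" using r(2) assms(3) by metis
  with r show ?thesis by blast
qed

text \<open>The window contains the starts of the marked blocks \<open>r * r\<close> and
  \<open>(r + 1) * (r + 1)\<close>. A positive shift that preserves the pattern takes them to starts
  of the blocks \<open>r' * r'\<close> and \<open>r'' * r''\<close> with \<open>r' > r\<close>; but
  then these two squares differ by at least \<open>2 * r' + 1\<close>, while the shift keeps the
  difference \<open>2 * r + 1\<close>.\<close>

lemma sqd_window_less:
  assumes eq: "\<And>i. i < l \<Longrightarrow> sqd (a + i) = sqd (b + i)"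
    and l: "l > 16 * M" and M: "a + l \<le> 4 * (M * M)" and "a < b"
  shows False
proof -
  have "M \<ge> 1" using M l by (cases M) auto
  \<comment> \<open>The marked block has to start strictly after \<open>a\<close>, so that the
    unmarked index just before its start is still in the window.\<close>
  define r where "r = (LEAST r. r \<ge> 1 \<and> 4 * (r * r) > a)"
  have ex: "M \<ge> 1 \<and> 4 * (M * M) > a" using M l \<open>M \<ge> 1\<close> by linarith
  then have r: "r \<ge> 1" "4 * (r * r) > a" and rM: "r \<le> M"
    unfolding r_def using LeastI[of "\<lambda>r. r \<ge> 1 \<and> 4 * (r * r) > a"] Least_le[of "\<lambda>r. r \<ge> 1 \<and> 4 * (r * r) > a"] by auto
  \<comment> \<open>By minimality the block for \<open>r - 1\<close> starts at or before
    \<open>a\<close>, and the squares of \<open>r + 1\<close> and \<open>r - 1\<close> differ by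
    \<open>4 * r\<close>.\<close>
  have up: "4 * ((r + 1) * (r + 1)) \<le> a + 16 * r"
  proof (cases "r = 1")
    case False
    then obtain k where k: "r = Suc k" "k \<ge> 1" using r by (cases r) auto
    have "\<not> (k \<ge> 1 \<and> 4 * (k * k) > a)"
      using not_less_Least[of k "\<lambda>r. r \<ge> 1 \<and> 4 * (r * r) > a"] k(1)[unfolded r_def] by linarith
    then have "4 * (k * k) \<le> a" using k by linarith
    then show ?thesis by (simp add: k algebra_simps)
  qed simp
  define \<delta> where "\<delta> = b - a"
  have \<delta>: "\<delta> > 0" "b = a + \<delta>" using \<open>a < b\<close> by (auto simp: \<delta>_def)
  have tr: "sqd (x + \<delta>) = sqd x" if "a \<le> x" "x < a + l" for x
    using eq[of "x - a"] that \<delta> by (simp add: add.commute add.left_commute)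
  have start: "\<exists>r'\<ge>1. 4 * (k * k) + \<delta> = 4 * (r' * r')" if k: "k \<ge> 1" "a < 4 * (k * k)" "4 * (k * k) < a + l" for k
  proof (rule sqd_startD)
    show "sqd (4 * (k * k) + \<delta>)" using tr[of "4 * (k * k)"] sqd_start k by simp
    have "4 * (k * k) + \<delta> - 1 = 4 * (k * k) - 1 + \<delta>" using k by simp
    then show "\<not> sqd (4 * (k * k) + \<delta> - 1)"
      using tr[of "4 * (k * k) - 1"] not_sqd_before_start[of k] k by simp
  qed (use \<delta> in simp)
  have rr: "r * r \<le> (r + 1) * (r + 1)" by (intro mult_le_mono) auto
  have "16 * r < l" using rM l by simp
  obtain r' where r': "r' \<ge> 1" "4 * (r * r) + \<delta> = 4 * (r' * r')"
    using start[of r] r up rr \<open>16 * r < l\<close> by fastforce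
  obtain r'' where r'': "r'' \<ge> 1" "4 * ((r + 1) * (r + 1)) + \<delta> = 4 * (r'' * r'')"
    using start[of "r + 1"] r up rr \<open>16 * r < l\<close> by fastforce
  have "r < r'"
  proof (rule ccontr)
    assume "\<not> r < r'"
    then have "r' * r' \<le> r * r" by (intro mult_le_mono) auto
    then show False using r' \<delta> by linarith
  qed
  have eq2: "r'' * r'' = r' * r' + 2 * r + 1" using r' r'' by (simp add: algebra_simps)
  have "r' < r''"
  proof (rule ccontr)
    assume "\<not> r' < r''"
    then have "r'' * r'' \<le> r' * r'" by (intro mult_le_mono) auto
    then show False using eq2 by linarith
  qed
  then have "(r' + 1) * (r' + 1) \<le> r'' * r''" by (intro mult_le_mono) auto
  then show False using eq2 \<open>r < r'\<close> by (simp add: algebra_simps)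
qed

lemma sqd_window:
  assumes eq: "\<And>i. i < l \<Longrightarrow> sqd (a + i) = sqd (b + i)"
    and l: "l > 16 * M" and M: "a + l \<le> 4 * (M * M)" "b + l \<le> 4 * (M * M)"
  shows "a = b"
  using sqd_window_less[of l a b M] sqd_window_less[of l b a M] assms by (metis nat_neq_iff)

subsection \<open>Edges on root paths\<close>

definition pe :: "('h letter) word \<Rightarrow> nat \<Rightarrow> 'h edge" where
  "pe w i = ledge (take i w) (w ! i)"

text \<open>The endpoint farther from the root. It determines the edge, which turns equality of
  edges into equality of prefixes.\<close>

definition child :: "'h edge \<Rightarrow> ('h letter) word" where
  "child e = (if fst e \<noteq> [] \<and> last (fst e) = (snd e, False) then fst e else fst e @ [(snd e, True)])"

lemma ledge_reduced:
  assumes "reduced (p @ [l])"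
  shows "ledge p l = (if snd l then p else p @ [l], fst l)"
  using assms by (simp add: ledge_def lapp_id)

lemma child_ledge: "reduced (p @ [l]) \<Longrightarrow> child (ledge p l) = p @ [l]"
  by (cases l) (auto simp: ledge_reduced child_def reduced_snoc linv_def)

lemma reduced_take_Suc: "reduced w \<Longrightarrow> i < length w \<Longrightarrow> reduced (take i w @ [w ! i])"
  by (metis reduced_take take_Suc_conv_app_nth)

lemma child_pe: "reduced w \<Longrightarrow> i < length w \<Longrightarrow> child (pe w i) = take (Suc i) w"
  by (simp add: pe_def child_ledge reduced_take_Suc take_Suc_conv_app_nth)

lemma pe_eq_iff:
  assumes "reduced w" "i < length w" "reduced (p @ [l])"
  shows "ledge p l = pe w i \<longleftrightarrow> p @ [l] = take (Suc i) w"
proof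
  assume "ledge p l = pe w i"
  then show "p @ [l] = take (Suc i) w"
    using child_pe[OF assms(1,2)] child_ledge[OF assms(3)] by simp
next
  assume "p @ [l] = take (Suc i) w"
  then show "ledge p l = pe w i"
    using assms by (simp add: pe_def take_Suc_conv_app_nth)
qed

lemma pe_inj: "reduced w \<Longrightarrow> i < length w \<Longrightarrow> j < length w \<Longrightarrow> pe w i = pe w j \<Longrightarrow> i = j"
  using child_pe[of w i] child_pe[of w j] by (metis Suc_leI add_right_cancel length_take min.absorb2 Suc_inject)

lemma take_Suc_lapp: "reduced w \<Longrightarrow> k < length w \<Longrightarrow> take (Suc k) w = lapp (take k w) [w ! k]"
  by (metis lapp_id reduced_take take_Suc_conv_app_nth)

text \<open>The signed number of crossings of \<open>e\<close> by the path from the root to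
  \<open>wd g\<close>. This path has no backtracking, so the number is nonzero exactly for the edges
  on it.\<close>

definition cr :: "'h::group_add edge \<Rightarrow> 'h gg \<Rightarrow> int" where
  "cr e g = coc (\<lambda>e'. if e' = e then 1 else 0) g"

lemma Phi_pe:
  assumes w: "reduced w" "i < length w" and "reduced y"
  shows "Phi (\<lambda>e'. if e' = pe w i then 1 else 0) [] y =
    (if take (Suc i) y = take (Suc i) w then (if snd (w ! i) then 1 else - 1 :: int) else 0)"
  using assms(3)
proof (induction y rule: rev_induct)
  case Nil
  then show ?case using w by auto
next
  case (snoc l y)
  have y: "reduced y" using snoc.prems reduced_snoc by blast
  have pend: "pend [] y = y" using y by (simp add: pend_lapp)
  have e: "ledge y l = pe w i \<longleftrightarrow> y @ [l] = take (Suc i) w"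
    using pe_eq_iff[OF w snoc.prems] .
  consider "length y < i" | "length y = i" | "length y > i" by linarith
  then show ?case
  proof cases
    case 1
    then have "y @ [l] \<noteq> take (Suc i) w" "take (Suc i) (y @ [l]) = y @ [l]" "take (Suc i) y \<noteq> take (Suc i) w"
      using w by (auto dest: arg_cong[where f = length])
    then show ?thesis using snoc.IH[OF y] e by (simp add: Phi_append pend)
  next
    case 2
    then have "take (Suc i) y \<noteq> take (Suc i) w"
      using w by (auto dest: arg_cong[where f = length])
    moreover have "l = w ! i" if "y @ [l] = take (Suc i) w"
      using that w by (simp add: take_Suc_conv_app_nth)
    ultimately show ?thesis using snoc.IH[OF y] e 2 by (auto simp add: Phi_append pend)
  next
    case 3
    then have "y @ [l] \<noteq> take (Suc i) w"
      using w by (auto dest: arg_cong[where f = length])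
    then show ?thesis using snoc.IH[OF y] e 3 by (simp add: Phi_append pend)
  qed
qed

lemma cr_pe:
  assumes "reduced w" "i < length w"
  shows "cr (pe w i) g = (if take (Suc i) (wd g) = take (Suc i) w then (if snd (w ! i) then 1 else - 1) else 0)"
  unfolding cr_def coc_def using Phi_pe[OF assms] by simp

lemma trav_append: "trav p (u @ v) = trav p u \<union> trav (pend p u) v"
  by (induction u arbitrary: p) auto

lemma trav_pe: "reduced w \<Longrightarrow> trav [] w = pe w ` {..<length w}"
proof (induction w rule: rev_induct)
  case (snoc l w)
  then have w: "reduced w" using reduced_snoc by blast
  have "pe (w @ [l]) ` {..<length w} = pe w ` {..<length w}"
    by (intro image_cong) (auto simp: pe_def nth_append)
  moreover have "pe (w @ [l]) (length w) = ledge w l"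
    by (simp add: pe_def)
  ultimately show ?case using snoc.IH[OF w]
    by (simp add: trav_append pend_lapp w lessThan_Suc)
qed simp

lemma cr_nonzero_trav:
  assumes "cr e g \<noteq> 0"
  shows "e \<in> trav [] (wd g)"
proof (rule ccontr)
  assume "e \<notin> trav [] (wd g)"
  then have "Phi (\<lambda>e'. if e' = e then 1 else 0) [] (wd g) = Phi (\<lambda>_. 0 :: int) [] (wd g)"
    by (intro Phi_cong) auto
  also have "\<dots> = 0" using Phi_hom[of "\<lambda>x::int. 0::int" "\<lambda>_. 0" "[]" "wd g"] by simp
  finally show False using assms by (simp add: cr_def coc_def)
qed

lemma cr_nonzero_iff: "cr e g \<noteq> 0 \<longleftrightarrow> e \<in> trav [] (wd g)"
proof
  assume "e \<in> trav [] (wd g)"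
  then obtain i where "i < length (wd g)" "e = pe (wd g) i"
    by (auto simp: trav_pe)
  then show "cr e g \<noteq> 0" by (simp add: cr_pe)
qed (rule cr_nonzero_trav)

lemma cr_add:
  assumes "reduced (fst e)"
  shows "cr (eact g e) (g + k) = cr (eact g e) g + cr e k"
proof -
  have "Phi ((\<lambda>e'. if e' = eact g e then 1 else 0) \<circ> eact g) [] (wd k) =
    Phi (\<lambda>e'. if e' = e then 1 else 0 :: int) [] (wd k)"
  proof (rule Phi_cong)
    fix e' assume "e' \<in> trav [] (wd k)"
    then have "reduced (fst e')" using trav_reduced[of "[]"] by simp
    then have "eact g e' = eact g e \<longleftrightarrow> e' = e"
      using assms by (metis eact_minus(1))
    then show "((\<lambda>e'. if e' = eact g e then 1 else 0) \<circ> eact g) e' = (if e' = e then 1 else 0 :: int)"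
      by simp
  qed
  then show ?thesis by (simp add: cr_def coc_add) (simp add: coc_def)
qed

lemma cr_eact:
  assumes "reduced (fst e)"
  shows "cr (eact g e) v = cr e (- g + v) - cr e (- g)"
proof -
  have "cr e (- g + v) = cr e (- g) + cr (eact g e) v"
    using cr_add[of "eact g e" "- g" v] assms by simp
  then show ?thesis by simp
qed

lemma common_prefix_bound: "\<exists>l. \<forall>k<length w. take (Suc k) y = take (Suc k) w \<longleftrightarrow> k < l"
proof (cases "\<exists>k<length w. take (Suc k) y \<noteq> take (Suc k) w")
  case True
  define l where "l = (LEAST k. k < length w \<and> take (Suc k) y \<noteq> take (Suc k) w)"
  have l: "l < length w" "take (Suc l) y \<noteq> take (Suc l) w"
    using LeastI_ex[of "\<lambda>k. k < length w \<and> take (Suc k) y \<noteq> take (Suc k) w"] True by (auto simp: l_def)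
  have "take (Suc k) y \<noteq> take (Suc k) w" if "k \<ge> l" for k
  proof
    assume "take (Suc k) y = take (Suc k) w"
    then have "take (Suc l) (take (Suc k) y) = take (Suc l) (take (Suc k) w)" by simp
    then show False using l that by (simp add: min_def split: if_splits)
  qed
  moreover have "take (Suc k) y = take (Suc k) w" if "k < l" for k
    using not_less_Least[of k "\<lambda>k. k < length w \<and> take (Suc k) y \<noteq> take (Suc k) w"] that l
    by (auto simp: l_def[symmetric])
  ultimately show ?thesis by (intro exI[of _ l]) (meson not_less)
next
  case False
  then show ?thesis by (intro exI[of _ "length w"]) auto
qed

text \<open>Translated back by \<open>g\<close>, the question is which edges of \<open>w\<close> are
  crossed by exactly one of the root paths of \<open>- g\<close> and \<open>- g + v\<close>. Each of
  the two crosses an initial part of \<open>w\<close>, and two initial parts differ by an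
  interval.\<close>

lemma path_interval:
  fixes g v :: "'h::group_add gg"
  assumes w: "reduced w"
  shows "\<exists>l1 l2. \<forall>k<length w. cr (eact g (pe w k)) v \<noteq> 0 \<longleftrightarrow> l1 \<le> k \<and> k < l2"
proof -
  obtain a where a: "\<forall>k<length w. take (Suc k) (wd (- g + v)) = take (Suc k) w \<longleftrightarrow> k < a"
    using common_prefix_bound by blast
  obtain b where b: "\<forall>k<length w. take (Suc k) (wd (- g)) = take (Suc k) w \<longleftrightarrow> k < b"
    using common_prefix_bound by blast
  have "cr (eact g (pe w k)) v \<noteq> 0 \<longleftrightarrow> min a b \<le> k \<and> k < max a b" if k: "k < length w" for k
  proof -
    have "reduced (fst (pe w k))" using w by (simp add: pe_def reduced_take)
    then show ?thesis
      using a b k by (auto simp: cr_eact cr_pe[OF w k])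
  qed
  then show ?thesis by blast
qed

subsection \<open>Segments of root paths\<close>

definition seg :: "'x word \<Rightarrow> nat \<Rightarrow> nat \<Rightarrow> 'x word" where
  "seg w a b = drop a (take b w)"

lemma length_seg: "b \<le> length w \<Longrightarrow> length (seg w a b) = b - a"
  by (simp add: seg_def)

lemma reduced_seg: "reduced w \<Longrightarrow> reduced (seg w a b)"
  by (simp add: seg_def reduced_drop reduced_take)

lemma nth_seg: "b \<le> length w \<Longrightarrow> i < b - a \<Longrightarrow> seg w a b ! i = w ! (a + i)"
  by (simp add: seg_def)

lemma take_seg: "a \<le> b \<Longrightarrow> take b w = take a w @ seg w a b"
  unfolding seg_def by (metis append_take_drop_id min.absorb1 take_take)

lemma lapp_take_seg: "reduced w \<Longrightarrow> a \<le> b \<Longrightarrow> lapp (take a w) (seg w a b) = take b w"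
  using take_seg[of a b w] by (metis lapp_id reduced_take)

lemma lapp_take_winv_seg:
  assumes "reduced w" "a \<le> b"
  shows "lapp (take b w) (winv (seg w a b)) = take a w"
proof -
  have "lapp (seg w a b) (winv (seg w a b)) = []"
    using lapp_winv_left[of "[]" "winv (seg w a b)"] assms by (simp add: reduced_seg)
  then show ?thesis
    using assms take_seg[of a b w] by (simp add: lapp_append reduced_take)
qed

lemma lapp_cancel: 
  assumes "reduced p" "reduced u" "reduced v" "lapp p u = lapp p v"
  shows "u = v"
  using assms(2-4) lapp_winv_left by metis

text \<open>A reduced word is determined by the two vertices that it joins. So if both ends of a
  segment land on the path \<open>w\<close>, the whole segment is carried onto it, forwards or
  backwards.\<close>

lemma vact_seg:
  assumes w: "reduced w0" "reduced w" and ab: "a \<le> b" "b \<le> length w0"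
    and a: "vact g (take a w0) = take a' w" "a' \<le> length w"
    and b: "vact g (take b w0) = take b' w" "b' \<le> length w"
  shows "(b' = a' + (b - a) \<and> map (lact (hp g)) (seg w0 a b) = seg w a' b') \<or>
         (a' = b' + (b - a) \<and> map (lact (hp g)) (seg w0 a b) = winv (seg w b' a'))"
proof -
  have "take b' w = vact g (lapp (take a w0) (seg w0 a b))"
    using lapp_take_seg[OF w(1) ab(1)] b by simp
  also have "\<dots> = lapp (take a' w) (map (lact (hp g)) (seg w0 a b))"
    using a w by (simp add: vact_lapp reduced_seg)
  finally have *: "lapp (take a' w) (map (lact (hp g)) (seg w0 a b)) = take b' w" by simp
  have r: "reduced (take a' w)" "reduced (map (lact (hp g)) (seg w0 a b))"
    using w by (simp_all add: reduced_take reduced_seg)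
  show ?thesis
  proof (cases "a' \<le> b'")
    case True
    then have "map (lact (hp g)) (seg w0 a b) = seg w a' b'"
      using lapp_cancel[OF r reduced_seg[OF w(2)]] * lapp_take_seg[OF w(2) True] by simp
    moreover from this have "b - a = b' - a'"
      using ab a b length_seg by (metis length_map)
    ultimately show ?thesis using True by simp
  next
    case False
    then have "b' \<le> a'" by simp
    then have "map (lact (hp g)) (seg w0 a b) = winv (seg w b' a')"
      using lapp_cancel[OF r, of "winv (seg w b' a')"] w * lapp_take_winv_seg[OF w(2) \<open>b' \<le> a'\<close>]
      by (simp add: reduced_seg)
    moreover from this have "b - a = a' - b'"
      using ab a b length_seg by (metis length_map winv_simps(3))
    ultimately show ?thesis using \<open>b' \<le> a'\<close> by simp
  qed
qed

lemma nth_winv: "i < length w \<Longrightarrow> winv w ! i = linv (w ! (length w - Suc i))"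
  by (simp add: winv_def rev_nth)

text \<open>In the reversed case the edge at distance \<open>k - a\<close> from the carried starting
  point is entered from above, so its index is one less than the position
  \<open>a' - (k - a)\<close>.\<close>

lemma eact_pe_carry:
  assumes w: "reduced w0" "reduced w" and k: "a \<le> k" "k < b" "b \<le> length w0"
    and a: "vact g (take a w0) = take a' w" "a' \<le> length w"
    and b: "vact g (take b w0) = take b' w" "b' \<le> length w"
  shows "(b' = a' + (b - a) \<and> eact g (pe w0 k) = pe w (a' + (k - a))) \<or>
         (a' = b' + (b - a) \<and> eact g (pe w0 k) = pe w (a' - Suc (k - a)))"
proof -
  have ab: "a \<le> b" using k by simp
  have e: "eact g (pe w0 k) = ledge (vact g (take k w0)) (lact (hp g) (w0 ! k))"
    using w by (simp add: pe_def ledge_act reduced_take)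
  have vk: "vact g (take k w0) = lapp (take a' w) (take (k - a) (map (lact (hp g)) (seg w0 a b)))"
  proof -
    have "take k w0 = lapp (take a w0) (take (k - a) (seg w0 a b))"
    proof -
      have "take (k - a) (seg w0 a b) = drop a (take (k - a + a) (take b w0))"
        by (simp add: seg_def take_drop)
      also have "take (k - a + a) (take b w0) = take k w0"
        using k by (simp add: take_take min_def)
      finally have "take (k - a) (seg w0 a b) = seg w0 a k"
        by (simp add: seg_def)
      then show ?thesis using lapp_take_seg[OF w(1) k(1)] by simp
    qed
    then show ?thesis using a w by (simp add: vact_lapp reduced_take reduced_seg take_map)
  qed
  have lk: "lact (hp g) (w0 ! k) = map (lact (hp g)) (seg w0 a b) ! (k - a)"
    using k by (simp add: nth_seg length_seg)
  from vact_seg[OF w ab k(3) a b] show ?thesis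
  proof (elim disjE conjE)
    assume h: "b' = a' + (b - a)" "map (lact (hp g)) (seg w0 a b) = seg w a' b'"
    have "take (k - a) (seg w a' b') = drop a' (take (k - a + a') (take b' w))"
      by (simp add: seg_def take_drop)
    also have "take (k - a + a') (take b' w) = take (a' + (k - a)) w"
      using h k by (simp add: take_take min_def add.commute)
    finally have "take (k - a) (seg w a' b') = seg w a' (a' + (k - a))"
      by (simp add: seg_def)
    then have "vact g (take k w0) = take (a' + (k - a)) w"
      using vk h lapp_take_seg[OF w(2), of a' "a' + (k - a)"] by simp
    moreover have "lact (hp g) (w0 ! k) = w ! (a' + (k - a))"
      using lk h k b nth_seg[of b' w "k - a" a'] by simp
    ultimately show ?thesis using e h by (simp add: pe_def)
  next
    assume h: "a' = b' + (b - a)" "map (lact (hp g)) (seg w0 a b) = winv (seg w b' a')"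
    let ?m = "a' - (k - a)"
    have m: "b' < ?m" "?m \<le> a'" using h k by auto
    have "seg w b' a' = seg w b' ?m @ seg w ?m a'"
      using take_seg[of b' ?m w] take_seg[of b' a' w] take_seg[of ?m a' w] m by simp
    then have "take (k - a) (winv (seg w b' a')) = winv (seg w ?m a')"
      using m a h k by (simp add: winv_append length_seg)
    then have "vact g (take k w0) = take ?m w"
      using vk h lapp_take_winv_seg[OF w(2) m(2)] by simp
    moreover have "lact (hp g) (w0 ! k) = linv (w ! (?m - 1))"
    proof -
      have "lact (hp g) (w0 ! k) = linv (seg w b' a' ! (length (seg w b' a') - Suc (k - a)))"
        using lk h k a by (simp add: nth_winv length_seg)
      also have "seg w b' a' ! (length (seg w b' a') - Suc (k - a)) = w ! (b' + (length (seg w b' a') - Suc (k - a)))"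
        using k a h by (intro nth_seg) (simp_all add: length_seg)
      also have "b' + (length (seg w b' a') - Suc (k - a)) = ?m - 1"
        using a h k by (simp add: length_seg)
      finally show ?thesis .
    qed
    ultimately have "eact g (pe w0 k) = ledge (take ?m w) (linv (w ! (?m - 1)))" using e by simp
    also have "take ?m w = lapp (take (?m - 1) w) [w ! (?m - 1)]"
    proof -
      have "Suc (?m - 1) = ?m" "?m - 1 < length w" using m a by linarith+
      then show ?thesis using take_Suc_lapp[OF w(2), of "?m - 1"] by metis
    qed
    also have "ledge \<dots> (linv (w ! (?m - 1))) = pe w (?m - 1)"
      unfolding pe_def by (rule ledge_linv) (use w in \<open>simp add: reduced_take\<close>)
    finally show ?thesis using h by simp
  qed
qed

lemma edge_ends_on_path:
  assumes w: "reduced w" "i < length w" and e: "cr (eact g (pe w i)) v \<noteq> 0"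
  shows "\<exists>m\<le>length (wd v). vact g (take i w) = take m (wd v)" "\<exists>m\<le>length (wd v). vact g (take (Suc i) w) = take m (wd v)"
proof -
  obtain k where k: "k < length (wd v)" "eact g (pe w i) = pe (wd v) k"
    using e by (auto simp: cr_nonzero_iff trav_pe)
  let ?l = "lact (hp g) (w ! i)" and ?p = "vact g (take i w)"
  have le: "ledge ?p ?l = pe (wd v) k"
    using k w by (simp add: ledge_act reduced_take pe_def)
  have rp: "reduced ?p" using w by (simp add: reduced_take)
  have s: "vact g (take (Suc i) w) = lapp ?p [?l]"
    using w by (simp add: take_Suc_conv_app_nth lapp_id[symmetric] reduced_take_Suc vact_lapp)
  have key: "(p = take k y \<and> lapp p [l] = take (Suc k) y) \<or> (p = take (Suc k) y \<and> lapp p [l] = take k y)"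
    if le: "ledge p l = pe y k" and k: "k < length y" and rp: "reduced p" and y: "reduced y" for p l and y :: "('h letter) word"
  proof -
    obtain x b where l: "l = (x, b)" by (cases l)
    obtain x' b' where y': "y ! k = (x', b')" by (cases "y ! k")
    have yk: "take (Suc k) y = take k y @ [(x', b')]" using k y' by (simp add: take_Suc_conv_app_nth)
    then have ly: "lapp (take k y) [(x', b')] = take (Suc k) y"
      using y by (metis lapp_id reduced_take)
    have e: "(if b then p else lapp p [(x, b)]) = (if b' then take k y else take (Suc k) y)" "x = x'"
      using le ly by (auto simp: l y' ledge_def pe_def)
    have ry: "reduced (take k y)" "reduced (take (Suc k) y)" using y by (auto simp: reduced_take)
    have inv1: "lapp (lapp p [(x, b)]) [(x, \<not> b)] = p"
      using lapp_linv_right[OF rp, of "(x, b)"] by (simp add: linv_def)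
    have inv2: "lapp (take (Suc k) y) [(x', \<not> b')] = take k y"
      using lapp_linv_right[OF ry(1), of "(x', b')"] ly by (simp add: linv_def)
    show ?thesis
      using e ly inv1 inv2 by (cases b; cases b') (auto simp: l)
  qed
  have "k \<le> length (wd v)" "Suc k \<le> length (wd v)" using k by auto
  moreover have "(?p = take k (wd v) \<and> vact g (take (Suc i) w) = take (Suc k) (wd v)) \<or>
      (?p = take (Suc k) (wd v) \<and> vact g (take (Suc i) w) = take k (wd v))"
    using key[OF le k(1) rp] s by simp
  ultimately show "\<exists>m\<le>length (wd v). vact g (take i w) = take m (wd v)"
      "\<exists>m\<le>length (wd v). vact g (take (Suc i) w) = take m (wd v)"
    by metis+
qed

subsection \<open>The amalgam inside the extended free group\<close>

definition tt :: "'h::group_add set \<Rightarrow> 'h gg" where "tt C = lt (False, C)"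
definition ss :: "'h::group_add set \<Rightarrow> 'h gg" where "ss C = lt (True, C)"
definition tc :: "'h::group_add set \<Rightarrow> 'h \<Rightarrow> 'h gg" where "tc C b = tt C + hh b + - tt C"
definition WW :: "'h::group_add set \<Rightarrow> 'h set \<Rightarrow> 'h set \<Rightarrow> 'h gg set" where
  "WW A B C = gen (hh ` A \<union> tc C ` B)"
definition EE :: "'h::group_add set \<Rightarrow> 'h set \<Rightarrow> 'h set \<Rightarrow> 'h gg set" where
  "EE A B C = gen (hh ` A \<union> tc C ` B \<union> {ss C})"
text \<open>\<open>a\<close> is put for \<open>t\<close> and \<open>b\<close> for \<open>s\<close>;
  the elements of \<open>range hh\<close> stay.\<close>

definition subst :: "'h::group_add set \<Rightarrow> 'h gg \<Rightarrow> 'h gg \<Rightarrow> 'h gg \<Rightarrow> 'h gg" where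
  "subst C a b = sub C (\<lambda>i. if i then b else a)"

lemma subgroupD:
  assumes "is_subgroup U"
  shows "0 \<in> U" "x \<in> U \<Longrightarrow> y \<in> U \<Longrightarrow> x + y \<in> U" "x \<in> U \<Longrightarrow> - x \<in> U"
  using assms by (auto simp: is_subgroup_def)

lemma coset_self:
  assumes C: "is_subgroup C" and c: "c \<in> C"
  shows "(+) c ` C = C"
  using coset_eqI[OF C, of c 0] subgroupD(3)[OF C c] by simp

lemma centralizes_lt:
  assumes C: "is_subgroup C"
  shows "centralizes (lt (b, C)) (hh ` C)"
  unfolding centralizes_def
proof (intro ballI, clarify)
  fix c assume "c \<in> C"
  then have "hh c + lt (b, C) + - hh c = lt (b, C)"
    by (simp add: hh_lt xact_def coset_self[OF C] del: add_uminus_conv_diff)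
  then have "hh c + lt (b, C) + - hh c + hh c = lt (b, C) + hh c" by simp
  then show "hh c + lt (b, C) = lt (b, C) + hh c" by (simp only: grps)
qed

lemma centralizes_0 [simp]: "centralizes 0 U"
  by (simp add: centralizes_def)

lemma centralizes_add: "centralizes x U \<Longrightarrow> centralizes y U \<Longrightarrow> centralizes (x + y) U"
  by (auto simp: centralizes_def) (metis add.assoc)

lemma centralizes_uminus: 
  assumes "centralizes x U"
  shows "centralizes (- x) U"
  unfolding centralizes_def
proof
  fix c assume "c \<in> U"
  then have "- x + (c + x) + - x = - x + (x + c) + - x" using assms by (simp add: centralizes_def)
  then show "c + - x = - x + c" by (simp only: grps)
qed

lemma centralizes_tt: "is_subgroup C \<Longrightarrow> centralizes (tt C) (hh ` C)"
  and centralizes_ss: "is_subgroup C \<Longrightarrow> centralizes (ss C) (hh ` C)"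
  by (simp_all add: tt_def ss_def centralizes_lt)

locale subst_hom =
  fixes C :: "'h::group_add set" and a b
  assumes C: "is_subgroup C" and a: "centralizes a (hh ` C)" and b: "centralizes b (hh ` C)"
begin

lemma add: "subst C a b (x + y) = subst C a b x + subst C a b y"
  unfolding subst_def by (rule sub_add[OF C]) (simp add: a b)

lemma hh [simp]: "subst C a b (hh h) = hh h"
  by (simp add: subst_def)

lemma tt [simp]: "subst C a b (tt C) = a" and ss [simp]: "subst C a b (ss C) = b"
  unfolding subst_def tt_def ss_def by (subst sub_lt[OF C]; simp add: a b)+

lemma zero [simp]: "subst C a b 0 = 0"
  by (rule hom_0) (rule add)

lemma uminus [simp]: "subst C a b (- x) = - subst C a b x"
  by (rule hom_uminus) (rule add)

lemma tc: "subst C a b (tc C x) = a + hh x + - a"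
  by (simp add: tc_def add del: add_uminus_conv_diff)

end

definition normalizes :: "'g::group_add \<Rightarrow> 'g set \<Rightarrow> bool" where
  "normalizes x U \<longleftrightarrow> (\<forall>c\<in>U. x + c + - x \<in> U \<and> - x + c + x \<in> U)"

lemma normalizes_0 [simp]: "normalizes 0 U"
  by (simp add: normalizes_def)

lemma normalizes_add:
  assumes "normalizes x U" "normalizes y U"
  shows "normalizes (x + y) U"
  unfolding normalizes_def
proof
  fix c assume c: "c \<in> U"
  have "x + (y + c + - y) + - x \<in> U" "- y + (- x + c + x) + y \<in> U"
    using assms c by (auto simp only: normalizes_def)
  then show "(x + y) + c + - (x + y) \<in> U \<and> - (x + y) + c + (x + y) \<in> U"
    by (simp only: grps)
qed

lemma normalizes_uminus: "normalizes x U \<Longrightarrow> normalizes (- x) U"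
  by (simp add: normalizes_def del: add_uminus_conv_diff)

lemma normalizes_image_hh: "normalizes x C \<Longrightarrow> normalizes (hh x) (hh ` C)"
  by (auto simp: normalizes_def image_iff hh_add[symmetric] hh_uminus[symmetric] simp del: add_uminus_conv_diff)

lemma centralizes_normalizes:
  assumes "centralizes x U"
  shows "normalizes x U"
  unfolding normalizes_def
proof
  fix c assume c: "c \<in> U"
  then have "x + c + - x = c + x + - x" using assms by (simp add: centralizes_def)
  moreover have "- x + c + x = - x + (x + c)" using assms c by (simp add: centralizes_def add.assoc)
  ultimately show "x + c + - x \<in> U \<and> - x + c + x \<in> U" using c by (simp only: grps)
qed

lemma centralizes_conj:
  assumes x: "normalizes x U" and y: "centralizes y U"
  shows "centralizes (x + y + - x) U"
  unfolding centralizes_def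
proof
  fix c assume c: "c \<in> U"
  define d where "d = - x + c + x"
  have d: "d \<in> U" using x c by (simp add: d_def normalizes_def)
  have c': "c = x + d + - x" by (simp only: d_def grps)
  have "c + (x + y + - x) = x + (d + y) + - x" by (simp only: c' grps)
  also have "\<dots> = x + (y + d) + - x" using y d by (simp add: centralizes_def)
  also have "\<dots> = (x + y + - x) + c" by (simp only: c' grps)
  finally show "c + (x + y + - x) = (x + y + - x) + c" .
qed

locale amalg =
  fixes A B C :: "'h::group_add set"
  assumes sA: "is_subgroup A" and sB: "is_subgroup B" and sC: "is_subgroup C"
    and CA: "C \<subseteq> A" and CB: "C \<subseteq> B"
begin

abbreviation "t \<equiv> tt C"
abbreviation "s \<equiv> ss C"
abbreviation "W \<equiv> WW A B C"
abbreviation "E \<equiv> EE A B C"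

lemma subgroup_W: "is_subgroup W" and subgroup_E: "is_subgroup E"
  by (simp_all add: WW_def EE_def)

lemma W_sub_E: "W \<subseteq> E"
  unfolding WW_def EE_def by (intro gen_mono) auto

lemma hhA_W: "a \<in> A \<Longrightarrow> hh a \<in> W" and tcB_W: "b \<in> B \<Longrightarrow> tc C b \<in> W"
  by (auto simp: WW_def intro: gen_base)

lemma s_E: "s \<in> E"
  by (auto simp: EE_def intro: gen_base)

lemma subst_t_W:
  assumes "centralizes b (hh ` C)" "x \<in> W"
  shows "subst C t b x = x"
proof -
  interpret subst_hom C t b by unfold_locales (use sC assms centralizes_tt in auto)
  show ?thesis
    by (rule hom_gen_eq[where g = "\<lambda>x. x", OF add _ _ assms(2)[unfolded WW_def]])
      (auto simp: tc[folded tc_def])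
qed

lemma subst_t_E:
  assumes "centralizes b (hh ` C)" "x \<in> E" "b \<in> U" "W \<subseteq> U" "is_subgroup U"
  shows "subst C t b x \<in> U"
proof -
  interpret subst_hom C t b by unfold_locales (use sC assms centralizes_tt in auto)
  show ?thesis
  proof (rule hom_gen[OF add _ assms(5) assms(2)[unfolded EE_def]])
    fix x assume "x \<in> hh ` A \<union> tc C ` B \<union> {s}"
    then consider "x \<in> W" | "x = s" using hhA_W tcB_W by auto
    then show "subst C t b x \<in> U"
      using assms subst_t_W by cases auto
  qed
qed

end

text \<open>The conjugate of \<open>s\<close> that belongs to the edge: it has the same coset and
  starts at the same vertex. Its equivariance, \<open>es_eact\<close>, makes it a possible
  coefficient of a cocycle.\<close>

definition es :: "'h::group_add edge \<Rightarrow> 'h gg" where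
  "es e = vx (fst e) + lt (True, snd (snd e)) + - vx (fst e)"

lemma es_eact:
  assumes "reduced (fst e)"
  shows "es (eact g e) = g + es e + - g"
proof -
  obtain p j Y where e: "e = (p, (j, Y))" by (metis surj_pair)
  have p: "reduced p" using assms by (simp add: e)
  have 1: "vx (vact g p) = g + vx p + - hh (hp g)"
  proof -
    have "vx (vact g p) + hh (hp g) = g + vx p"
      by (rule gg_eqI) (simp_all add: p wd_plus vact_def)
    then have "vx (vact g p) + hh (hp g) + - hh (hp g) = g + vx p + - hh (hp g)" by simp
    then show ?thesis by (simp only: grps)
  qed
  have 2: "lt (True, (+) (hp g) ` Y) = hh (hp g) + lt (True, Y) + - hh (hp g)"
    by (simp add: hh_lt xact_def del: add_uminus_conv_diff)
  show ?thesis
    by (simp only: es_def e eact_def fst_conv snd_conv xact_def 1 2 grps)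
qed

lemma Phi_in: "is_subgroup U \<Longrightarrow> (\<And>e. Z e \<in> U) \<Longrightarrow> Phi Z p w \<in> U"
  by (induction w arbitrary: p) (simp_all add: is_subgroup_def)

lemma Phi_zero [simp]: "Phi (\<lambda>_. 0) p w = 0"
  by (induction w arbitrary: p) auto

lemma reduced_map_upt: "(\<And>i. f (Suc i) \<noteq> linv (f i)) \<Longrightarrow> reduced (map f [a..<b])"
proof (induction b)
  case (Suc b)
  show ?case
  proof (cases "a \<le> b")
    case True
    have "last (map f [a..<b]) = f (b - 1)" "b = Suc (b - 1)" if "a < b"
      using that by (auto simp: last_map)
    moreover have "f b \<noteq> linv (f (b - 1))" if "a < b" using Suc.prems[of "b - 1"] that by simp
    ultimately show ?thesis using Suc True by (cases "a < b") (auto simp: reduced_snoc linv_eq_iff)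
  qed auto
qed simp

subsection \<open>A generic element centralizing the edge group\<close>

text \<open>\<open>p1\<close> and \<open>p2\<close> are the two values of the varying syllable in
  \<open>A\<close>, and \<open>q\<close> is the constant syllable in \<open>B\<close>. That they are
  outside \<open>C\<close> makes words reduced, \<open>p12\<close> makes the two values
  distinguishable modulo \<open>C\<close>, \<open>q + q\<close> outside \<open>C\<close> excludes
  reversed windows, and \<open>ord1\<close>, \<open>ord2\<close> close up each block of
  four.\<close>

locale merz = amalg A B C for A B C :: "'h::group_add set" +
  fixes p1 p2 q :: 'h
  assumes p1: "p1 \<in> A" "normalizes p1 C" "p1 \<notin> C"
    and p2: "p2 \<in> A" "normalizes p2 C" "p2 \<notin> C"
    and p12: "- p1 + p2 \<notin> C"
    and q: "q \<in> B" "normalizes q C" "q \<notin> C" "q + q \<notin> C"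
    and ord1: "p1 + q + (p1 + q) + (p1 + q) + (p1 + q) = 0"
    and ord2: "p2 + q + (p2 + q) + (p2 + q) + (p2 + q) = 0"
begin

definition P :: "nat \<Rightarrow> 'h" where "P k = (if sqd k then p2 else p1)"

text \<open>The image in \<open>'h\<close> of the product of the first \<open>k\<close> pairs of
  syllables, obtained by forgetting \<open>t\<close>.\<close>

fun H :: "nat \<Rightarrow> 'h" where
  "H 0 = 0"
| "H (Suc k) = H k + P k + q"

text \<open>The letters of the product of the elements \<open>hh (P k) + tc C q\<close>: each
  \<open>tc C q\<close> contributes \<open>t\<close> and its inverse, conjugated by the part of the
  product to their left.\<close>

definition lf :: "nat \<Rightarrow> 'h letter \<times> bool" where
  "lf i = (if even i then ((False, (+) (H (i div 2) + P (i div 2)) ` C), True)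
     else ((False, (+) (H (Suc (i div 2))) ` C), False))"

lemma P: "P k \<in> A" "normalizes (P k) C" "P k \<notin> C"
  using p1 p2 by (auto simp: P_def)

lemma P_eqD: "- P k + P k' \<in> C \<Longrightarrow> sqd k = sqd k'"
proof -
  have "- p2 + p1 \<notin> C"
  proof
    assume "- p2 + p1 \<in> C"
    from subgroupD(3)[OF sC this] show False using p12 by (simp only: grps)
  qed
  then show "- P k + P k' \<in> C \<Longrightarrow> sqd k = sqd k'" using p12 by (auto simp: P_def split: if_splits)
qed

lemma normalizes_H: "normalizes (H k) C"
  by (induction k) (simp_all add: normalizes_add P q)

lemma coset_fix:
  assumes "normalizes x C" "c \<in> C"
  shows "(+) (c + x) ` C = (+) x ` C"
proof -
  have "- c \<in> C" using assms subgroupD(3)[OF sC] by blast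
  then have "- x + - c + x \<in> C" using assms(1) unfolding normalizes_def by blast
  then have "- (c + x) + x \<in> C" by (simp only: grps)
  then show ?thesis by (rule coset_eqI[OF sC])
qed

text \<open>The elements \<open>H k\<close> and \<open>P k\<close> normalize \<open>C\<close>, so
  their left cosets are right cosets too and are fixed by translation with \<open>C\<close>. This is
  what lets the generic element centralize \<open>C\<close>.\<close>

lemma lact_lf: "c \<in> C \<Longrightarrow> lact c (lf i) = lf i"
  using coset_fix[OF normalizes_add[OF normalizes_H P(2)], of c] coset_fix[OF normalizes_H, of c]
  by (simp add: lf_def lact_def xact_def image_image add.assoc[symmetric] del: H.simps)

lemma lf_Suc: "lf (Suc i) \<noteq> linv (lf i)"
proof (cases "even i")
  case True
  then obtain k where i: "i = 2 * k" by blast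
  have "(+) (H (Suc k)) ` C \<noteq> (+) (H k + P k) ` C"
  proof
    assume "(+) (H (Suc k)) ` C = (+) (H k + P k) ` C"
    from coset_eqD[OF sC this[symmetric]] have "q \<in> C"
      by (simp only: H.simps grps)
    then show False using q by simp
  qed
  then show ?thesis by (simp add: lf_def i linv_def del: H.simps)
next
  case False
  then obtain k where i: "i = Suc (2 * k)" by (metis oddE Suc_eq_plus1)
  have "(+) (H (Suc k) + P (Suc k)) ` C \<noteq> (+) (H (Suc k)) ` C"
  proof
    assume "(+) (H (Suc k) + P (Suc k)) ` C = (+) (H (Suc k)) ` C"
    from coset_eqD[OF sC this[symmetric]] have "P (Suc k) \<in> C"
      by (simp only: grps)
    then show False using P by simp
  qed
  then show ?thesis by (simp add: lf_def i linv_def del: H.simps)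
qed

definition wn :: "nat \<Rightarrow> ('h letter) word" where "wn m = map lf [0..<2 * m]"

lemma reduced_wn [simp]: "reduced (wn m)"
  unfolding wn_def by (rule reduced_map_upt) (rule lf_Suc)

lemma length_wn [simp]: "length (wn m) = 2 * m"
  by (simp add: wn_def)

lemma nth_wn [simp]: "i < 2 * m \<Longrightarrow> wn m ! i = lf i"
  by (simp add: wn_def)

lemma take_wn: "k \<le> m \<Longrightarrow> take (2 * k) (wn m) = wn k"
  by (simp add: wn_def take_map)

lemma mk_wn_Suc: "mk (wn (Suc m)) (H (Suc m)) = mk (wn m) (H m) + hh (P m) + tc C q"
proof (rule gg_eqI)
  have qC: "(+) q ` C \<noteq> C" using coset_eqD[OF sC, of 0 q] q by auto
  have wtc: "wd (tc C q) = [((False, C), True), ((False, (+) q ` C), False)]"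
    using qC by (simp add: tc_def wd_plus wd_uminus tt_def linv_def lact_def xact_def del: add_uminus_conv_diff)
  have "wd (mk (wn m) (H m) + hh (P m) + tc C q) = lapp (wn m) [lf (2 * m), lf (Suc (2 * m))]"
    by (simp add: wd_plus wtc lact_def xact_def lf_def image_image add.assoc)
  also have "\<dots> = wn m @ [lf (2 * m), lf (Suc (2 * m))]"
    using reduced_wn[of "Suc m"] by (intro lapp_id) (simp add: wn_def)
  also have "\<dots> = wn (Suc m)" by (simp add: wn_def)
  finally show "wd (mk (wn (Suc m)) (H (Suc m))) = wd (mk (wn m) (H m) + hh (P m) + tc C q)"
    by simp
qed (simp add: tc_def tt_def)

lemma mk_wn_W: "mk (wn m) (H m) \<in> W"
proof (induction m)
  case 0
  then show ?case using subgroupD(1)[OF subgroup_W] by (simp add: wn_def zero_gg_def)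
next
  case (Suc m)
  then show ?case unfolding mk_wn_Suc
    by (intro subgroupD(2)[OF subgroup_W] hhA_W tcB_W P q)
qed

lemma P_block: "i < 4 \<Longrightarrow> P (4 * m + i) = P (4 * m)"
  by (simp add: P_def sqd_def)

text \<open>The syllable \<open>P\<close> is constant on a block of four, so \<open>ord1\<close> or
  \<open>ord2\<close> applies to the block.\<close>

lemma H_block: "H (4 * m) = 0"
proof (induction m)
  case (Suc m)
  have "P (Suc (4 * m)) = P (4 * m)" "P (Suc (Suc (4 * m))) = P (4 * m)" "P (Suc (Suc (Suc (4 * m)))) = P (4 * m)"
    using P_block[of 1 m] P_block[of 2 m] P_block[of 3 m] by (simp_all add: numeral_eq_Suc)
  moreover have "4 * Suc m = Suc (Suc (Suc (Suc (4 * m))))" by simp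
  ultimately have "H (4 * Suc m) = P (4 * m) + q + (P (4 * m) + q) + (P (4 * m) + q) + (P (4 * m) + q)"
    using Suc by (simp only: H.simps) (simp add: add.assoc)
  also have "\<dots> = 0" using ord1 ord2 by (simp add: P_def)
  finally show ?case .
qed simp

text \<open>Two consecutive letters, known up to a common translation, determine the syllable
  between them modulo \<open>C\<close>, because \<open>P k\<close> normalizes
  \<open>C\<close>.\<close>

lemma fwd_step:
  assumes "(+) (h + H k) ` C = (+) (H k') ` C" "(+) (h + (H k + P k)) ` C = (+) (H k' + P k') ` C"
  shows "sqd k = sqd k'"
proof -
  define c where "c = - (h + H k) + H k'"
  have c: "c \<in> C" using coset_eqD[OF sC assms(1)] by (simp add: c_def)
  have "- (h + (H k + P k)) + (H k' + P k') \<in> C" using coset_eqD[OF sC assms(2)] .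
  then have d: "- P k + c + P k' \<in> C" by (simp only: c_def grps)
  have "- P k + c + P k \<in> C" using P(2)[of k] c by (simp add: normalizes_def)
  then have "- (- P k + c + P k) \<in> C" by (rule subgroupD(3)[OF sC])
  from subgroupD(2)[OF sC this d] have "- P k + P k' \<in> C" by (simp only: grps)
  then show ?thesis by (rule P_eqD)
qed

text \<open>A reversed match pairs the syllable \<open>q\<close> with its own inverse. As
  \<open>q\<close> normalizes \<open>C\<close>, this would put \<open>q + q\<close> into
  \<open>C\<close>.\<close>

lemma rev_step:
  assumes "(+) (h + x) ` C = (+) (y + q) ` C" "(+) (h + (x + q)) ` C = (+) y ` C"
  shows False
proof -
  define c where "c = - (h + x) + (y + q)"
  have c: "c \<in> C" using coset_eqD[OF sC assms(1)] by (simp add: c_def)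
  have "- (h + (x + q)) + y \<in> C" using coset_eqD[OF sC assms(2)] .
  then have d: "- q + c + - q \<in> C" by (simp only: c_def grps)
  have "- q + c + q \<in> C" using q c by (simp add: normalizes_def)
  then have "- (- q + c + q) \<in> C" by (rule subgroupD(3)[OF sC])
  from subgroupD(2)[OF sC this d] have "- q + - q \<in> C" by (simp only: grps)
  from subgroupD(3)[OF sC this] have "q + q \<in> C" by (simp only: grps)
  then show False using q by simp
qed

text \<open>The length \<open>2 * L + 1\<close> leaves room for \<open>L\<close> complete syllables
  from \<open>A\<close> whatever the parity of \<open>a\<close>. Forward matches are settled by
  \<open>sqd_window\<close>, reversed ones by a single syllable \<open>q\<close>.\<close>

lemma window_unique:
  assumes L: "L > 16 * M" and b: "b = a + (2 * L + 1)" "b \<le> 2 * (4 * (M * M))"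
    and w: "w0 = wn (4 * (M * M))"
    and a': "vact g (take a w0) = take a' w0" "a' \<le> length w0"
    and b': "vact g (take b w0) = take b' w0" "b' \<le> length w0"
  shows "a' = a \<and> b' = b"
proof -
  let ?h = "hp g"
  have rw: "reduced w0" and lw: "length w0 = 2 * (4 * (M * M))" by (simp_all add: w)
  have ab: "a \<le> b" "b \<le> length w0" using b lw by auto
  have nw: "w0 ! i = lf i" if "i < length w0" for i using that by (simp add: w)
  from vact_seg[OF rw rw ab a' b'] show ?thesis
  proof (elim disjE conjE)
    assume h: "b' = a' + (b - a)" "map (lact ?h) (seg w0 a b) = seg w0 a' b'"
    have eq: "lact ?h (lf (a + i)) = lf (a' + i)" if "i < 2 * L + 1" for i
    proof -
      have "map (lact ?h) (seg w0 a b) ! i = lact ?h (lf (a + i))"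
        using that ab b by (simp add: length_seg nth_seg nw)
      moreover have "seg w0 a' b' ! i = lf (a' + i)"
        using that ab b b' h by (simp add: nth_seg nw)
      ultimately show ?thesis using h by simp
    qed
    define \<alpha> \<alpha>' r where "\<alpha> = a div 2" and "\<alpha>' = a' div 2" and "r = a mod 2"
    have "snd (lf a) = snd (lf a')" using eq[of 0] by (metis add_0_right snd_lact zero_less_Suc Suc_eq_plus1)
    then have "even a = even a'" by (auto simp: lf_def split: if_splits)
    then have "a' mod 2 = r" unfolding r_def by presburger
    then have aa: "a = 2 * \<alpha> + r" "a' = 2 * \<alpha>' + r" and r: "r \<le> 1"
      unfolding \<alpha>_def \<alpha>'_def r_def by presburger+
    \<comment> \<open>The first syllable of \<open>A\<close> with both neighbouring letters surely
      in the window has index one above \<open>a div 2\<close>: the letter before it sits at the odd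
      position \<open>2 * (a div 2) + 1\<close>.\<close>
    have "sqd (\<alpha> + 1 + i) = sqd (\<alpha>' + 1 + i)" if i: "i < L" for i
    proof (rule fwd_step)
      have x: "a + (2 * i + 1 - r) = Suc (2 * (\<alpha> + i))" "a' + (2 * i + 1 - r) = Suc (2 * (\<alpha>' + i))"
         "a + (2 * i + 2 - r) = 2 * (\<alpha> + i + 1)" "a' + (2 * i + 2 - r) = 2 * (\<alpha>' + i + 1)"
        using aa r by auto
      have "lact ?h (lf (Suc (2 * (\<alpha> + i)))) = lf (Suc (2 * (\<alpha>' + i)))"
        using eq[of "2 * i + 1 - r"] i unfolding x by simp
      then show "(+) (?h + H (\<alpha> + 1 + i)) ` C = (+) (H (\<alpha>' + 1 + i)) ` C"
        by (simp add: lf_def lact_def xact_def image_image add.assoc del: H.simps)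
      have "lact ?h (lf (2 * (\<alpha> + i + 1))) = lf (2 * (\<alpha>' + i + 1))"
        using eq[of "2 * i + 2 - r"] i unfolding x by simp
      then show "(+) (?h + (H (\<alpha> + 1 + i) + P (\<alpha> + 1 + i))) ` C = (+) (H (\<alpha>' + 1 + i) + P (\<alpha>' + 1 + i)) ` C"
        by (simp add: lf_def lact_def xact_def image_image add.assoc del: H.simps)
    qed
    moreover have "\<alpha> + 1 + L \<le> 4 * (M * M)" "\<alpha>' + 1 + L \<le> 4 * (M * M)"
      using aa b b' h lw by linarith+
    ultimately have "\<alpha> + 1 = \<alpha>' + 1"
      using sqd_window[OF _ L, of "\<alpha> + 1" "\<alpha>' + 1"] by blast
    then show ?thesis using aa h ab by simp
  next
    assume h: "a' = b' + (b - a)" "map (lact ?h) (seg w0 a b) = winv (seg w0 b' a')"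
    have eq: "lact ?h (lf (a + i)) = linv (lf (a' - Suc i))" if "i < 2 * L + 1" for i
    proof -
      have "map (lact ?h) (seg w0 a b) ! i = lact ?h (lf (a + i))"
        using that ab b by (simp add: length_seg nth_seg nw)
      moreover have "winv (seg w0 b' a') ! i = linv (w0 ! (b' + (length (seg w0 b' a') - Suc i)))"
        using that ab b a' h by (simp add: nth_winv length_seg nth_seg)
      moreover have "b' + (length (seg w0 b' a') - Suc i) = a' - Suc i"
        using that a' h b by (simp add: length_seg)
      ultimately show ?thesis using h a' b that nw[of "a' - Suc i"] by simp
    qed
    have Lp: "L \<ge> 1" using L by simp
    \<comment> \<open>Moves to the first even position of the window, so that a letter pair
      enclosing \<open>q\<close> is read.\<close>
    define x where "x = a mod 2"
    have "even (a + x)" by (simp add: x_def)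
    then obtain k where k: "a + x = 2 * k" by blast
    have x: "x \<le> 1" by (simp add: x_def)
    define y where "y = a' - Suc (Suc x)"
    have y: "a' - Suc x = Suc y" using h b Lp x by (simp add: y_def)
    have e1: "lact ?h (lf (2 * k)) = linv (lf (Suc y))"
      using eq[of x] x Lp k y by simp
    have e2: "lact ?h (lf (Suc (2 * k))) = linv (lf y)"
      using eq[of "Suc x"] x Lp k y_def by simp
    have "even y"
      using arg_cong[OF e1, of snd] by (auto simp: lf_def linv_def split: if_splits)
    then obtain k' where k': "y = 2 * k'" by blast
    show ?thesis
    proof (rule ccontr, rule rev_step)
      show "(+) (?h + (H k + P k)) ` C = (+) ((H k' + P k') + q) ` C"
        using e1 by (simp add: k' lf_def linv_def lact_def xact_def image_image add.assoc)
      show "(+) (?h + ((H k + P k) + q)) ` C = (+) (H k' + P k') ` C"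
        using e2 by (simp add: k' lf_def linv_def lact_def xact_def image_image add.assoc)
    qed
  qed
qed

end

section \<open>Following one window of \<open>n\<close> through a finite set of elements\<close>

lemma card_le_if_injective_relation:
  assumes "finite T" "\<And>j. j \<in> J \<Longrightarrow> \<exists>x\<in>T. R j x" "\<And>j j' x. R j x \<Longrightarrow> R j' x \<Longrightarrow> j \<in> J \<Longrightarrow> j' \<in> J \<Longrightarrow> j = j'"
  shows "card J \<le> card T"
proof -
  obtain f where f: "\<And>j. j \<in> J \<Longrightarrow> f j \<in> T \<and> R j (f j)"
    using assms(2) by metis
  have "inj_on f J"
    using f assms(3) by (metis inj_onI)
  then show ?thesis using f assms(1) by (intro card_inj_on_le[of f]) auto
qed

text \<open>\<open>V\<close> is the finite symmetric set on which additivity is wanted. With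
  \<open>L = 16 * M + 1\<close>, \<open>big\<close> says that the even positions of \<open>n\<close>
  at a safe distance from its ends outnumber the positions whose window can get lost, at most
  \<open>4 * L\<close> for each triple from \<open>V\<close>.\<close>

locale merz_window = merz A B C p1 p2 q for A B C :: "'h::group_add set" and p1 p2 q +
  fixes M :: nat and V :: "'h gg set"
  assumes finV: "finite V" and V0: "0 \<in> V" and Vm: "\<And>v. v \<in> V \<Longrightarrow> - v \<in> V" and VW: "V \<subseteq> W"
    and nV: "mk (wn (4 * (M * M))) 0 \<in> V"
    and big: "4 * (M * M) > 2 * (16 * M + 1) + card (V \<times> V \<times> V) * (2 * (2 * (16 * M + 1)))"
begin

definition "L = 16 * M + 1"
definition "w0 = wn (4 * (M * M))"
definition "n = mk w0 0"

lemma L: "L > 16 * M" by (simp add: L_def)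

lemma length_w0: "length w0 = 2 * (4 * (M * M))" and reduced_w0 [simp]: "reduced w0"
  and wd_n [simp]: "wd n = w0" and n_V: "n \<in> V"
  using nV by (simp_all add: w0_def n_def)

definition inner :: "nat \<Rightarrow> bool" where "inner j \<longleftrightarrow> L \<le> j \<and> j + L + 1 \<le> length w0"

text \<open>Only the ends of the window are required to lie on the path of \<open>v\<close>; what is
  between them follows by \<open>vact_seg\<close>.\<close>

definition carry :: "nat \<Rightarrow> 'h gg \<Rightarrow> 'h gg \<Rightarrow> bool" where
  "carry j g v \<longleftrightarrow> (\<exists>m\<le>length (wd v). vact g (take (j - L) w0) = take m (wd v)) \<and>
     (\<exists>m\<le>length (wd v). vact g (take (j + L + 1) w0) = take m (wd v))"

text \<open>\<open>i\<close> is the index in \<open>wd v\<close> of the translated middle edge, and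
  \<open>b\<close> tells whether the window is read forwards.\<close>

definition carry_at :: "nat \<Rightarrow> 'h gg \<Rightarrow> 'h gg \<Rightarrow> nat \<Rightarrow> bool \<Rightarrow> bool" where
  "carry_at j g v i b \<longleftrightarrow> L \<le> i \<and> i + L + 1 \<le> length (wd v) \<and> eact g (pe w0 j) = pe (wd v) i \<and>
     (if b then vact g (take (j - L) w0) = take (i - L) (wd v) \<and> vact g (take (j + L + 1) w0) = take (i + L + 1) (wd v)
      else vact g (take (j - L) w0) = take (i + L + 1) (wd v) \<and> vact g (take (j + L + 1) w0) = take (i - L) (wd v))"

lemma carry_carry_at:
  assumes j: "inner j" and c: "carry j g v"
  obtains i b where "carry_at j g v i b"
proof -
  obtain m where m: "m \<le> length (wd v)" "vact g (take (j - L) w0) = take m (wd v)"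
    using c by (auto simp: carry_def)
  obtain m' where m': "m' \<le> length (wd v)" "vact g (take (j + L + 1) w0) = take m' (wd v)"
    using c by (auto simp: carry_def)
  have j': "L \<le> j" "j + L + 1 \<le> length w0" using j by (auto simp: inner_def)
  have "(m' = m + (j + L + 1 - (j - L)) \<and> eact g (pe w0 j) = pe (wd v) (m + (j - (j - L)))) \<or>
     (m = m' + (j + L + 1 - (j - L)) \<and> eact g (pe w0 j) = pe (wd v) (m - Suc (j - (j - L))))"
    by (rule eact_pe_carry) (use j' m m' in auto)
  then show ?thesis
  proof (elim disjE conjE)
    assume h: "m' = m + (j + L + 1 - (j - L))" "eact g (pe w0 j) = pe (wd v) (m + (j - (j - L)))"
    then have "carry_at j g v (m + L) True"
      using m m' j' by (simp add: carry_at_def add.assoc)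
    then show ?thesis by (rule that)
  next
    assume h: "m = m' + (j + L + 1 - (j - L))" "eact g (pe w0 j) = pe (wd v) (m - Suc (j - (j - L)))"
    then have "carry_at j g v (m' + L) False"
      using m m' j' by (simp add: carry_at_def add.assoc)
    then show ?thesis by (rule that)
  qed
qed

text \<open>Here \<open>v\<close> is \<open>n\<close> itself, with path \<open>w0\<close>; by
  \<open>window_unique\<close> a window of \<open>w0\<close> can only land on itself.\<close>

lemma carry_n:
  assumes "inner j" "carry j g n"
  shows "eact g (pe w0 j) = pe w0 j"
proof -
  obtain i b where c: "carry_at j g n i b" using carry_carry_at assms by blast
  have j: "L \<le> j" "j + L + 1 \<le> length w0" using assms by (auto simp: inner_def)
  show ?thesis
  proof (cases b)
    case True
    have "i - L = j - L \<and> i + L + 1 = j + L + 1"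
      by (rule window_unique[OF L _ _ w0_def])
        (use c True j length_w0 in \<open>auto simp: carry_at_def\<close>)
    then show ?thesis using c by (simp add: carry_at_def)
  next
    case False
    have "i + L + 1 = j - L \<and> i - L = j + L + 1"
      by (rule window_unique[OF L _ _ w0_def])
        (use c False j length_w0 in \<open>auto simp: carry_at_def\<close>)
    then show ?thesis by linarith
  qed
qed

lemma carry_at_unique:
  assumes "carry_at j g v i b" "carry_at j' g' v i b" "inner j" "inner j'"
  shows "j = j'"
proof -
  have j: "L \<le> j" "j + L + 1 \<le> length w0" "L \<le> j'" "j' + L + 1 \<le> length w0"
    using assms by (auto simp: inner_def)
  have eq: "vact g (take (j - L) w0) = vact g' (take (j' - L) w0)"
    "vact g (take (j + L + 1) w0) = vact g' (take (j' + L + 1) w0)"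
    using assms(1,2) by (auto simp: carry_at_def split: if_splits)
  have bk: "vact (- g' + g) x = y" if "vact g x = vact g' y" "reduced x" "reduced y" for x y
    using that by (metis left_minus vact_0 vact_add)
  have "j' - L = j - L \<and> j' + L + 1 = j + L + 1"
    by (rule window_unique[OF L _ _ w0_def])
      (use eq j length_w0 in \<open>auto intro!: bk simp: reduced_take\<close>)
  then show ?thesis by simp
qed

text \<open>A translate of the edge has its whole window on the path of \<open>v\<close>, and the
  next step \<open>h\<close> takes the edge, but not the window, to the path of
  \<open>v'\<close>.\<close>

definition bad :: "nat \<Rightarrow> bool" where
  "bad j \<longleftrightarrow> (\<exists>g v h v'. v \<in> V \<and> h \<in> V \<and> v' \<in> V \<and> carry j g v \<and>
     cr (eact h (eact g (pe w0 j))) v' \<noteq> 0 \<and> \<not> carry j (h + g) v')"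

lemma interval_ends:
  obtains f1 f2 where "\<And>(v :: 'h gg) h v' k. k < length (wd v) \<Longrightarrow>
    cr (eact h (pe (wd v) k)) v' \<noteq> 0 \<longleftrightarrow> f1 (v, h, v') \<le> k \<and> k < (f2 (v, h, v') :: nat)"
proof -
  have "\<forall>x :: 'h gg \<times> 'h gg \<times> 'h gg. \<exists>l1 l2. \<forall>k<length (wd (fst x)).
      cr (eact (fst (snd x)) (pe (wd (fst x)) k)) (snd (snd x)) \<noteq> 0 \<longleftrightarrow> l1 \<le> k \<and> k < l2"
    using path_interval[OF reduced_wd] by blast
  then obtain f1 where "\<forall>x :: 'h gg \<times> 'h gg \<times> 'h gg. \<exists>l2. \<forall>k<length (wd (fst x)).
      cr (eact (fst (snd x)) (pe (wd (fst x)) k)) (snd (snd x)) \<noteq> 0 \<longleftrightarrow> f1 x \<le> k \<and> k < l2"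
    by metis
  then obtain f2 where f: "\<forall>x :: 'h gg \<times> 'h gg \<times> 'h gg. \<forall>k<length (wd (fst x)).
      cr (eact (fst (snd x)) (pe (wd (fst x)) k)) (snd (snd x)) \<noteq> 0 \<longleftrightarrow> f1 x \<le> k \<and> k < f2 x"
    by metis
  show ?thesis by (rule that[of f1 f2]) (use f in force)
qed

text \<open>For fixed \<open>v\<close>, \<open>h\<close>, \<open>v'\<close> the edges of
  \<open>v\<close> that \<open>h\<close> takes to the path of \<open>v'\<close> form an interval,
  and a window is lost only within distance \<open>L\<close> of its ends. That leaves
  \<open>2 * L\<close> indices and two directions, and by \<open>carry_at_unique\<close> each such
  place belongs to one \<open>j\<close> only.\<close>

lemma few_bad: "card {j. inner j \<and> bad j} \<le> card (V \<times> V \<times> V) * (2 * (2 * L))"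
proof -
  obtain f1 f2 where f: "\<And>(v :: 'h gg) h v' k. k < length (wd v) \<Longrightarrow>
      cr (eact h (pe (wd v) k)) v' \<noteq> 0 \<longleftrightarrow> f1 (v, h, v') \<le> k \<and> k < (f2 (v, h, v') :: nat)"
    using interval_ends by blast
  define S where "S x = ({f1 x..<f1 x + L} \<union> {f2 x - L..<f2 x}) \<times> (UNIV :: bool set)" for x
  have S: "finite (S x)" "card (S x) \<le> 2 * (2 * L)" for x
  proof -
    have "card ({f1 x..<f1 x + L} \<union> {f2 x - L..<f2 x}) \<le> L + L"
      by (rule order_trans[OF card_Un_le]) auto
    then show "finite (S x)" "card (S x) \<le> 2 * (2 * L)"
      by (simp_all add: S_def card_cartesian_product)
  qed
  let ?T = "SIGMA x : V \<times> V \<times> V. S x"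
  define R where "R j x \<longleftrightarrow> (\<exists>g. carry_at j g (fst (fst x)) (fst (snd x)) (snd (snd x)))"
    for j and x :: "('h gg \<times> 'h gg \<times> 'h gg) \<times> nat \<times> bool"
  have "card {j. inner j \<and> bad j} \<le> card ?T"
  proof (rule card_le_if_injective_relation[where R = R])
    show "finite ?T" using finV S by auto
  next
    fix j assume "j \<in> {j. inner j \<and> bad j}"
    then obtain g v h v' where j: "inner j" and v: "v \<in> V" "h \<in> V" "v' \<in> V" and c: "carry j g v"
      and cr: "cr (eact h (eact g (pe w0 j))) v' \<noteq> 0" and nc: "\<not> carry j (h + g) v'"
      unfolding bad_def by blast
    obtain i b where ca: "carry_at j g v i b" using carry_carry_at[OF j c] by blast
    then have i: "L \<le> i" "i + L + 1 \<le> length (wd v)" "eact g (pe w0 j) = pe (wd v) i"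
      by (auto simp: carry_at_def)
    have "f1 (v, h, v') \<le> i" "i < f2 (v, h, v')" using cr f[of i v h v'] i by auto
    moreover have "\<not> (f1 (v, h, v') \<le> i - L \<and> i + L < f2 (v, h, v'))"
    proof
      assume in1: "f1 (v, h, v') \<le> i - L \<and> i + L < f2 (v, h, v')"
      have "cr (eact h (pe (wd v) (i - L))) v' \<noteq> 0" "cr (eact h (pe (wd v) (i + L))) v' \<noteq> 0"
        using f[of "i - L" v h v'] f[of "i + L" v h v'] in1 i by auto
      then have *: "\<exists>m\<le>length (wd v'). vact h (take (i - L) (wd v)) = take m (wd v')"
        "\<exists>m\<le>length (wd v'). vact h (take (i + L + 1) (wd v)) = take m (wd v')"
        using edge_ends_on_path(1)[of "wd v" "i - L" h v'] edge_ends_on_path(2)[of "wd v" "i + L" h v'] i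
        by auto
      have "vact (h + g) (take k w0) = vact h (vact g (take k w0))" for k
        by (simp add: vact_add reduced_take)
      then have "carry j (h + g) v'"
        using * ca by (auto simp: carry_def carry_at_def split: if_splits)
      then show False using nc by simp
    qed
    ultimately have "(i, b) \<in> S (v, h, v')" by (auto simp: S_def)
    then have "((v, h, v'), i, b) \<in> ?T" using v by auto
    then show "\<exists>x\<in>?T. R j x"
      using ca by (intro bexI[of _ "((v, h, v'), i, b)"]) (auto simp: R_def)
  next
    fix j j' x
    assume "R j x" "R j' x" "j \<in> {j. inner j \<and> bad j}" "j' \<in> {j. inner j \<and> bad j}"
    then show "j = j'" using carry_at_unique by (auto simp: R_def)
  qed
  also have "\<dots> = (\<Sum>x\<in>V \<times> V \<times> V. card (S x))"
    using finV S by (intro card_SigmaI) auto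
  also have "\<dots> \<le> (\<Sum>x\<in>V \<times> V \<times> V. 2 * (2 * L))"
    by (intro sum_mono S)
  finally show ?thesis by simp
qed

lemma good_exists: "\<exists>k. inner (2 * k) \<and> \<not> bad (2 * k)"
proof (rule ccontr)
  assume no: "\<nexists>k. inner (2 * k) \<and> \<not> bad (2 * k)"
  \<comment> \<open>Only even positions are candidates: there \<open>w0\<close> has a positive
    letter, that is, a forward crossing of a \<open>t\<close>-edge.\<close>
  let ?J = "(\<lambda>k. 2 * k) ` {L..<4 * (M * M) - L}"
  have "?J \<subseteq> {j. inner j \<and> bad j}"
  proof
    fix j assume "j \<in> ?J"
    then obtain k where k: "j = 2 * k" "L \<le> k" "k < 4 * (M * M) - L" by auto
    then have "inner (2 * k)" by (auto simp: inner_def length_w0)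
    then show "j \<in> {j. inner j \<and> bad j}" using no k by auto
  qed
  moreover have "finite {j. inner j \<and> bad j}"
    by (rule finite_subset[of _ "{..length w0}"]) (auto simp: inner_def)
  ultimately have "card ?J \<le> card {j. inner j \<and> bad j}" by (rule card_mono[rotated])
  also have "\<dots> \<le> card (V \<times> V \<times> V) * (2 * (2 * L))" by (rule few_bad)
  finally have le: "4 * (M * M) - L - L \<le> card (V \<times> V \<times> V) * (2 * (2 * L))"
    by (simp add: card_image inj_on_def)
  define K where "K = card (V \<times> V \<times> V) * (2 * (2 * L))"
  show False using le big[folded L_def] unfolding K_def[symmetric] by linarith
qed

definition good :: nat where "good = (SOME k. inner (2 * k) \<and> \<not> bad (2 * k))"

lemma good: "inner (2 * good)" "\<not> bad (2 * good)"
  using someI_ex[OF good_exists] by (auto simp: good_def)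

definition e0 :: "'h edge" where "e0 = pe w0 (2 * good)"

lemma reduced_e0 [simp]: "reduced (fst e0)"
  by (simp add: e0_def pe_def reduced_take)

definition DD :: "'h edge set" where "DD = (\<Union>v\<in>V. {e. cr e v \<noteq> 0})"

text \<open>Elements reached from 0 by steps in \<open>V\<close> that keep the translate of
  \<open>e0\<close> on paths of \<open>V\<close>. The full orbit of \<open>e0\<close> under
  \<open>W\<close> would be too large, since windows are controlled along such steps only.\<close>

inductive_set RR :: "'h gg set" where
  RR_0: "0 \<in> RR"
| RR_step: "g \<in> RR \<Longrightarrow> h \<in> V \<Longrightarrow> eact h (eact g e0) \<in> DD \<Longrightarrow> h + g \<in> RR"

lemma good_len: "2 * good < length w0"
  using good(1) by (auto simp: inner_def)

lemma e0_n: "cr e0 n \<noteq> 0"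
  using good_len by (auto simp: cr_nonzero_iff trav_pe e0_def)

lemma RR_W: "g \<in> RR \<Longrightarrow> g \<in> W"
  by (induction rule: RR.induct) (use VW subgroupD[OF subgroup_W] in auto)

lemma RR_DD: "g \<in> RR \<Longrightarrow> eact g e0 \<in> DD"
proof (induction rule: RR.induct)
  case RR_0
  then show ?case using e0_n n_V by (auto simp: DD_def)
qed (simp add: eact_add)

text \<open>The window is complete at the start, where \<open>n\<close> carries it by 0. The first
  step at which it were lost would make the position bad.\<close>

lemma RR_carry:
  assumes "g \<in> RR" "v \<in> V" "cr (eact g e0) v \<noteq> 0"
  shows "carry (2 * good) g v"
  using assms
proof (induction arbitrary: v rule: RR.induct)
  case RR_0
  have "carry (2 * good) 0 n"
    unfolding carry_def wd_n vact_0
    by (intro conjI exI[of _ "2 * good - L"] exI[of _ "2 * good + L + 1"])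
      (use good(1) in \<open>auto simp: inner_def\<close>)
  show ?case
  proof (rule ccontr)
    assume "\<not> carry (2 * good) 0 v"
    then have "bad (2 * good)"
      unfolding bad_def
      by (intro exI[of _ 0] exI[of _ n] exI[of _ v])
        (use RR_0 V0 n_V \<open>carry (2 * good) 0 n\<close> in \<open>simp add: e0_def\<close>)
    then show False using good(2) by simp
  qed
next
  case (RR_step g h)
  obtain u where u: "u \<in> V" "cr (eact g e0) u \<noteq> 0"
    using RR_DD[OF RR_step.hyps(1)] by (auto simp: DD_def)
  have "carry (2 * good) g u" by (rule RR_step.IH[OF u])
  moreover have "cr (eact h (eact g e0)) v \<noteq> 0" using RR_step.prems by (simp add: eact_add)
  ultimately have "bad (2 * good)" if "\<not> carry (2 * good) (h + g) v"
    unfolding bad_def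
    by (intro exI[of _ g] exI[of _ u] exI[of _ h] exI[of _ v])
      (use that u RR_step.hyps RR_step.prems in \<open>simp add: e0_def\<close>)
  then show ?case using good(2) by blast
qed

definition Orb :: "'h edge set" where "Orb = (\<lambda>g. eact g e0) ` RR"

lemma Orb_closed: "e \<in> Orb \<Longrightarrow> h \<in> V \<Longrightarrow> eact h e \<in> DD \<Longrightarrow> eact h e \<in> Orb"
  by (auto simp: Orb_def eact_add[symmetric] intro!: imageI RR_step)

lemma Orb_n: "e \<in> Orb \<Longrightarrow> cr e n \<noteq> 0 \<longleftrightarrow> e = e0"
  using RR_carry[OF _ n_V] carry_n[OF good(1)] e0_n by (auto simp: Orb_def e0_def)

lemma e0_Orb: "e0 \<in> Orb"
  using RR_0 by (force simp: Orb_def)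

text \<open>A path that crosses such an edge contains a window of \<open>2 * L + 1\<close> letters.
  Hence the generators from the two factors, of length at most 2, will not be changed by
  \<open>sg\<close>.\<close>

lemma Orb_short:
  assumes "e \<in> Orb" "v \<in> V" "length (wd v) \<le> 2"
  shows "cr e v = 0"
proof (rule ccontr)
  assume "cr e v \<noteq> 0"
  then obtain g where "carry (2 * good) g v" using assms RR_carry by (auto simp: Orb_def)
  then obtain i b where "carry_at (2 * good) g v i b" using carry_carry_at[OF good(1)] by blast
  then show False using assms(3) by (auto simp: carry_at_def L_def)
qed

definition Z :: "'h edge \<Rightarrow> 'h gg" where "Z e = (if e \<in> Orb then es e else 0)"

text \<open>A conjugate of \<open>s\<close>, or its negative, is inserted at each crossing of an
  edge in \<open>Orb\<close>.\<close>

definition sg :: "'h gg \<Rightarrow> 'h gg" where "sg v = coc Z v + v"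

text \<open>The initial part of \<open>n\<close> that takes the \<open>t\<close>-edge at the root to
  \<open>e0\<close>.\<close>

definition n1 :: "'h gg" where "n1 = mk (wn good) (H good + P good)"

lemma n1_W: "n1 \<in> W"
proof -
  have "n1 = mk (wn good) (H good) + hh (P good)"
    unfolding n1_def by (rule gg_eqI) (simp_all add: wd_plus)
  then show ?thesis using subgroupD(2)[OF subgroup_W mk_wn_W hhA_W[OF P(1)]] by simp
qed

lemma mk_wn_centralizes: "centralizes (mk (wn m) 0) (hh ` C)"
  unfolding centralizes_def
proof (intro ballI, clarify)
  fix c assume "c \<in> C"
  then have "map (lact c) (wn m) = wn m" by (simp add: wn_def lact_lf)
  then show "hh c + mk (wn m) 0 = mk (wn m) 0 + hh c"
    by (intro gg_eqI) (simp_all add: wd_plus)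
qed

lemma n1_normalizes: "normalizes n1 (hh ` C)"
proof -
  have "n1 = mk (wn good) 0 + hh (H good + P good)"
    unfolding n1_def by (rule gg_eqI) (simp_all add: wd_plus)
  then show ?thesis
    using normalizes_add[OF centralizes_normalizes[OF mk_wn_centralizes] normalizes_image_hh[OF normalizes_add[OF normalizes_H P(2)]]]
    by simp
qed

lemma e0_eq: "e0 = (wn good, (False, (+) (H good + P good) ` C))"
  using good_len by (simp add: e0_def pe_def w0_def ledge_def take_wn lf_def)

lemma es_e0: "es e0 = n1 + s + - n1"
proof -
  have 1: "n1 = vx (wn good) + hh (H good + P good)"
    unfolding n1_def by (rule gg_eqI) (simp_all add: wd_plus)
  have 2: "lt (True, (+) (H good + P good) ` C) = hh (H good + P good) + s + - hh (H good + P good)"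
    unfolding ss_def hh_lt by (simp add: xact_def)
  show ?thesis by (simp only: es_def e0_eq fst_conv snd_conv 1 2 grps)
qed

lemma Z_E: "Z e \<in> E"
proof (cases "e \<in> Orb")
  case True
  then obtain g where g: "g \<in> RR" "e = eact g e0" by (auto simp: Orb_def)
  have "es e = g + (n1 + s + - n1) + - g" by (simp only: g es_eact[OF reduced_e0] es_e0)
  moreover have "g \<in> E" "n1 \<in> E" using RR_W[OF g(1)] n1_W W_sub_E by auto
  ultimately show ?thesis using True s_E subgroupD[OF subgroup_E] by (simp add: Z_def del: add_uminus_conv_diff)
qed (simp add: Z_def subgroupD[OF subgroup_E])

lemma sg_E: "v \<in> W \<Longrightarrow> sg v \<in> E"
  unfolding sg_def coc_def using W_sub_E by (intro subgroupD(2)[OF subgroup_E] Phi_in subgroup_E Z_E) auto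

text \<open>By \<open>coc_add\<close> it suffices that \<open>Z\<close> is equivariant under
  \<open>u\<close> along the path of \<open>v\<close>; the only question is whether \<open>u\<close>
  respects membership in \<open>Orb\<close> there.\<close>

lemma sg_add:
  assumes "u \<in> V" "v \<in> V" "u + v \<in> V"
  shows "sg (u + v) = sg u + sg v"
proof -
  have "coc (Z \<circ> eact u) v = Phi (\<lambda>e. u + Z e + - u) [] (wd v)"
    unfolding coc_def
  proof (rule Phi_cong)
    fix e assume e: "e \<in> trav [] (wd v)"
    have r: "reduced (fst e)" using trav_reduced[of "[]"] e by simp
    have "cr e v \<noteq> 0" using e by (simp add: cr_nonzero_iff)
    then have eD: "e \<in> DD" using assms by (auto simp: DD_def)
    \<comment> \<open>So the translated edge is on the path of \<open>u\<close> or of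
      \<open>u + v\<close>. Both it and \<open>e\<close> then belong to \<open>DD\<close>, and the
      closure of \<open>Orb\<close> can be used for \<open>u\<close> and for
      \<open>- u\<close>.\<close>
    have "cr (eact u e) (u + v) = cr (eact u e) u + cr e v" by (rule cr_add[OF r])
    then have "cr (eact u e) (u + v) \<noteq> 0 \<or> cr (eact u e) u \<noteq> 0" using \<open>cr e v \<noteq> 0\<close> by auto
    then have ueD: "eact u e \<in> DD" using assms by (auto simp: DD_def)
    have "e \<in> Orb \<longleftrightarrow> eact u e \<in> Orb"
      using Orb_closed[OF _ assms(1) ueD] Orb_closed[of "eact u e" "- u"] Vm[OF assms(1)] eD r by auto
    then show "(Z \<circ> eact u) e = u + Z e + - u"
      using es_eact[OF r, of u] by (simp add: Z_def del: add_uminus_conv_diff)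
  qed
  also have "\<dots> = u + Phi Z [] (wd v) + - u"
    by (rule Phi_hom) (simp only: grps)
  finally have "coc (Z \<circ> eact u) v = u + coc Z v + - u" by (simp only: coc_def)
  then show ?thesis by (simp only: sg_def coc_add grps)
qed

definition forget :: "'h gg \<Rightarrow> 'h gg" where "forget = subst C t 0"

text \<open>Every inserted factor is a conjugate of a letter of type \<open>s\<close> and vanishes
  when \<open>s\<close> is put to 0. This yields injectivity of \<open>sg\<close>.\<close>

lemma forget_sg:
  assumes v: "v \<in> W"
  shows "forget (sg v) = v"
proof -
  interpret f: subst_hom C t 0 by unfold_locales (use sC centralizes_tt in auto)
  have lam0: "lam C (\<lambda>i. if i then 0 else t) (True, Y) = 0" for Y
    by (simp add: lam_def Let_def)
  have "forget (lt (True, Y)) = 0" for Y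
    by (simp add: forget_def subst_def sub_def lam0)
  then have "forget (Z e) = 0" for e
    by (simp add: Z_def es_def forget_def f.add del: add_uminus_conv_diff)
  then have "forget (coc Z v) = 0"
    using Phi_hom[of forget Z "[]" "wd v"] by (simp add: coc_def forget_def f.add)
  moreover have "forget v = v" unfolding forget_def by (rule subst_t_W) (use v in auto)
  ultimately show ?thesis by (simp add: sg_def forget_def f.add)
qed

lemma sg_short: 
  assumes "v \<in> V" "length (wd v) \<le> 2"
  shows "sg v = v"
proof -
  have "coc Z v = Phi (\<lambda>_. 0) [] (wd v)"
    unfolding coc_def by (rule Phi_cong) (use Orb_short[OF _ assms] in \<open>auto simp: Z_def cr_nonzero_iff[symmetric]\<close>)
  then show ?thesis by (simp add: sg_def)
qed

text \<open>The path of \<open>n\<close> meets \<open>Orb\<close> in \<open>e0\<close> only, and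
  crosses it once and forwards.\<close>

lemma sg_n: "sg n = n1 + s + - n1 + n"
proof -
  have "coc Z n = Phi (\<lambda>e. if e = e0 then es e0 else 0) [] (wd n)"
    unfolding coc_def
  proof (rule Phi_cong)
    fix e assume "e \<in> trav [] (wd n)"
    then have "cr e n \<noteq> 0" by (simp add: cr_nonzero_iff)
    then show "Z e = (if e = e0 then es e0 else 0)"
      using Orb_n[of e] e0_Orb by (cases "e = e0") (auto simp: Z_def)
  qed
  also have "\<dots> = es e0"
  proof -
    let ?F = "\<lambda>e. if e = e0 then es e0 else 0"
    have split: "w0 = take (2 * good) w0 @ w0 ! (2 * good) # drop (Suc (2 * good)) w0"
      using good_len by (rule id_take_nth_drop)
    have pre: "Phi ?F [] (take k w0) = 0" if "k \<le> 2 * good" for k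
    proof -
      have "Phi ?F [] (take k w0) = Phi (\<lambda>_. 0) [] (take k w0)"
      proof (rule Phi_cong)
        fix e assume "e \<in> trav [] (take k w0)"
        then obtain i where "i < k" "i < length w0" "e = pe (take k w0) i"
          by (auto simp: trav_pe reduced_take)
        then have "e = pe w0 i" "i \<noteq> 2 * good" "i < length w0" using that by (auto simp: pe_def)
        then show "?F e = 0" using pe_inj[OF reduced_w0 _ good_len] by (auto simp: e0_def)
      qed
      then show ?thesis by simp
    qed
    have post: "Phi ?F p (drop k w0) = 0" if p: "p = take k w0" and k: "k > 2 * good" for k p
    proof -
      have "Phi ?F p (drop k w0) = Phi (\<lambda>_. 0) p (drop k w0)"
      proof (rule Phi_cong)
        fix e assume e: "e \<in> trav p (drop k w0)"
        have tr: "trav (take k w0) (drop k w0) \<subseteq> pe w0 ` {k..<length w0}" for k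
        proof (induction "length w0 - k" arbitrary: k)
          case (Suc x)
          then have k: "k < length w0" by simp
          have "drop k w0 = w0 ! k # drop (Suc k) w0" using k by (simp add: Cons_nth_drop_Suc)
          moreover have "lapp (take k w0) [w0 ! k] = take (Suc k) w0"
            using k by (simp add: take_Suc_lapp)
          moreover have "trav (take (Suc k) w0) (drop (Suc k) w0) \<subseteq> pe w0 ` {Suc k..<length w0}"
            using Suc by simp
          moreover have "ledge (take k w0) (w0 ! k) = pe w0 k" by (simp add: pe_def)
          ultimately show ?case using k by auto
        qed simp
        then obtain i where i: "i \<ge> k" "i < length w0" "e = pe w0 i" using e p by fastforce
        have "e \<noteq> e0"
        proof
          assume "e = e0"
          then have "i = 2 * good" using pe_inj[OF reduced_w0 i(2) good_len] i by (simp add: e0_def)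
          then show False using i k by simp
        qed
        then show "?F e = 0" by simp
      qed
      then show ?thesis by simp
    qed
    have "snd (w0 ! (2 * good))" using good_len by (simp add: w0_def lf_def)
    have "Phi ?F [] w0 = Phi ?F [] (take (2 * good) w0) +
        (?F (ledge (take (2 * good) w0) (w0 ! (2 * good))) +
         Phi ?F (lapp (take (2 * good) w0) [w0 ! (2 * good)]) (drop (Suc (2 * good)) w0))"
      using \<open>snd _\<close> by (subst split) (simp add: Phi_append pend_lapp reduced_take del: take_append)
    also have "\<dots> = es e0"
      using pre[of "2 * good"] post[of "take (Suc (2 * good)) w0" "Suc (2 * good)"] good_len
      by (simp add: take_Suc_lapp e0_def pe_def)
    finally show ?thesis by simp
  qed
  finally show ?thesis by (simp only: sg_def es_e0)
qed

end

text \<open>A map that is additive only inside a finite set can still be evaluated on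
  \<open>y\<close> if this set contains the images of all partial sums of one expression of
  \<open>y\<close> in the generators. Negative factors are covered by reading
  \<open>x + (- x + y) = y\<close>.\<close>

lemma gen_finite_witness:
  fixes y :: "'g::group_add"
  assumes "y \<in> gen S"
  shows "\<exists>F. finite F \<and> F \<subseteq> gen S \<and> (\<forall>(\<phi> :: 'g \<Rightarrow> 'k::group_add) \<sigma>.
    (\<forall>x y. \<phi> (x + y) = \<phi> x + \<phi> y) \<longrightarrow>
    (\<forall>x\<in>\<phi> ` F. \<forall>y\<in>\<phi> ` F. x + y \<in> \<phi> ` F \<longrightarrow> \<sigma> (x + y) = \<sigma> x + \<sigma> y) \<longrightarrow>
    (\<forall>g\<in>S. \<sigma> (\<phi> g) = g) \<longrightarrow> \<sigma> (\<phi> y) = y)"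
  using assms
proof (induction rule: gen.induct)
  case gen_0
  show ?case
  proof (intro exI[of _ "{0}"] conjI allI impI)
    fix \<phi> :: "'g \<Rightarrow> 'k" and \<sigma> :: "'k \<Rightarrow> 'g"
    assume "\<forall>x y. \<phi> (x + y) = \<phi> x + \<phi> y"
      and p: "\<forall>x\<in>\<phi> ` {0}. \<forall>y\<in>\<phi> ` {0}. x + y \<in> \<phi> ` {0} \<longrightarrow> \<sigma> (x + y) = \<sigma> x + \<sigma> y"
    then have "\<phi> 0 = 0" using hom_0[of \<phi>] by blast
    then have "\<sigma> 0 + \<sigma> 0 = \<sigma> 0 + 0" using p by simp
    then show "\<sigma> (\<phi> 0) = 0" using \<open>\<phi> 0 = 0\<close> by (simp only: add_left_cancel)
  qed (auto intro: gen.gen_0)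
next
  case (gen_add x y)
  then obtain F where F: "finite F" "F \<subseteq> gen S" "\<And>\<phi> :: 'g \<Rightarrow> 'k. \<And>\<sigma>. (\<forall>x y. \<phi> (x + y) = \<phi> x + \<phi> y) \<Longrightarrow>
    (\<forall>x\<in>\<phi> ` F. \<forall>y\<in>\<phi> ` F. x + y \<in> \<phi> ` F \<longrightarrow> \<sigma> (x + y) = \<sigma> x + \<sigma> y) \<Longrightarrow>
    (\<forall>g\<in>S. \<sigma> (\<phi> g) = g) \<Longrightarrow> \<sigma> (\<phi> y) = y" by metis
  show ?case
  proof (intro exI[of _ "F \<union> {x, y, x + y}"] conjI allI impI)
    fix \<phi> :: "'g \<Rightarrow> 'k" and \<sigma> :: "'k \<Rightarrow> 'g"
    assume h: "\<forall>x y. \<phi> (x + y) = \<phi> x + \<phi> y"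
      and p: "\<forall>u\<in>\<phi> ` (F \<union> {x, y, x + y}). \<forall>v\<in>\<phi> ` (F \<union> {x, y, x + y}). u + v \<in> \<phi> ` (F \<union> {x, y, x + y}) \<longrightarrow> \<sigma> (u + v) = \<sigma> u + \<sigma> v"
      and s: "\<forall>g\<in>S. \<sigma> (\<phi> g) = g"
    have "\<sigma> (\<phi> y) = y" using p by (intro F(3) h s) blast
    moreover have "\<phi> x + \<phi> y = \<phi> (x + y)" using h by simp
    moreover from this have "\<sigma> (\<phi> x + \<phi> y) = \<sigma> (\<phi> x) + \<sigma> (\<phi> y)" using p by blast
    ultimately show "\<sigma> (\<phi> (x + y)) = x + y" using s gen_add.hyps(1) by simp
  qed (use F gen_add in \<open>auto intro: gen.gen_add gen_base\<close>)
next
  case (gen_minus x y)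
  then obtain F where F: "finite F" "F \<subseteq> gen S" "\<And>\<phi> :: 'g \<Rightarrow> 'k. \<And>\<sigma>. (\<forall>x y. \<phi> (x + y) = \<phi> x + \<phi> y) \<Longrightarrow>
    (\<forall>x\<in>\<phi> ` F. \<forall>y\<in>\<phi> ` F. x + y \<in> \<phi> ` F \<longrightarrow> \<sigma> (x + y) = \<sigma> x + \<sigma> y) \<Longrightarrow>
    (\<forall>g\<in>S. \<sigma> (\<phi> g) = g) \<Longrightarrow> \<sigma> (\<phi> y) = y" by metis
  let ?z = "- x + y"
  show ?case
  proof (intro exI[of _ "F \<union> {x, y, ?z}"] conjI allI impI)
    fix \<phi> :: "'g \<Rightarrow> 'k" and \<sigma> :: "'k \<Rightarrow> 'g"
    assume h: "\<forall>x y. \<phi> (x + y) = \<phi> x + \<phi> y"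
      and p: "\<forall>u\<in>\<phi> ` (F \<union> {x, y, ?z}). \<forall>v\<in>\<phi> ` (F \<union> {x, y, ?z}). u + v \<in> \<phi> ` (F \<union> {x, y, ?z}) \<longrightarrow> \<sigma> (u + v) = \<sigma> u + \<sigma> v"
      and s: "\<forall>g\<in>S. \<sigma> (\<phi> g) = g"
    have "\<sigma> (\<phi> y) = y" using p by (intro F(3) h s) blast
    moreover have e: "\<phi> x + \<phi> ?z = \<phi> y" using h[rule_format, of x ?z] by simp
    moreover from this have "\<sigma> (\<phi> x + \<phi> ?z) = \<sigma> (\<phi> x) + \<sigma> (\<phi> ?z)" using p by blast
    ultimately have "y = x + \<sigma> (\<phi> ?z)" using s gen_minus.hyps(1) by simp
    then have "- x + y = - x + (x + \<sigma> (\<phi> ?z))" by simp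
    then show "\<sigma> (\<phi> ?z) = ?z" by (simp only: grps)
  qed (use F gen_minus in \<open>auto intro: gen.gen_minus gen_base\<close>)
qed

lemma length_tc: "length (wd (tc C b)) \<le> 2"
  by (simp add: tc_def tt_def wd_plus wd_uminus linv_def lact_def del: add_uminus_conv_diff)

text \<open>The left side is at most \<open>(2 + 4 * k) * (17 * M) = M * (34 + 68 * k)\<close>, and
  the factor 100 in \<open>M\<close> is ample for this to stay below
  \<open>M * (4 * M)\<close>.\<close>

lemma big_bound:
  fixes k :: nat
  defines "M \<equiv> 100 * (k + 1)"
  assumes "x \<le> k"
  shows "2 * (16 * M + 1) + x * (2 * (2 * (16 * M + 1))) < 4 * (M * M)"
proof -
  have "16 * M + 1 \<le> 17 * M" by (simp add: M_def)
  have "2 * (16 * M + 1) + x * (2 * (2 * (16 * M + 1))) = (2 + 4 * x) * (16 * M + 1)"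
    by (simp add: algebra_simps)
  also have "\<dots> \<le> (2 + 4 * k) * (17 * M)"
    using assms(2) \<open>16 * M + 1 \<le> 17 * M\<close> by (intro mult_le_mono) auto
  also have "\<dots> = M * (34 + 68 * k)" by (simp add: algebra_simps)
  also have "\<dots> < M * (4 * M)"
    by (simp add: M_def)
  finally show ?thesis by (simp add: ac_simps)
qed

context merz
begin

text \<open>The order of quantifiers is the point: \<open>n\<close> depends on \<open>Y\<close> and
  on the size bound \<open>N\<close>, but not on \<open>V\<close>. The map \<open>sg\<close> sends
  \<open>n\<close> to \<open>n1 + s - n1 + n\<close> instead of \<open>s\<close>; an automorphism of
  \<open>E\<close> that fixes \<open>W\<close> corrects this, and the result inverts the
  substitution of \<open>n\<close> for \<open>s\<close> on \<open>Y\<close>.\<close>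

theorem formal_solution:
  assumes fin: "finite A" "finite B" and Y: "finite Y" "Y \<subseteq> E"
  shows "\<exists>n\<in>W. centralizes n (hh ` C) \<and>
    (\<forall>V\<subseteq>W. finite V \<longrightarrow> card V \<le> N \<longrightarrow>
      (\<exists>\<sigma>. (\<forall>x\<in>V \<union> subst C t n ` Y. \<forall>y\<in>V \<union> subst C t n ` Y. x + y \<in> V \<union> subst C t n ` Y \<longrightarrow> \<sigma> (x + y) = \<sigma> x + \<sigma> y) \<and>
        inj_on \<sigma> (V \<union> subst C t n ` Y) \<and> \<sigma> ` (V \<union> subst C t n ` Y) \<subseteq> E \<and>
        (\<forall>y\<in>Y. \<sigma> (subst C t n y) = y)))"
proof -
  let ?S = "hh ` A \<union> tc C ` B \<union> {s}"
  let ?Q = "\<lambda>y F. finite F \<and> F \<subseteq> E \<and> (\<forall>(\<phi> :: 'h gg \<Rightarrow> 'h gg) \<sigma>.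
    (\<forall>x y. \<phi> (x + y) = \<phi> x + \<phi> y) \<longrightarrow>
    (\<forall>x\<in>\<phi> ` F. \<forall>y\<in>\<phi> ` F. x + y \<in> \<phi> ` F \<longrightarrow> \<sigma> (x + y) = \<sigma> x + \<sigma> y) \<longrightarrow>
    (\<forall>g\<in>?S. \<sigma> (\<phi> g) = g) \<longrightarrow> \<sigma> (\<phi> y) = y)"
  have "\<forall>y\<in>Y. \<exists>F. ?Q y F"
  proof
    fix y assume "y \<in> Y"
    then have "y \<in> gen ?S" using Y(2) by (auto simp: EE_def)
    from gen_finite_witness[where 'k = "'h gg", OF this] show "\<exists>F. ?Q y F" unfolding EE_def .
  qed
  then have "\<exists>F. \<forall>y\<in>Y. ?Q y (F y)" by (rule bchoice)
  then obtain F where F: "\<And>y. y \<in> Y \<Longrightarrow> ?Q y (F y)" by (elim exE) (rule that, erule bspec)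
  define Fs where "Fs = ?S \<union> Y \<union> (\<Union>y\<in>Y. F y)"
  have Fs: "finite Fs" "Fs \<subseteq> E"
    using F Y fin hhA_W tcB_W W_sub_E s_E by (auto simp: Fs_def)
  \<comment> \<open>Bounds the set that will be used: 0, together with \<open>V\<close>, the image
    of \<open>Fs\<close> and \<open>n\<close>, and the negatives of these.\<close>
  define K where "K = 2 * (N + card Fs + 1) + 1"
  define M where "M = 100 * (K * (K * K) + 1)"
  define n where "n = mk (wn (4 * (M * M))) 0"
  have nW: "n \<in> W" using mk_wn_W[of "4 * (M * M)"] H_block[of "M * M"] by (simp add: n_def)
  have nC: "centralizes n (hh ` C)"
    unfolding centralizes_def
  proof (intro ballI, clarify)
    fix c assume "c \<in> C"
    then have "map (lact c) (wn m) = wn m" for m by (simp add: wn_def lact_lf)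
    then show "hh c + n = n + hh c"
      unfolding n_def by (intro gg_eqI) (simp_all add: wd_plus)
  qed
  let ?\<phi> = "subst C t n"
  interpret f: subst_hom C t n by unfold_locales (use sC centralizes_tt nC in auto)
  have fFs: "?\<phi> ` Fs \<subseteq> W" using subst_t_E[OF nC _ nW _ subgroup_W] Fs by auto
  show ?thesis
  proof (intro bexI[OF _ nW] conjI nC allI impI)
    fix V assume V: "V \<subseteq> W" "finite V" "card V \<le> N"
    define V0 where "V0 = V \<union> ?\<phi> ` Fs \<union> {n}"
    define V' where "V' = insert 0 (V0 \<union> uminus ` V0)"
    have V0: "finite V0" "V0 \<subseteq> W" using V Fs fFs nW by (auto simp: V0_def)
    have "card V0 \<le> N + card Fs + 1"
    proof -
      have "card V0 \<le> card (V \<union> ?\<phi> ` Fs) + card {n}" unfolding V0_def by (rule card_Un_le)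
      also have "card (V \<union> ?\<phi> ` Fs) \<le> card V + card (?\<phi> ` Fs)" by (rule card_Un_le)
      also have "card (?\<phi> ` Fs) \<le> card Fs" using Fs by (intro card_image_le)
      finally show ?thesis using V by simp
    qed
    moreover have "card V' \<le> 1 + (card V0 + card V0)"
    proof -
      have "card V' \<le> Suc (card (V0 \<union> uminus ` V0))" unfolding V'_def using V0 by (intro card_insert_le_m1) auto
      also have "card (V0 \<union> uminus ` V0) \<le> card V0 + card (uminus ` V0)" by (rule card_Un_le)
      also have "card (uminus ` V0) \<le> card V0" using V0 by (intro card_image_le)
      finally show ?thesis by simp
    qed
    ultimately have cV': "card V' \<le> K" by (simp add: K_def)
    have "card (V' \<times> V' \<times> V') \<le> K * (K * K)"
      using cV' by (simp add: card_cartesian_product mult_le_mono)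
    then have big: "2 * (16 * M + 1) + card (V' \<times> V' \<times> V') * (2 * (2 * (16 * M + 1))) < 4 * (M * M)"
      unfolding M_def by (rule big_bound)
    interpret w: merz_window A B C p1 p2 q M V'
    proof unfold_locales
      show "finite V'" "0 \<in> V'" using V0 by (simp_all add: V'_def)
      show "- v \<in> V'" if "v \<in> V'" for v using that by (auto simp: V'_def)
      show "V' \<subseteq> W" using V0 subgroupD(1,3)[OF subgroup_W] by (auto simp: V'_def)
      show "mk (wn (4 * (M * M))) 0 \<in> V'" by (simp add: V'_def V0_def n_def)
    qed (rule big)
    have wn: "w.n = n" by (simp add: w.n_def w.w0_def n_def)
    \<comment> \<open>\<open>b\<close> solves \<open>n1 + b - n1 + n = s\<close>, so substituting it
      for \<open>s\<close> turns \<open>sg n\<close> into \<open>s\<close>. The substitution of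
      \<open>b'\<close> undoes that of \<open>b\<close>.\<close>
    define b where "b = - w.n1 + (s + - n) + - (- w.n1)"
    define b' where "b' = w.n1 + s + - w.n1 + n"
    have bC: "centralizes b (hh ` C)" unfolding b_def
      by (intro centralizes_conj normalizes_uminus w.n1_normalizes centralizes_add centralizes_uminus nC centralizes_ss sC)
    have b'C: "centralizes b' (hh ` C)" unfolding b'_def
      by (intro centralizes_conj w.n1_normalizes centralizes_add nC centralizes_ss sC)
    interpret h: subst_hom C t b by unfold_locales (use sC centralizes_tt bC in auto)
    interpret h': subst_hom C t b' by unfold_locales (use sC centralizes_tt b'C in auto)
    have hW: "subst C t b x = x" if "x \<in> W" for x by (rule subst_t_W[OF bC that])
    have h'W: "subst C t b' x = x" if "x \<in> W" for x by (rule subst_t_W[OF b'C that])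
    have bE: "b \<in> E" unfolding b_def
      using W_sub_E w.n1_W nW s_E by (intro subgroupD[OF subgroup_E]) auto
    have hE: "subst C t b x \<in> E" if "x \<in> E" for x
      by (rule subst_t_E[OF bC that bE W_sub_E subgroup_E])
    have hh': "subst C t b' (subst C t b x) = x" if "x \<in> E" for x
    proof -
      have "subst C t b' (subst C t b s) = s"
      proof -
        have "subst C t b' b = - w.n1 + (b' + - n) + - (- w.n1)"
          unfolding b_def using h'W[OF w.n1_W] h'W[OF nW] by (simp only: h'.add h'.uminus h'.ss)
        also have "\<dots> = s" unfolding b'_def by (simp only: grps)
        finally show ?thesis by simp
      qed
      note hs = this
      show ?thesis
      proof (rule hom_gen_eq[where f = "\<lambda>x. subst C t b' (subst C t b x)" and g = "\<lambda>x. x" and S = ?S])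
        fix x assume "x \<in> ?S"
        then consider "x \<in> W" | "x = s" using hhA_W tcB_W by auto
        then show "subst C t b' (subst C t b x) = x"
          using hs hW h'W by cases simp_all
      next
        show "x \<in> gen ?S" using that by (simp only: EE_def)
      qed (simp_all only: h.add h'.add)
    qed
    define \<sigma> where "\<sigma> x = subst C t b (w.sg x)" for x
    have V'W: "V' \<subseteq> W" by (rule w.VW)
    have padd: "\<sigma> (x + y) = \<sigma> x + \<sigma> y" if "x \<in> V'" "y \<in> V'" "x + y \<in> V'" for x y
      using w.sg_add[OF that] by (simp add: \<sigma>_def h.add)
    have inj: "inj_on \<sigma> V'"
    proof (rule inj_onI)
      fix x y assume xy: "x \<in> V'" "y \<in> V'" "\<sigma> x = \<sigma> y"
      then have "x \<in> W" "y \<in> W" using V'W by auto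
      then show "x = y" using xy(3) hh'[OF w.sg_E] w.forget_sg unfolding \<sigma>_def by metis
    qed
    have \<sigma>E: "\<sigma> ` V' \<subseteq> E" using w.sg_E V'W hE by (auto simp: \<sigma>_def)
    have FsV': "?\<phi> x \<in> V'" if "x \<in> Fs" for x using that by (simp add: V'_def V0_def)
    have \<sigma>S: "\<sigma> (?\<phi> g) = g" if g: "g \<in> ?S" for g
    proof -
      have gV: "?\<phi> g \<in> V'" by (intro FsV') (use g in \<open>auto simp: Fs_def\<close>)
      have "g = s \<or> (g \<in> W \<and> length (wd g) \<le> 2)"
        using g hhA_W tcB_W length_tc by auto
      then consider "g \<in> W" "length (wd g) \<le> 2" | "g = s" by blast
      then show ?thesis
      proof cases
        case 1
        then have "?\<phi> g = g" by (intro subst_t_W nC)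
        then show ?thesis using w.sg_short[of g] 1 gV hW by (simp add: \<sigma>_def)
      next
        case 2
        then have "\<sigma> (?\<phi> g) = subst C t b (w.n1 + s + - w.n1 + n)"
          using w.sg_n by (simp add: \<sigma>_def wn)
        also have "\<dots> = w.n1 + b + - w.n1 + n"
          using hW[OF w.n1_W] hW[OF nW] by (simp only: h.add h.uminus h.ss)
        also have "\<dots> = s" unfolding b_def by (simp only: grps)
        finally show ?thesis using 2 by simp
      qed
    qed
    have sub: "V \<union> ?\<phi> ` Y \<subseteq> V'" by (auto simp: V'_def V0_def Fs_def)
    show "\<exists>\<sigma>. (\<forall>x\<in>V \<union> ?\<phi> ` Y. \<forall>y\<in>V \<union> ?\<phi> ` Y. x + y \<in> V \<union> ?\<phi> ` Y \<longrightarrow> \<sigma> (x + y) = \<sigma> x + \<sigma> y) \<and>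
        inj_on \<sigma> (V \<union> ?\<phi> ` Y) \<and> \<sigma> ` (V \<union> ?\<phi> ` Y) \<subseteq> E \<and> (\<forall>y\<in>Y. \<sigma> (?\<phi> y) = y)"
    proof (intro exI[of _ \<sigma>] conjI ballI impI)
      fix x y assume "x \<in> V \<union> ?\<phi> ` Y" "y \<in> V \<union> ?\<phi> ` Y" "x + y \<in> V \<union> ?\<phi> ` Y"
      then show "\<sigma> (x + y) = \<sigma> x + \<sigma> y" using sub by (intro padd) auto
    next
      show "inj_on \<sigma> (V \<union> ?\<phi> ` Y)" using inj sub by (rule inj_on_subset)
      show "\<sigma> ` (V \<union> ?\<phi> ` Y) \<subseteq> E" using \<sigma>E sub by blast
    next
      fix y assume y: "y \<in> Y"
      have "F y \<subseteq> Fs" using y by (auto simp: Fs_def)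
      then have "\<forall>x\<in>?\<phi> ` F y. \<forall>z\<in>?\<phi> ` F y. x + z \<in> ?\<phi> ` F y \<longrightarrow> \<sigma> (x + z) = \<sigma> x + \<sigma> z"
        using FsV' padd by (metis (no_types, lifting) imageE subset_iff)
      then show "\<sigma> (?\<phi> y) = y" using F[OF y] f.add \<sigma>S by blast
    qed
  qed
qed

end

subsection \<open>Transfer of quantifier-free formulas\<close>

fun sts :: "gterm \<Rightarrow> gterm set" where
  "sts (GVar v) = {GVar v}"
| "sts GOne = {GOne}"
| "sts (GMul a b) = insert (GMul a b) (sts a \<union> sts b)"
| "sts (GInv a) = insert (GInv a) (sts a)"

fun qts :: "gqf \<Rightarrow> gterm set" where
  "qts (QEq a b) = sts a \<union> sts b"
| "qts (QNot p) = qts p"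
| "qts (QAnd p q) = qts p \<union> qts q"
| "qts (QOr p q) = qts p \<union> qts q"

lemma finite_sts [simp]: "finite (sts a)" by (induction a) auto
lemma finite_qts [simp]: "finite (qts p)" by (induction p) auto
lemma sts_self: "a \<in> sts a" by (cases a) auto
lemma sts_vars: "b \<in> sts a \<Longrightarrow> gterm_vars b \<subseteq> gterm_vars a" by (induction a) auto
lemma qts_vars: "b \<in> qts p \<Longrightarrow> gterm_vars b \<subseteq> gqf_vars p"
  by (induction p) (auto dest: sts_vars)

lemma gterm_eval_closed:
  assumes "group G" "\<And>v. v \<in> gterm_vars a \<Longrightarrow> \<rho> v \<in> carrier G"
  shows "gterm_eval G \<rho> a \<in> carrier G"
proof -
  interpret group G by fact
  show ?thesis using assms(2) by (induction a) auto
qed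

lemma gterm_eval_cong: "(\<And>v. v \<in> gterm_vars a \<Longrightarrow> \<rho> v = \<rho>' v) \<Longrightarrow> gterm_eval G \<rho> a = gterm_eval G \<rho>' a"
  by (induction a) auto

lemma gqf_sat_cong: "(\<And>v. v \<in> gqf_vars p \<Longrightarrow> \<rho> v = \<rho>' v) \<Longrightarrow> gqf_sat G \<rho> p = gqf_sat G \<rho>' p"
proof (induction p)
  case (QEq a b)
  then show ?case using gterm_eval_cong[of a \<rho> \<rho>' G] gterm_eval_cong[of b \<rho> \<rho>' G] by auto
qed auto

text \<open>A quantifier-free formula sees only the values of its subterms, so a map that is
  multiplicative on a set containing them preserves it, provided the map is injective there.\<close>

locale partial_hom =
  fixes G :: "('a, 'x) monoid_scheme" and H :: "('b, 'y) monoid_scheme" and V and \<sigma> :: "'a \<Rightarrow> 'b"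
  assumes G: "group G" and H: "group H" and VG: "V \<subseteq> carrier G" and \<sigma>V: "\<sigma> ` V \<subseteq> carrier H"
    and one: "\<one>\<^bsub>G\<^esub> \<in> V"
    and mult: "\<And>x y. x \<in> V \<Longrightarrow> y \<in> V \<Longrightarrow> x \<otimes>\<^bsub>G\<^esub> y \<in> V \<Longrightarrow> \<sigma> (x \<otimes>\<^bsub>G\<^esub> y) = \<sigma> x \<otimes>\<^bsub>H\<^esub> \<sigma> y"
begin

interpretation G: group G by (rule G)
interpretation H: group H by (rule H)

lemma \<sigma>_one: "\<sigma> \<one>\<^bsub>G\<^esub> = \<one>\<^bsub>H\<^esub>"
proof -
  have "\<sigma> \<one>\<^bsub>G\<^esub> \<in> carrier H" using \<sigma>V one by auto
  moreover have "\<sigma> \<one>\<^bsub>G\<^esub> \<otimes>\<^bsub>H\<^esub> \<sigma> \<one>\<^bsub>G\<^esub> = \<sigma> \<one>\<^bsub>G\<^esub>" using mult[OF one one] one by simp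
  ultimately show ?thesis by (simp add: H.r_cancel_one)
qed

lemma gterm_transfer:
  "(\<And>b. b \<in> sts a \<Longrightarrow> gterm_eval G \<rho> b \<in> V) \<Longrightarrow> gterm_eval H (\<sigma> \<circ> \<rho>) a = \<sigma> (gterm_eval G \<rho> a)"
proof (induction a)
  case GOne
  then show ?case by (simp add: \<sigma>_one)
next
  case (GMul a b)
  have v: "gterm_eval G \<rho> a \<in> V" "gterm_eval G \<rho> b \<in> V" "gterm_eval G \<rho> a \<otimes>\<^bsub>G\<^esub> gterm_eval G \<rho> b \<in> V"
    using GMul.prems[of a] GMul.prems[of b] GMul.prems[of "GMul a b"] by (auto simp: sts_self)
  have "gterm_eval H (\<sigma> \<circ> \<rho>) a = \<sigma> (gterm_eval G \<rho> a)" "gterm_eval H (\<sigma> \<circ> \<rho>) b = \<sigma> (gterm_eval G \<rho> b)"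
    using GMul.prems by (auto intro!: GMul.IH simp del: comp_apply)
  then show ?case using mult[OF v] by (simp only: gterm_eval.simps)
next
  case (GInv a)
  let ?x = "gterm_eval G \<rho> a"
  have x: "?x \<in> V" "inv\<^bsub>G\<^esub> ?x \<in> V" using GInv.prems[of a] GInv.prems[of "GInv a"] by (auto simp: sts_self)
  then have c: "?x \<in> carrier G" "\<sigma> ?x \<in> carrier H" "\<sigma> (inv\<^bsub>G\<^esub> ?x) \<in> carrier H" using VG \<sigma>V by auto
  have "\<sigma> (inv\<^bsub>G\<^esub> ?x) \<otimes>\<^bsub>H\<^esub> \<sigma> ?x = \<one>\<^bsub>H\<^esub>"
    using mult[of "inv\<^bsub>G\<^esub> ?x" ?x] x c one \<sigma>_one by simp
  then have "inv\<^bsub>H\<^esub> (\<sigma> ?x) = \<sigma> (inv\<^bsub>G\<^esub> ?x)" using c by (metis H.inv_equality)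
  then show ?case using GInv by simp
qed simp

lemma gqf_transfer:
  assumes "inj_on \<sigma> V"
  shows "(\<And>b. b \<in> qts p \<Longrightarrow> gterm_eval G \<rho> b \<in> V) \<Longrightarrow> gqf_sat H (\<sigma> \<circ> \<rho>) p = gqf_sat G \<rho> p"
proof (induction p)
  case (QEq a b)
  then have "gterm_eval G \<rho> a \<in> V" "gterm_eval G \<rho> b \<in> V" by (auto simp: sts_self)
  moreover have "gterm_eval H (\<sigma> \<circ> \<rho>) a = \<sigma> (gterm_eval G \<rho> a)" "gterm_eval H (\<sigma> \<circ> \<rho>) b = \<sigma> (gterm_eval G \<rho> b)"
    using QEq by (auto intro!: gterm_transfer simp del: comp_apply)
  ultimately show ?case using inj_on_eq_iff[OF assms] by (simp only: gqf_sat.simps)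
qed auto

end

definition gm :: "'g::group_add set \<Rightarrow> 'g monoid" where
  "gm U = \<lparr>carrier = U, monoid.mult = (+), one = 0\<rparr>"

lemma gm_simps [simp]: "carrier (gm U) = U" "x \<otimes>\<^bsub>gm U\<^esub> y = x + y" "\<one>\<^bsub>gm U\<^esub> = 0"
  by (simp_all add: gm_def)

lemma group_gm: "is_subgroup U \<Longrightarrow> group (gm U)"
proof (rule groupI)
  fix x assume "is_subgroup U" "x \<in> carrier (gm U)"
  then show "\<exists>y\<in>carrier (gm U). y \<otimes>\<^bsub>gm U\<^esub> x = \<one>\<^bsub>gm U\<^esub>"
    by (intro bexI[of _ "- x"]) (auto simp: is_subgroup_def)
qed (auto simp: is_subgroup_def add.assoc)

lemma AE_holds_iso_imp:
  assumes G: "group G" and H: "group H" and f: "f \<in> iso G H" and s: "AE_sentence n k \<theta>" and A: "AE_holds G n k \<theta>"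
  shows "AE_holds H n k \<theta>"
  unfolding AE_holds_def
proof (intro allI impI)
  fix xs assume xs: "\<forall>v<n. xs v \<in> carrier H"
  have bij: "bij_betw f (carrier G) (carrier H)" and hom: "f \<in> hom G H" using f by (auto simp: iso_def)
  then have "\<forall>v. \<exists>x. v < n \<longrightarrow> x \<in> carrier G \<and> f x = xs v"
    using xs by (metis bij_betw_imp_surj_on imageE)
  then obtain xs' where xs': "\<And>v. v < n \<Longrightarrow> xs' v \<in> carrier G \<and> f (xs' v) = xs v" by metis
  then obtain ys where ys: "\<forall>l<k. ys l \<in> carrier G" "gqf_sat G (\<lambda>v. if v < n then xs' v else ys (v - n)) \<theta>"
    using A unfolding AE_holds_def by blast
  let ?\<rho> = "\<lambda>v. if v < n then xs' v else ys (v - n)"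
  interpret p: partial_hom G H "carrier G" f
    using hom G H by (intro partial_hom.intro) (auto simp: hom_def monoid.one_closed[OF group.is_monoid])
  have vars: "v < n + k" if "v \<in> gqf_vars \<theta>" for v using s that by (auto simp: AE_sentence_def)
  have "gqf_sat H (f \<circ> ?\<rho>) \<theta>"
  proof -
    have "gterm_eval G ?\<rho> b \<in> carrier G" if "b \<in> qts \<theta>" for b
      using qts_vars[OF that] vars xs' ys by (intro gterm_eval_closed[OF G]) fastforce
    then show ?thesis using p.gqf_transfer[of \<theta> ?\<rho>] ys bij by (auto simp: bij_betw_def)
  qed
  then have "gqf_sat H (\<lambda>v. if v < n then xs v else f (ys (v - n))) \<theta>"
    using xs' by (subst gqf_sat_cong[where \<rho>' = "f \<circ> ?\<rho>"]) auto
  moreover have "\<forall>l<k. f (ys l) \<in> carrier H" using ys hom by (auto simp: hom_def)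
  ultimately show "\<exists>ys. (\<forall>l<k. ys l \<in> carrier H) \<and> gqf_sat H (\<lambda>v. if v < n then xs v else ys (v - n)) \<theta>"
    by (intro exI[of _ "\<lambda>l. f (ys l)"]) simp
qed

lemma AE_equivalent_iso:
  assumes "group G" "group H" "f \<in> iso G H"
  shows "AE_equivalent G H"
  unfolding AE_equivalent_def
  using AE_holds_iso_imp[OF assms] AE_holds_iso_imp[OF assms(2,1) group.iso_set_sym[OF assms(1,3)]] by blast

lemma AE_equivalent_sym: "AE_equivalent G H \<Longrightarrow> AE_equivalent H G"
  by (auto simp: AE_equivalent_def)

lemma AE_equivalent_trans: "AE_equivalent G H \<Longrightarrow> AE_equivalent H K \<Longrightarrow> AE_equivalent G K"
  by (auto simp: AE_equivalent_def)

context merz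
begin

text \<open>From \<open>W\<close> to \<open>E\<close>: the parameters are pushed to \<open>W\<close>
  by putting a generic element for \<open>s\<close>, solved there, and the solution is pulled back
  by the partial homomorphism. From \<open>E\<close> to \<open>W\<close>: parameters in
  \<open>W\<close> are fixed by such a substitution, which carries a solution in \<open>E\<close> to
  \<open>W\<close> and is injective on the finitely many values involved.\<close>

theorem AE_equivalent_W_E:
  assumes fin: "finite A" "finite B"
  shows "AE_equivalent (gm W) (gm E)"
  unfolding AE_equivalent_def
proof (intro allI impI iffI)
  fix n k \<theta> assume s: "AE_sentence n k \<theta>" and A: "AE_holds (gm W) n k \<theta>"
  have vars: "v < n + k" if "v \<in> gqf_vars \<theta>" for v using s that by (auto simp: AE_sentence_def)
  have gW: "group (gm W)" and gE: "group (gm E)" by (simp_all add: group_gm subgroup_W subgroup_E)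
  show "AE_holds (gm E) n k \<theta>"
    unfolding AE_holds_def
  proof (intro allI impI)
    fix xs assume xs: "\<forall>v<n. xs v \<in> carrier (gm E)"
    let ?Y = "xs ` {..<n}"
    \<comment> \<open>Counts 0, the values of the subterms and the witnesses. It depends on the
      formula only and is available before the witnesses are.\<close>
    let ?N = "1 + card (qts \<theta>) + k"
    obtain m where m: "m \<in> W" "centralizes m (hh ` C)"
      and sol: "\<And>V. V \<subseteq> W \<Longrightarrow> finite V \<Longrightarrow> card V \<le> ?N \<Longrightarrow>
        (\<exists>\<sigma>. (\<forall>x\<in>V \<union> subst C t m ` ?Y. \<forall>y\<in>V \<union> subst C t m ` ?Y. x + y \<in> V \<union> subst C t m ` ?Y \<longrightarrow> \<sigma> (x + y) = \<sigma> x + \<sigma> y) \<and>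
        inj_on \<sigma> (V \<union> subst C t m ` ?Y) \<and> \<sigma> ` (V \<union> subst C t m ` ?Y) \<subseteq> E \<and>
        (\<forall>y\<in>?Y. \<sigma> (subst C t m y) = y))"
      using formal_solution[OF fin, of ?Y ?N] xs by fastforce
    let ?xs = "\<lambda>v. subst C t m (xs v)"
    have xsW: "?xs v \<in> W" if "v < n" for v
      using xs that by (intro subst_t_E[OF m(2) _ m(1) _ subgroup_W]) auto
    then obtain ys where ys: "\<forall>l<k. ys l \<in> W" "gqf_sat (gm W) (\<lambda>v. if v < n then ?xs v else ys (v - n)) \<theta>"
      using A unfolding AE_holds_def by fastforce
    let ?\<rho> = "\<lambda>v. if v < n then ?xs v else ys (v - n)"
    define V where "V = insert 0 (gterm_eval (gm W) ?\<rho> ` qts \<theta> \<union> ys ` {..<k})"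
    have VW: "V \<subseteq> W"
    proof -
      have "gterm_eval (gm W) ?\<rho> b \<in> carrier (gm W)" if "b \<in> qts \<theta>" for b
        using qts_vars[OF that] vars xsW ys by (intro gterm_eval_closed[OF gW]) fastforce
      then show ?thesis using ys subgroupD(1)[OF subgroup_W] by (auto simp: V_def)
    qed
    have "card V \<le> ?N"
    proof -
      have "card V \<le> Suc (card (gterm_eval (gm W) ?\<rho> ` qts \<theta> \<union> ys ` {..<k}))"
        unfolding V_def by (intro card_insert_le_m1) auto
      also have "card (gterm_eval (gm W) ?\<rho> ` qts \<theta> \<union> ys ` {..<k}) \<le> card (gterm_eval (gm W) ?\<rho> ` qts \<theta>) + card (ys ` {..<k})"
        by (rule card_Un_le)
      also have "card (gterm_eval (gm W) ?\<rho> ` qts \<theta>) \<le> card (qts \<theta>)" by (intro card_image_le) simp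
      also have "card (ys ` {..<k}) \<le> card {..<k}" by (intro card_image_le) simp
      finally show ?thesis by simp
    qed
    moreover have "finite V" by (simp add: V_def)
    moreover have eqY: "subst C t m ` ?Y = ?xs ` {..<n}" by (simp add: image_image)
    ultimately obtain \<sigma> where \<sigma>0: "\<forall>x\<in>V \<union> ?xs ` {..<n}. \<forall>y\<in>V \<union> ?xs ` {..<n}. x + y \<in> V \<union> ?xs ` {..<n} \<longrightarrow> \<sigma> (x + y) = \<sigma> x + \<sigma> y"
      "inj_on \<sigma> (V \<union> ?xs ` {..<n})" "\<sigma> ` (V \<union> ?xs ` {..<n}) \<subseteq> E" "\<forall>y\<in>?Y. \<sigma> (subst C t m y) = y"
      using sol[OF VW] unfolding eqY by blast
    then have \<sigma>: "\<And>x y. x \<in> V \<union> ?xs ` {..<n} \<Longrightarrow> y \<in> V \<union> ?xs ` {..<n} \<Longrightarrow> x + y \<in> V \<union> ?xs ` {..<n} \<Longrightarrow> \<sigma> (x + y) = \<sigma> x + \<sigma> y"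
      "inj_on \<sigma> (V \<union> ?xs ` {..<n})" "\<sigma> ` (V \<union> ?xs ` {..<n}) \<subseteq> E" "\<And>v. v < n \<Longrightarrow> \<sigma> (?xs v) = xs v"
      by blast+
    interpret p: partial_hom "gm W" "gm E" "V \<union> ?xs ` {..<n}" \<sigma>
      using VW xsW \<sigma> gW gE by (intro partial_hom.intro) (auto simp: V_def)
    have "gqf_sat (gm E) (\<sigma> \<circ> ?\<rho>) \<theta>"
      using p.gqf_transfer[OF \<sigma>(2), of \<theta> ?\<rho>] ys by (auto simp: V_def)
    then have "gqf_sat (gm E) (\<lambda>v. if v < n then xs v else \<sigma> (ys (v - n))) \<theta>"
      using \<sigma>(4) by (subst gqf_sat_cong[where \<rho>' = "\<sigma> \<circ> ?\<rho>"]) auto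
    moreover have "\<forall>l<k. \<sigma> (ys l) \<in> carrier (gm E)" using \<sigma>(3) by (auto simp: V_def)
    ultimately show "\<exists>ys. (\<forall>l<k. ys l \<in> carrier (gm E)) \<and> gqf_sat (gm E) (\<lambda>v. if v < n then xs v else ys (v - n)) \<theta>"
      by (intro exI[of _ "\<lambda>l. \<sigma> (ys l)"]) simp
  qed
next
  fix n k \<theta> assume s: "AE_sentence n k \<theta>" and A: "AE_holds (gm E) n k \<theta>"
  have vars: "v < n + k" if "v \<in> gqf_vars \<theta>" for v using s that by (auto simp: AE_sentence_def)
  have gW: "group (gm W)" and gE: "group (gm E)" by (simp_all add: group_gm subgroup_W subgroup_E)
  show "AE_holds (gm W) n k \<theta>"
    unfolding AE_holds_def
  proof (intro allI impI)
    fix xs assume xs: "\<forall>v<n. xs v \<in> carrier (gm W)"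
    then have xsE: "\<forall>v<n. xs v \<in> E" using W_sub_E by auto
    then obtain ys where ys: "\<forall>l<k. ys l \<in> E" "gqf_sat (gm E) (\<lambda>v. if v < n then xs v else ys (v - n)) \<theta>"
      using A unfolding AE_holds_def by fastforce
    let ?\<rho> = "\<lambda>v. if v < n then xs v else ys (v - n)"
    define V where "V = insert 0 (gterm_eval (gm E) ?\<rho> ` qts \<theta>)"
    have VE: "V \<subseteq> E"
    proof -
      have "gterm_eval (gm E) ?\<rho> b \<in> carrier (gm E)" if "b \<in> qts \<theta>" for b
        using qts_vars[OF that] vars xsE ys by (intro gterm_eval_closed[OF gE]) fastforce
      then show ?thesis using subgroupD(1)[OF subgroup_E] by (auto simp: V_def)
    qed
    have "finite V" by (simp add: V_def)
    \<comment> \<open>Here the values of the terms in \<open>E\<close> play the role of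
      \<open>Y\<close>, and the set of later elements is empty; the left inverse on \<open>Y\<close>
      gives injectivity.\<close>
    then obtain m where m: "m \<in> W" "centralizes m (hh ` C)"
      and "\<exists>\<sigma>. \<forall>y\<in>V. \<sigma> (subst C t m y) = y"
      using formal_solution[OF fin _ VE, of 0] by (metis card.empty empty_subsetI finite.emptyI order_refl)
    then have inj: "inj_on (subst C t m) V" by (metis inj_on_inverseI)
    let ?\<phi> = "subst C t m"
    interpret f: subst_hom C t m by unfold_locales (use sC centralizes_tt m in auto)
    have \<phi>W: "?\<phi> x \<in> W" if "x \<in> E" for x by (rule subst_t_E[OF m(2) that m(1) _ subgroup_W]) simp
    interpret p: partial_hom "gm E" "gm W" V ?\<phi>
      using VE \<phi>W gW gE subgroupD(1)[OF subgroup_W] by (intro partial_hom.intro) (auto simp: V_def f.add)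
    have "gqf_sat (gm W) (?\<phi> \<circ> ?\<rho>) \<theta>"
      using p.gqf_transfer[OF inj, of \<theta> ?\<rho>] ys by (auto simp: V_def)
    then have "gqf_sat (gm W) (\<lambda>v. if v < n then xs v else ?\<phi> (ys (v - n))) \<theta>"
      using xs subst_t_W[OF m(2)] by (subst gqf_sat_cong[where \<rho>' = "?\<phi> \<circ> ?\<rho>"]) auto
    moreover have "\<forall>l<k. ?\<phi> (ys l) \<in> carrier (gm W)" using \<phi>W ys by auto
    ultimately show "\<exists>ys. (\<forall>l<k. ys l \<in> carrier (gm W)) \<and> gqf_sat (gm W) (\<lambda>v. if v < n then xs v else ys (v - n)) \<theta>"
      by (intro exI[of _ "\<lambda>l. ?\<phi> (ys l)"]) simp
  qed
qed

end

section \<open>Independence of the extension from the twist\<close>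

lemma subst_indep:
  assumes C: "is_subgroup C" and a: "centralizes a (hh ` C)" and b: "centralizes b (hh ` C)" "centralizes b' (hh ` C)"
    and x: "x \<in> WW A B C"
  shows "subst C a b x = subst C a b' x"
proof -
  interpret f: subst_hom C a b by unfold_locales fact+
  interpret g: subst_hom C a b' by unfold_locales fact+
  show ?thesis
    by (rule hom_gen_eq[OF f.add g.add _ x[unfolded WW_def]]) (auto simp: f.tc g.tc)
qed

locale twist = V1: amalg A B C + V2: amalg A B' C
  for A B B' C :: "'h::group_add set" +
  fixes u :: 'h and m m' :: "'h gg"
  assumes uB: "\<And>b. b \<in> B' \<Longrightarrow> - u + b + u \<in> B"
    and uB': "\<And>b. b \<in> B \<Longrightarrow> u + b + - u \<in> B'"
    and uC: "normalizes u C"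
    and m: "m \<in> WW A B C" "\<And>c. c \<in> C \<Longrightarrow> m + hh c = hh (u + c + - u) + m"
    and m': "m' \<in> WW A B' C" "\<And>c. c \<in> C \<Longrightarrow> m' + hh c = hh (- u + c + u) + m'"
begin

text \<open>Moving \<open>B'\<close> onto \<open>B\<close> calls for \<open>tt C + - hh u\<close>,
  which acts on \<open>C\<close> by the inverse of \<open>u\<close>. The element \<open>m\<close>,
  acting on \<open>C\<close> as \<open>u\<close>, repairs this, and the leading \<open>ss C\<close>
  makes the change of generators reversible.\<close>

definition psi_t :: "'h gg" where "psi_t = ss C + m + tt C + - hh u"

lemma psi_t: "centralizes psi_t (hh ` C)"
  unfolding centralizes_def
proof (intro ballI, clarify)
  fix c assume c: "c \<in> C"
  define d where "d = - u + c + u"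
  have d: "d \<in> C" using uC c by (simp add: d_def normalizes_def)
  have cd: "c = u + d + - u" by (simp only: d_def grps)
  have e1: "- hh u + hh c = hh d + - hh u" by (simp only: d_def hh_add hh_uminus grps)
  have e2: "tt C + hh d = hh d + tt C" using centralizes_tt[OF V1.sC] d by (auto simp: centralizes_def)
  have e3: "m + hh d = hh c + m" using m(2)[OF d] by (simp only: cd)
  have e4: "ss C + hh c = hh c + ss C" using centralizes_ss[OF V1.sC] c by (auto simp: centralizes_def)
  have "psi_t + hh c = ss C + m + tt C + (- hh u + hh c)" by (simp only: psi_t_def add.assoc)
  also have "\<dots> = ss C + m + (tt C + hh d) + - hh u" by (simp only: e1 add.assoc)
  also have "\<dots> = ss C + (m + hh d) + tt C + - hh u" by (simp only: e2 add.assoc)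
  also have "\<dots> = (ss C + hh c) + m + tt C + - hh u" by (simp only: e3 add.assoc)
  also have "\<dots> = hh c + psi_t" by (simp only: e4 psi_t_def add.assoc)
  finally show "hh c + psi_t = psi_t + hh c" by simp
qed

text \<open>The image of \<open>m'\<close> under the map to be defined. As \<open>m'\<close> lies in
  the amalgam, the value for \<open>s\<close> does not enter, and putting 0 for it avoids a circular
  definition with \<open>psi_s\<close>.\<close>

definition psi_m :: "'h gg" where "psi_m = subst C psi_t 0 m'"

lemma psi_m: 
  assumes c: "c \<in> C"
  shows "psi_m + hh c = hh (- u + c + u) + psi_m"
proof -
  interpret subst_hom C psi_t 0 by unfold_locales (simp_all add: V1.sC psi_t)
  have "subst C psi_t 0 (m' + hh c) = subst C psi_t 0 (hh (- u + c + u) + m')"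
    by (simp only: m'(2)[OF c])
  then show ?thesis by (simp only: add hh psi_m_def)
qed

text \<open>Chosen such that \<open>ss C + m'\<close> goes to the negative of
  \<open>ss C + m\<close>. The mirrored map does the same with \<open>m\<close> and
  \<open>m'\<close> exchanged, and the two prefixes cancel in the composition.\<close>

definition psi_s :: "'h gg" where "psi_s = - m + - ss C + - psi_m"

lemma psi_s: "centralizes psi_s (hh ` C)"
  unfolding centralizes_def
proof (intro ballI, clarify)
  fix c assume c: "c \<in> C"
  define d where "d = u + c + - u"
  have d: "d \<in> C" using uC c by (simp add: d_def normalizes_def)
  have cd: "c = - u + d + u" by (simp only: d_def grps)
  have "psi_m + hh d = hh c + psi_m" using psi_m[OF d] by (simp only: cd)
  then have "- psi_m + (psi_m + hh d) + - psi_m = - psi_m + (hh c + psi_m) + - psi_m" by simp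
  then have e1: "- psi_m + hh c = hh d + - psi_m" by (simp only: grps)
  have e2: "- ss C + hh d = hh d + - ss C"
    using centralizes_uminus[OF centralizes_ss[OF V1.sC]] d by (auto simp: centralizes_def simp del: add_uminus_conv_diff)
  have "m + hh c = hh d + m" using m(2)[OF c] by (simp only: d_def)
  then have "- m + (m + hh c) + - m = - m + (hh d + m) + - m" by simp
  then have e3: "- m + hh d = hh c + - m" by (simp only: grps)
  have "psi_s + hh c = - m + - ss C + (- psi_m + hh c)" by (simp only: psi_s_def add.assoc)
  also have "\<dots> = - m + (- ss C + hh d) + - psi_m" by (simp only: e1 add.assoc)
  also have "\<dots> = (- m + hh d) + - ss C + - psi_m" by (simp only: e2 add.assoc)
  also have "\<dots> = hh c + psi_s" by (simp only: e3 psi_s_def add.assoc)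
  finally show "hh c + psi_s = psi_s + hh c" by simp
qed

definition psi :: "'h gg \<Rightarrow> 'h gg" where "psi = subst C psi_t psi_s"

sublocale psi: subst_hom C psi_t psi_s
  by unfold_locales (simp_all add: V1.sC psi_t psi_s)

lemma psi_add: "psi (x + y) = psi x + psi y"
  unfolding psi_def by (rule psi.add)

lemma psi_m': "psi m' = psi_m"
  unfolding psi_def psi_m_def by (rule subst_indep[OF V1.sC psi_t psi_s _ m'(1)]) simp

lemma psi_tc: "psi (tc C b) = ss C + m + tc C (- u + b + u) + - m + - ss C"
  unfolding psi_def psi.tc
  by (simp only: psi_t_def tc_def hh_add hh_uminus grps)

lemma psi_tc_E: "b \<in> B' \<Longrightarrow> psi (tc C b) \<in> EE A B C"
proof -
  assume "b \<in> B'"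
  then have "tc C (- u + b + u) \<in> EE A B C" "m \<in> EE A B C"
    using V1.tcB_W uB V1.W_sub_E m by auto
  then show ?thesis unfolding psi_tc using V1.s_E by (intro subgroupD[OF V1.subgroup_E])
qed

lemma psi_E:
  assumes "x \<in> EE A B' C"
  shows "psi x \<in> EE A B C"
proof -
  have W: "psi x \<in> EE A B C" if "x \<in> WW A B' C" for x
    using that unfolding WW_def
    by (rule hom_gen[OF psi_add _ V1.subgroup_E, rotated])
      (use psi_tc_E V1.hhA_W V1.W_sub_E in \<open>auto simp: psi_def\<close>)
  have "psi_s \<in> EE A B C"
    unfolding psi_s_def psi_m'[symmetric]
    using W[OF m'(1)] V1.s_E m V1.W_sub_E by (intro subgroupD[OF V1.subgroup_E]) auto
  then have s: "psi (ss C) \<in> EE A B C" by (simp add: psi_def)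
  show ?thesis
    using assms unfolding EE_def[of A B']
    by (rule hom_gen[OF psi_add _ V1.subgroup_E, rotated])
      (use s W V2.hhA_W V2.tcB_W in auto)
qed

lemma twist_sym: "twist A B' B C (- u) m' m"
  by unfold_locales (use uB uB' uC m m' normalizes_uminus in \<open>auto simp del: add_uminus_conv_diff\<close>)

end

lemma (in twist) twist_inverse:
  assumes "x \<in> EE A B' C"
  shows "twist.psi C (- u) m' m (psi x) = x"
proof -
  interpret T: twist A B' B C "- u" m' m by (rule twist_sym)
  have t: "T.psi (psi (tt C)) = tt C"
  proof -
    have "T.psi (psi (tt C)) = T.psi psi_t" by (simp add: psi_def)
    also have "\<dots> = T.psi (ss C) + T.psi m + T.psi (tt C) + T.psi (- hh u)"
      by (simp only: psi_t_def T.psi_add)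
    also have "T.psi m = T.psi_m" by (rule T.psi_m')
    also have "T.psi (ss C) = T.psi_s" by (simp add: T.psi_def)
    also have "T.psi (tt C) = T.psi_t" by (simp add: T.psi_def)
    also have "T.psi (- hh u) = - hh u" by (simp add: T.psi_def)
    finally show ?thesis by (simp only: T.psi_s_def T.psi_t_def hh_uminus grps)
  qed
  have hhx: "T.psi (psi (hh h)) = hh h" for h by (simp add: psi_def T.psi_def)
  have hom: "T.psi (psi (x + y)) = T.psi (psi x) + T.psi (psi y)" for x y
    by (simp only: psi_add T.psi_add)
  have neg: "T.psi (psi (- x)) = - T.psi (psi x)" for x
    using hom_uminus[of "\<lambda>x. T.psi (psi x)"] hom by blast
  have tcx: "T.psi (psi (tc C b)) = tc C b" for b
    by (simp only: tc_def hom neg t hhx)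
  have W: "T.psi (psi x) = x" if "x \<in> WW A B' C" for x
    by (rule hom_gen_eq[where f = "\<lambda>x. T.psi (psi x)" and g = "\<lambda>x. x", OF hom _ _ that[unfolded WW_def]])
      (use hhx tcx in auto)
  have s: "T.psi (psi (ss C)) = ss C"
  proof -
    have "T.psi (psi (ss C)) = T.psi psi_s" by (simp add: psi_def)
    also have "\<dots> = T.psi (- m) + T.psi (- ss C) + T.psi (- psi_m)"
      by (simp only: psi_s_def T.psi_add)
    also have "\<dots> = - T.psi m + - T.psi (ss C) + - T.psi psi_m"
      using hom_uminus[of T.psi] T.psi_add by metis
    also have "T.psi psi_m = m'" using W[OF m'(1)] by (simp only: psi_m')
    also have "T.psi m = T.psi_m" by (rule T.psi_m')
    also have "T.psi (ss C) = T.psi_s" by (simp add: T.psi_def)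
    finally show ?thesis by (simp only: T.psi_s_def grps)
  qed
  show ?thesis
    by (rule hom_gen_eq[where f = "\<lambda>x. T.psi (psi x)" and g = "\<lambda>x. x", OF hom _ _ assms[unfolded EE_def]])
      (use hhx tcx s in auto)
qed

lemma (in twist) psi_iso: "psi \<in> iso (gm (EE A B' C)) (gm (EE A B C))"
proof -
  interpret T: twist A B' B C "- u" m' m by (rule twist_sym)
  have "bij_betw psi (EE A B' C) (EE A B C)"
    by (rule bij_betw_byWitness[where f' = T.psi])
      (use twist_inverse T.twist_inverse psi_E T.psi_E in auto)
  then show ?thesis using psi_E by (auto simp: iso_def hom_def psi_add)
qed

subsection \<open>Normal forms\<close>

text \<open>Alternating products that start with a factor from \<open>Q\<close> outside
  \<open>S\<close>. Only the last factor from \<open>P\<close> may lie in \<open>S\<close>, which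
  includes the products that end in \<open>Q\<close>.\<close>

inductive_set tails :: "'g::group_add set \<Rightarrow> 'g set \<Rightarrow> 'g set \<Rightarrow> 'g set" for P Q S where
  tails_base: "k \<in> Q \<Longrightarrow> k \<notin> S \<Longrightarrow> a \<in> P \<Longrightarrow> k + a \<in> tails P Q S"
| tails_step: "k \<in> Q \<Longrightarrow> k \<notin> S \<Longrightarrow> a \<in> P \<Longrightarrow> a \<notin> S \<Longrightarrow> x \<in> tails P Q S \<Longrightarrow> k + a + x \<in> tails P Q S"

text \<open>The set of normal forms contains 0 and is closed under adding an element of
  \<open>P\<close> or \<open>Q\<close> on the left: if the leading element of \<open>P\<close> lies
  in \<open>S\<close>, the neighbouring factors from \<open>Q\<close> merge, and if their sum lies
  in \<open>S\<close> too, it is passed on to \<open>P\<close>.\<close>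

theorem normal_form:
  assumes P: "is_subgroup P" and Q: "is_subgroup Q" and S: "is_subgroup S" "S \<subseteq> P" "S \<subseteq> Q"
    and y: "y \<in> gen (P \<union> Q)"
  shows "y \<in> P \<or> (\<exists>a\<in>P. \<exists>x\<in>tails P Q S. y = a + x)"
proof -
  define NF where "NF = P \<union> {a + x |a x. a \<in> P \<and> x \<in> tails P Q S}"
  have addP: "k + y \<in> NF" if k: "k \<in> P" and y: "y \<in> NF" for k y
    using y unfolding NF_def
  proof (elim UnE CollectE exE conjE)
    fix a x assume "y = a + x" "a \<in> P" "x \<in> tails P Q S"
    moreover from this have "k + y = (k + a) + x" "k + a \<in> P"
      using subgroupD(2)[OF P] k by (auto simp: add.assoc)
    ultimately show "k + y \<in> P \<union> {a + x |a x. a \<in> P \<and> x \<in> tails P Q S}" by blast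
  qed (use subgroupD(2)[OF P] k in auto)
  have tNF: "x \<in> NF" if "x \<in> tails P Q S" for x
    using that subgroupD(1)[OF P] add_0[of x] unfolding NF_def by (metis (mono_tags, lifting) CollectI UnI2)
  have addQ: "k + y \<in> NF" if k: "k \<in> Q" and y: "y \<in> NF" for k y
  proof (cases "k \<in> S")
    case True
    then show ?thesis using addP y S by blast
  next
    case kS: False
    from y show ?thesis unfolding NF_def
    proof (elim UnE CollectE exE conjE)
      assume "y \<in> P"
      then show "k + y \<in> P \<union> {a + x |a x. a \<in> P \<and> x \<in> tails P Q S}"
        using tNF[OF tails_base[OF k kS]] by (simp add: NF_def)
    next
      fix a x assume y: "y = a + x" "a \<in> P" "x \<in> tails P Q S"
      have "k + y \<in> NF"
      proof (cases "a \<in> S")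
        case False
        then show ?thesis using tNF[OF tails_step[OF k kS y(2) False y(3)]] y by (simp add: add.assoc)
      next
        case True
        have ka: "k + a \<in> Q" using subgroupD(2)[OF Q k] True S by blast
        have tail_NF: "k + a + k1 + a1 \<in> NF" if "k1 \<in> Q" "k1 \<notin> S" "a1 \<in> P" for k1 a1
        proof (cases "k + a + k1 \<in> S")
          case True
          then have "k + a + k1 + a1 \<in> P" using S that subgroupD(2)[OF P] by blast
          then show ?thesis by (simp add: NF_def)
        next
          case False
          then show ?thesis using tNF tails_base subgroupD(2)[OF Q ka that(1)] that by blast
        qed
        from y(3) show ?thesis
        proof cases
          case (tails_base k1 a1)
          then show ?thesis using tail_NF[of k1 a1] y by (simp add: add.assoc)
        next
          case (tails_step k1 a1 x1)
          show ?thesis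
          proof (cases "k + a + k1 \<in> S")
            case True
            then have "k + a + k1 + a1 \<in> P" using S tails_step subgroupD(2)[OF P] by blast
            then have "(k + a + k1 + a1) + x1 \<in> NF" using tails_step unfolding NF_def by blast
            then show ?thesis using y tails_step by (simp add: add.assoc)
          next
            case False
            have "(k + a + k1) + a1 + x1 \<in> tails P Q S"
              by (rule tails.tails_step) (use False tails_step subgroupD(2)[OF Q ka] in auto)
            then show ?thesis using tNF y tails_step by (simp add: add.assoc)
          qed
        qed
      qed
      then show "k + y \<in> P \<union> {a + x |a x. a \<in> P \<and> x \<in> tails P Q S}" by (simp add: NF_def)
    qed
  qed
  have "y \<in> NF"
    using y
  proof (induction rule: gen.induct)
    case gen_0
    then show ?case using subgroupD(1)[OF P] by (simp add: NF_def)
  qed (use addP addQ subgroupD(3)[OF P] subgroupD(3)[OF Q] in blast)+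
  then show ?thesis unfolding NF_def by blast
qed

lemma hh_image_iff [simp]: "hh x \<in> hh ` U \<longleftrightarrow> x \<in> U"
  by auto

context amalg
begin

abbreviation "T \<equiv> tails (hh ` A) (tc C ` B) (hh ` C)"

lemma tc_add: "tc C b + tc C b' = tc C (b + b')"
  by (simp only: tc_def hh_add grps)

lemma tc_uminus: "- tc C b = tc C (- b)"
  by (simp only: tc_def hh_uminus grps)

lemma tc_C:
  assumes "c \<in> C"
  shows "tc C c = hh c"
proof -
  have "tt C + hh c = hh c + tt C" using centralizes_tt[OF sC] assms by (auto simp: centralizes_def)
  then show ?thesis by (simp only: tc_def grps)
qed

lemma subgroup_hh: "is_subgroup U \<Longrightarrow> is_subgroup (hh ` U)"
  by (auto simp: is_subgroup_def hh_add[symmetric] hh_uminus[symmetric]) (metis hh_0 imageI)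

lemma tc_0 [simp]: "tc C 0 = 0"
  by (simp add: tc_def)

lemma subgroup_tc: "is_subgroup U \<Longrightarrow> is_subgroup (tc C ` U)"
  by (auto simp: is_subgroup_def tc_add tc_uminus) (metis tc_0 imageI)

lemma hp_tc [simp]: "hp (tc C b) = b"
  by (simp add: tc_def tt_def)

lemma tc_inj [simp]: "tc C b = tc C b' \<longleftrightarrow> b = b'"
  by (metis hp_tc)

lemma wd_tc:
  assumes "b \<notin> C"
  shows "wd (tc C b) = [((False, C), True), ((False, (+) b ` C), False)]"
proof -
  have "(+) b ` C \<noteq> C" using coset_eqD[OF sC, of 0 b] assms by auto
  then show ?thesis
    by (simp add: tc_def wd_plus wd_uminus tt_def linv_def lact_def xact_def del: add_uminus_conv_diff)
qed

lemma tc_hh_C: "b \<in> B \<Longrightarrow> tc C b \<in> hh ` C \<longleftrightarrow> b \<in> C"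
  using wd_tc tc_C by (auto simp: image_iff) (metis wd_hh list.distinct(1))

lemma coset_neq: "a \<notin> C \<Longrightarrow> (+) (b + a) ` C \<noteq> (+) b ` C"
proof
  assume "a \<notin> C" "(+) (b + a) ` C = (+) b ` C"
  from coset_eqD[OF sC this(2)[symmetric]] have "a \<in> C" by (simp only: grps)
  then show False using \<open>a \<notin> C\<close> by simp
qed

text \<open>The last letter of \<open>tc C b\<close> carries the coset of \<open>b\<close> and the
  next one that of \<open>b + a\<close>. They differ because \<open>a\<close> is outside
  \<open>C\<close>, so nothing cancels.\<close>

lemma wd_step:
  assumes b: "b \<notin> C" and a: "a \<notin> C" and y: "wd y = ((False, C), True) # v"
  shows "wd (tc C b + hh a + y) = wd (tc C b) @ map (lact (b + a)) (wd y)"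
proof -
  have "wd (tc C b + hh a + y) = lapp (wd (tc C b)) (map (lact (b + a)) (wd y))"
    by (simp add: wd_plus)
  also have "\<dots> = wd (tc C b) @ map (lact (b + a)) (wd y)"
  proof (rule lapp_id)
    have "reduced (map (lact (b + a)) (wd y))" by simp
    then show "reduced (wd (tc C b) @ map (lact (b + a)) (wd y))"
      using coset_neq[OF a, of b] coset_neq[OF b, of 0] sC
      by (auto simp: wd_tc[OF b] y lact_def xact_def linv_def)
  qed
  finally show ?thesis .
qed

lemma T_word: "x \<in> T \<Longrightarrow> \<exists>v. wd x = ((False, C), True) # v"
proof (induction rule: tails.induct)
  case (tails_base k a)
  then show ?case using tc_hh_C by (auto simp: wd_tc)
next
  case (tails_step k a x)
  then obtain b a' v where "k = tc C b" "b \<notin> C" "a = hh a'" "a' \<notin> C" "wd x = ((False, C), True) # v"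
    using tc_hh_C by auto
  then show ?case by (simp add: wd_step wd_tc)
qed

lemma W_gen: "W = gen (hh ` A \<union> tc C ` B)"
  by (simp add: WW_def)

lemma W_cases:
  assumes "x \<in> W"
  obtains a where "a \<in> A" "x = hh a" | a y where "a \<in> A" "y \<in> T" "x = hh a + y"
proof -
  have "hh ` C \<subseteq> tc C ` B" using tc_C CB by (metis (no_types, lifting) image_subset_iff rev_image_eqI subsetD)
  then have "x \<in> hh ` A \<or> (\<exists>a\<in>hh ` A. \<exists>y\<in>T. x = a + y)"
    using assms CA sA sB sC unfolding W_gen
    by (intro normal_form subgroup_hh subgroup_tc) auto
  then show ?thesis using that by blast
qed

lemma wd_hh_T: "y \<in> T \<Longrightarrow> \<exists>v. wd (hh a + y) = ((False, (+) a ` C), True) # v"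
  using T_word by (fastforce simp: wd_plus lact_def xact_def)

lemma hh_W_D: "hh h \<in> W \<Longrightarrow> h \<in> A"
proof (erule W_cases)
  fix a y assume "y \<in> T" "hh h = hh a + y"
  then show "h \<in> A" using wd_hh_T[of y a] by (metis list.distinct(1) wd_hh)
qed simp

lemma T_prefix:
  "x \<in> T \<Longrightarrow> i \<le> length (wd x) \<Longrightarrow> \<exists>g\<in>W. take i (wd x) = wd g \<or> take i (wd x) = wd (g + t)"
proof (induction arbitrary: i rule: tails.induct)
  case (tails_base k a)
  then obtain b a' where k: "k = tc C b" "b \<notin> C" "a = hh a'" "b \<in> B" "a' \<in> A" using tc_hh_C by auto
  consider "i = 0" | "i = 1" | "i \<ge> 2" by linarith
  then show ?case
  proof cases
    case 1
    then show ?thesis using subgroupD(1)[OF subgroup_W] by (intro bexI[of _ 0]) simp_all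
  next
    case 2
    then show ?thesis using subgroupD(1)[OF subgroup_W] by (intro bexI[of _ 0]) (simp_all add: k wd_tc tt_def)
  next
    case 3
    then show ?thesis using k tcB_W by (intro bexI[of _ "tc C b"]) (simp_all add: wd_tc)
  qed
next
  case (tails_step k a x)
  then obtain b a' where k: "k = tc C b" "b \<notin> C" "a = hh a'" "b \<in> B" "a' \<in> A" "a' \<notin> C" using tc_hh_C by auto
  obtain v where v: "wd x = ((False, C), True) # v" using T_word tails_step by blast
  have w: "wd (k + a + x) = wd (tc C b) @ map (lact (b + a')) (wd x)"
    using wd_step[OF k(2,6) v] k by simp
  consider "i = 0" | "i = 1" | "i \<ge> 2" by linarith
  then show ?case
  proof cases
    case 1
    then show ?thesis using subgroupD(1)[OF subgroup_W] by (intro bexI[of _ 0]) simp_all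
  next
    case 2
    then show ?thesis using subgroupD(1)[OF subgroup_W] unfolding w by (intro bexI[of _ 0]) (simp_all add: k wd_tc tt_def)
  next
    case 3
    define i' where "i' = i - 2"
    have i: "i = i' + 2" using 3 by (simp add: i'_def)
    have "i' \<le> length (wd x)" using tails_step.prems unfolding w by (simp add: i wd_tc[OF k(2)])
    from tails_step.IH[OF this] obtain g where g: "g \<in> W" "take i' (wd x) = wd g \<or> take i' (wd x) = wd (g + t)" by blast
    let ?g = "tc C b + hh a' + g"
    have "?g \<in> W" using g k by (intro subgroupD(2)[OF subgroup_W] tcB_W hhA_W)
    have ti: "take i (wd (k + a + x)) = wd (tc C b) @ map (lact (b + a')) (take i' (wd x))"
      unfolding w using k by (simp add: i wd_tc take_map)
    then have red: "reduced (wd (tc C b) @ map (lact (b + a')) (take i' (wd x)))"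
      by (metis reduced_take reduced_wd)
    have gen: "wd (tc C b + hh a' + y) = take i (wd (k + a + x))" if "take i' (wd x) = wd y" for y
      using lapp_id[OF red] that ti by (simp add: wd_plus)
    show ?thesis
      using g(2) gen[of g] gen[of "g + t"] \<open>?g \<in> W\<close> by (metis add.assoc)
  qed
qed

text \<open>The root paths of \<open>W\<close> pass only through translates of the root and of the
  vertex of \<open>t\<close>. This subtree is the Bass-Serre tree of the amalgam, so a fixed vertex
  found on such a path has a conjugate of \<open>A\<close> or of the second factor as its
  stabilizer.\<close>

lemma W_prefix:
  assumes "x \<in> W"
  shows "\<exists>g\<in>W. take i (wd x) = wd g \<or> take i (wd x) = wd (g + t)"
  using assms
proof (cases rule: W_cases)
  case (1 a)
  then show ?thesis using subgroupD(1)[OF subgroup_W] by (intro bexI[of _ 0]) simp_all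
next
  case (2 a y)
  have "take i (wd y) = take (min i (length (wd y))) (wd y)" by (simp add: min_def)
  then obtain g where g: "g \<in> W" "take i (wd y) = wd g \<or> take i (wd y) = wd (g + t)"
    using T_prefix[OF 2(2), of "min i (length (wd y))"] by auto
  have "wd (hh a + z) = map (lact a) (wd z)" for z by (simp add: wd_plus)
  moreover have "hh a + g \<in> W" using g 2 by (intro subgroupD(2)[OF subgroup_W] hhA_W)
  ultimately show ?thesis using g(2) unfolding 2(3)
    by (intro bexI[of _ "hh a + g"]) (auto simp: take_map add.assoc)
qed

text \<open>Together with \<open>hh_W_D\<close> this identifies the stabilizers in \<open>W\<close>
  of the two base vertices. The word of \<open>tc C h\<close> has length 2, so its normal form can
  have only one syllable from the second factor.\<close>

lemma tc_W_D:
  assumes "tc C h \<in> W"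
  shows "h \<in> B"
proof (cases "h \<in> C")
  case True
  then show ?thesis using CB by blast
next
  case False
  note w = wd_tc[OF False]
  from assms show ?thesis
  proof (cases rule: W_cases)
    case (1 a)
    then show ?thesis using w by (metis list.distinct(1) wd_hh)
  next
    case (2 a y)
    from 2(2) show ?thesis
    proof cases
      case (tails_base k a')
      then obtain b a'' where b: "k = tc C b" "b \<notin> C" "b \<in> B" "a' = hh a''" using tc_hh_C by auto
      have e: "tc C h = hh a + tc C b + hh a''" using 2 tails_base b by (simp add: add.assoc)
      have "hp (tc C h) = hp (hh a + tc C b + hh a'')" by (simp only: e)
      then have h: "h = a + b + a''" by simp
      have "wd (tc C h) = map (lact a) (wd (tc C b))" unfolding e by (simp add: wd_plus)
      then have c: "(+) a ` C = C" "(+) (a + b) ` C = (+) h ` C"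
        unfolding w wd_tc[OF b(2)] by (simp_all add: lact_def xact_def image_image add.assoc)
      from c(1) have "a \<in> C" using coset_eqD[OF sC, of 0 a] by simp
      moreover have "a'' \<in> C" using coset_eqD[OF sC c(2)] unfolding h by (simp only: grps)
      ultimately show ?thesis unfolding h using b CB subgroupD(2)[OF sB] by blast
    next
      case (tails_step k a' x)
      then obtain b a'' v where b: "k = tc C b" "b \<notin> C" "a' = hh a''" "a'' \<notin> C" "wd x = ((False, C), True) # v"
        using tc_hh_C T_word by (metis (no_types, lifting) image_iff)
      have "length (wd (tc C h)) = length (wd y)" unfolding 2(3) by (simp add: wd_plus)
      also have "\<dots> \<ge> 3" using wd_step[OF b(2,4,5)] tails_step b by (simp add: wd_tc)
      finally show ?thesis using w by simp
    qed
  qed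
qed

lemma wd_tt [simp]: "wd t = [((False, C), True)]" and wd_minus_tt: "wd (- t) = [((False, C), False)]"
  by (simp_all add: tt_def wd_uminus linv_def)

lemma hp_tt [simp]: "hp t = 0"
  by (simp add: tt_def)

text \<open>Adding \<open>t\<close> may cancel the last letter of the word of \<open>g\<close>, but
  never the first one, since that letter is positive like the one added.\<close>

lemma wd_W_t:
  assumes "g \<in> W"
  shows "\<exists>a\<in>A. \<exists>v. wd (g + t) = ((False, (+) a ` C), True) # v"
  using assms
proof (cases rule: W_cases)
  case (1 a)
  then show ?thesis by (intro bexI[of _ a]) (simp_all add: wd_plus lact_def xact_def)
next
  case (2 a y)
  obtain v where v: "wd g = ((False, (+) a ` C), True) # v" using wd_hh_T 2 by blast
  have "wd (g + t) = cons_red ((False, (+) a ` C), True) (lapp v [lact (hp g) ((False, C), True)])"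
    by (simp add: wd_plus v)
  moreover have "reduced (((False, (+) a ` C), True) # v)" using v by (metis reduced_wd)
  ultimately have "\<exists>v. wd (g + t) = ((False, (+) a ` C), True) # v"
  proof -
    have "\<exists>v'. cons_red ((False, (+) a ` C), True) (lapp v [l]) = ((False, (+) a ` C), True) # v'"
      if l: "snd l" and red: "reduced (((False, (+) a ` C), True) # v)" for l
    proof (cases v rule: rev_cases)
      case Nil
      then show ?thesis using l by (auto simp: linv_def)
    next
      case (snoc v0 l0)
      show ?thesis
      proof (cases "l = linv l0")
        case True
        have r: "reduced (((False, (+) a ` C), True) # v0 @ [l0])" using red snoc by simp
        then have r': "reduced (v0 @ [l0])" "reduced (((False, (+) a ` C), True) # v0)"
          using reduced_appendD[of "_ # v0" "[l0]"] by (auto simp: reduced_Cons)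
        have "lapp v [l] = v0"
          using r' reduced_appendD[of v0] by (simp add: snoc lapp_append True)
        then show ?thesis using cons_red_id[OF r'(2)] by blast
      next
        case False
        then have "reduced ((((False, (+) a ` C), True) # v) @ [l])"
          using red snoc by (subst reduced_snoc) (auto simp: linv_eq_iff)
        then have "lapp (((False, (+) a ` C), True) # v) [l] = ((False, (+) a ` C), True) # v @ [l]"
          by (simp only: lapp_id) simp
        then show ?thesis by simp
      qed
    qed
    then show ?thesis using \<open>wd (g + t) = _\<close> \<open>reduced _\<close> by simp
  qed
  then show ?thesis using 2 by blast
qed

lemma wd_t_W:
  assumes "g \<in> W"
  shows "\<exists>b\<in>B. \<exists>v. wd (- t + g) = ((False, (+) b ` C), False) # v"
  using assms
proof (cases rule: W_cases)
  case (1 a)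
  then show ?thesis using subgroupD(1)[OF sB] by (intro bexI[of _ 0]) (simp_all add: wd_plus wd_minus_tt)
next
  case (2 a y)
  obtain v where v: "wd g = ((False, (+) a ` C), True) # v" using wd_hh_T 2 by blast
  have w: "wd (- t + g) = cons_red ((False, C), False) (wd g)" by (simp add: wd_plus wd_minus_tt)
  show ?thesis
  proof (cases "a \<in> C")
    case False
    then have "(+) a ` C \<noteq> C" using coset_neq[OF False, of 0] by simp
    then show ?thesis using w v subgroupD(1)[OF sB] by (intro bexI[of _ 0]) (auto simp: linv_def)
  next
    case True
    then have "(+) a ` C = C" by (rule coset_self[OF sC])
    then have w: "wd (- t + g) = v" using w v by (simp add: linv_def)
    have "wd g = map (lact a) (wd y)" unfolding 2(3) by (simp add: wd_plus)
    moreover have "\<exists>b\<in>B. \<exists>v l. wd y = l # ((False, (+) b ` C), False) # v"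
      using 2(2)
    proof cases
      case (tails_base k a')
      then obtain b a'' where b: "k = tc C b" "b \<notin> C" "b \<in> B" "a' = hh a''" using tc_hh_C by auto
      then show ?thesis using tails_base by (auto simp: wd_tc)
    next
      case (tails_step k a' x)
      then obtain b a'' v where b: "k = tc C b" "b \<in> B" "b \<notin> C" "a' = hh a''" "a'' \<notin> C" "wd x = ((False, C), True) # v"
        using tc_hh_C T_word by (metis (no_types, lifting) image_iff)
      then show ?thesis using wd_step[OF b(3,5,6)] tails_step by (auto simp: wd_tc)
    qed
    ultimately obtain b v' l where "b \<in> B" "wd g = lact a l # lact a ((False, (+) b ` C), False) # map (lact a) v'" by auto
    then have "v = ((False, (+) (a + b) ` C), False) # map (lact a) v'"
      using v by (simp add: lact_def xact_def image_image add.assoc)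
    moreover have "a + b \<in> B" using True \<open>b \<in> B\<close> CB subgroupD(2)[OF sB] by blast
    ultimately show ?thesis using w by blast
  qed
qed

end

subsection \<open>Finite subgroups fix a vertex\<close>

lemma wd_uminus_plus: "wd (- v + u) = map (lact (- hp v)) (lapp (winv (wd v)) (wd u))" for u v :: "'h::group_add gg"
  by (simp add: wd_plus wd_uminus map_lapp map_winv)

lemma wd_eqD:
  assumes "wd x = wd (y :: 'h::group_add gg)"
  shows "\<exists>k. y = x + hh k"
proof -
  have "wd (- x + y) = []"
    using assms lapp_winv_left[of "[]" "wd x"] by (simp add: wd_uminus_plus)
  then obtain k where "- x + y = hh k" by (auto simp: wd_Nil_iff)
  then have "x + (- x + y) = x + hh k" by simp
  then show ?thesis by (simp only: grps) blast
qed

text \<open>Take a longest word in \<open>U\<close>. All nonempty words start with its first letter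
  \<open>l\<close>, for otherwise a difference would be longer. Applied to negatives, this shows
  that they also end with the inverse of a translate of \<open>l\<close>, so conjugation by
  \<open>l\<close> shortens them by 2. That the fixed vertex is on a root path of \<open>U\<close>
  keeps it in the subtree of \<open>W_prefix\<close>.\<close>

lemma finite_subgroup_fixes_prefix:
  fixes U :: "'h::group_add gg set"
  assumes "finite U" "is_subgroup U" "\<And>u. u \<in> U \<Longrightarrow> length (wd u) \<le> N"
  shows "\<exists>u\<in>U. \<exists>i. \<forall>v\<in>U. vact v (take i (wd u)) = take i (wd u)"
  using assms
proof (induction N arbitrary: U rule: less_induct)
  case (less N)
  show ?case
  proof (cases "\<forall>u\<in>U. wd u = []")
    case True
    then show ?thesis using subgroupD(1)[OF less.prems(2)] by (intro bexI[of _ 0] exI[of _ 0]) auto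
  next
    case False
    define L where "L = Max ((\<lambda>u. length (wd u)) ` U)"
    have ne: "U \<noteq> {}" using subgroupD(1)[OF less.prems(2)] by auto
    have Lmax: "length (wd u) \<le> L" if "u \<in> U" for u
      unfolding L_def using less.prems(1) that by (intro Max_ge) auto
    have "L \<in> (\<lambda>u. length (wd u)) ` U" unfolding L_def using less.prems(1) ne by (intro Max_in) auto
    then obtain u where u: "u \<in> U" "length (wd u) = L" by auto
    from False obtain u' where "u' \<in> U" "wd u' \<noteq> []" by blast
    then have "L > 0" using Lmax[of u'] by (cases "wd u'") auto
    then obtain l w where lw: "wd u = l # w" using u by (cases "wd u") auto
    have LN: "L \<le> N" using less.prems(3) u by auto
    have first: "\<exists>a. wd v = l # a" if v: "v \<in> U" "wd v \<noteq> []" for v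
    proof -
      obtain l' a where a: "wd v = l' # a" using v by (cases "wd v") auto
      have "l' = l"
      proof (rule ccontr)
        assume "l' \<noteq> l"
        have "reduced (winv a @ linv l' # [])" using reduced_winv[of "wd v"] reduced_wd[of v] by (simp add: a)
        moreover have "reduced (linv l' # l # w)"
          using \<open>l' \<noteq> l\<close> reduced_wd[of u] by (simp add: lw)
        ultimately have "reduced (winv (wd v) @ wd u)"
          using reduced_append_Cons[of "winv a" "linv l'" "l # w"] by (simp add: a lw)
        then have "length (wd (- v + u)) = length (wd v) + L"
          using u by (simp add: wd_uminus_plus lapp_id)
        moreover have "- v + u \<in> U" using less.prems(2) v u by (intro subgroupD[OF less.prems(2)])
        ultimately show False using Lmax a by fastforce
      qed
      then show ?thesis using a by blast
    qed
    \<comment> \<open>Elements that fix the root must fix the first edge as well, since they map the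
      longest word to another word of the group.\<close>
    have short: "lact (hp v) l = l" if v: "v \<in> U" "wd v = []" for v
    proof -
      have "v + u \<in> U" using v u subgroupD(2)[OF less.prems(2)] by blast
      moreover have "wd (v + u) = map (lact (hp v)) (l # w)" using v by (simp add: wd_plus lw)
      ultimately show ?thesis using first[of "v + u"] by auto
    qed
    have ends: "\<exists>a. wd v = l # a @ [linv (lact (hp v) l)]" if v: "v \<in> U" "wd v \<noteq> []" for v
    proof -
      obtain a where a: "wd v = l # a" using first v by blast
      have "- v \<in> U" using v subgroupD(3)[OF less.prems(2)] by blast
      have wn: "wd (- v) = map (lact (- hp v)) (winv a) @ [lact (- hp v) (linv l)]"
        by (simp add: wd_uminus a map_winv lact_linv)
      then have ne: "wd (- v) \<noteq> []" by auto
      obtain a' where a': "wd (- v) = l # a'" using first[OF \<open>- v \<in> U\<close> ne] by blast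
      show ?thesis
      proof (cases a rule: rev_cases)
        case Nil
        then have "l = lact (- hp v) (linv l)" using wn a' by simp
        then have "snd l = snd (linv l)" by (metis snd_lact)
        then show ?thesis by (simp add: linv_def)
      next
        case (snoc b l')
        then have "l = lact (- hp v) (linv l')" using wn a' by (simp add: winv_append)
        then have "lact (hp v) l = linv l'" by (simp add: lact_add)
        then show ?thesis using a snoc by simp
      qed
    qed
    define g where "g = mk [l] (0 :: 'h)"
    have g: "wd g = [l]" "hp g = 0" by (simp_all add: g_def)
    have wdc: "wd (- g + v + g) = lapp [linv l] (lapp (wd v) [lact (hp v) l])" for v
      by (simp add: wd_plus wd_uminus g lapp_cons_red)
    have conj_long: "wd (- g + v + g) = a" if "v \<in> U" "wd v = l # a @ [linv (lact (hp v) l)]" for v a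
    proof -
      have r: "reduced ((l # a) @ [linv (lact (hp v) l)])" using reduced_wd[of v] that by simp
      then have r: "reduced (l # a)" using reduced_appendD by blast
      have "lapp (wd v) [lact (hp v) l] = lapp (l # a) []" by (simp add: that lapp_append)
      also have "\<dots> = l # a" using r by (rule lapp_Nil)
      finally show ?thesis unfolding wdc by simp
    qed
    have conj_short: "wd (- g + v + g) = []" if "v \<in> U" "wd v = []" for v
      unfolding wdc using short[OF that] that by (simp add: linv_def)
    define U' where "U' = (\<lambda>v. - g + v + g) ` U"
    have len: "length (wd (- g + v + g)) \<le> L - 2" if "v \<in> U" for v
    proof (cases "wd v = []")
      case False
      from ends[OF that this] obtain a where a: "wd v = l # a @ [linv (lact (hp v) l)]" by blast
      then show ?thesis using conj_long[OF that a] Lmax[OF that] by simp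
    qed (simp add: conj_short that)
    have sU': "is_subgroup U'"
      unfolding is_subgroup_def
    proof (intro conjI ballI)
      have "0 = - g + 0 + g" by simp
      then show "0 \<in> U'" unfolding U'_def using subgroupD(1)[OF less.prems(2)] by (metis imageI)
    next
      fix x y assume "x \<in> U'" "y \<in> U'"
      then obtain v v' where "v \<in> U" "v' \<in> U" "x = - g + v + g" "y = - g + v' + g" by (auto simp: U'_def)
      moreover from this have "x + y = - g + (v + v') + g" by (simp only: grps)
      ultimately show "x + y \<in> U'" using subgroupD(2)[OF less.prems(2)] unfolding U'_def by blast
    next
      fix x assume "x \<in> U'"
      then obtain v where "v \<in> U" "x = - g + v + g" by (auto simp: U'_def)
      moreover from this have "- x = - g + (- v) + g" by (simp only: grps)
      ultimately show "- x \<in> U'" using subgroupD(3)[OF less.prems(2)] unfolding U'_def by blast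
    qed
    have "L - 2 < N" using \<open>L > 0\<close> LN by simp
    then have "\<exists>u\<in>U'. \<exists>i. \<forall>v\<in>U'. vact v (take i (wd u)) = take i (wd u)"
      by (rule less.IH) (use less.prems(1) sU' len in \<open>auto simp: U'_def\<close>)
    then obtain v i where v: "v \<in> U" and fix': "\<forall>v'\<in>U'. vact v' (take i (wd (- g + v + g))) = take i (wd (- g + v + g))"
      by (auto simp: U'_def)
    let ?z = "take i (wd (- g + v + g))"
    have fz: "vact x (vact g ?z) = vact g ?z" if "x \<in> U" for x
    proof -
      have r: "reduced ?z" by (simp add: reduced_take)
      have "vact (- g + x + g) ?z = ?z" using fix' that by (auto simp: U'_def)
      then have "vact g (vact (- g + x + g) ?z) = vact g ?z" by simp
      then have "vact (g + (- g + x + g)) ?z = vact g ?z" using r by (simp add: vact_add)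
      then have "vact (x + g) ?z = vact g ?z" by (simp only: grps)
      then show ?thesis using r by (simp add: vact_add)
    qed
    have "\<exists>u\<in>U. \<exists>j. vact g ?z = take j (wd u)"
    proof (cases "wd v = []")
      case True
      then have "vact g ?z = [l]" using conj_short v by (simp add: g)
      then show ?thesis using u lw by (intro bexI[OF _ u(1)] exI[of _ 1]) simp
    next
      case False
      then obtain a where a: "wd v = l # a @ [linv (lact (hp v) l)]" using ends[OF v] by blast
      have wa: "wd (- g + v + g) = a" by (rule conj_long[OF v a])
      have "reduced (take (Suc (min i (length a))) (wd v))" by (simp add: reduced_take)
      then have r: "reduced (l # take i a)" by (simp add: a min_def split: if_splits)
      have "vact g (take i a) = l # take i a"
        using cons_red_id[OF r] by (simp add: vact_def g)
      then have "vact g ?z = take (Suc (min i (length a))) (wd v)" unfolding wa by (simp add: a min_def)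
      then show ?thesis using v by blast
    qed
    then show ?thesis using fz by metis
  qed
qed

context amalg
begin

theorem finite_subgroup_conj:
  assumes U: "finite U" "is_subgroup U" "U \<subseteq> W"
  shows "\<exists>g\<in>W. (\<forall>v\<in>U. - g + v + g \<in> hh ` A) \<or> (\<forall>v\<in>U. - g + v + g \<in> tc C ` B)"
proof -
  have "\<And>u. u \<in> U \<Longrightarrow> length (wd u) \<le> Max ((\<lambda>u. length (wd u)) ` U)"
    using U(1) by simp
  from finite_subgroup_fixes_prefix[OF U(1,2) this] obtain u i where u: "u \<in> U"
    "\<And>v. v \<in> U \<Longrightarrow> vact v (take i (wd u)) = take i (wd u)" by blast
  obtain g where g: "g \<in> W" "take i (wd u) = wd g \<or> take i (wd u) = wd (g + t)"
    using W_prefix U(3) u(1) by blast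
  have gv: "- g + v + g \<in> W" if "v \<in> U" for v
    using that U(3) g(1) by (intro subgroupD[OF subgroup_W]) auto
  from g(2) show ?thesis
  proof
    assume z: "take i (wd u) = wd g"
    have "- g + v + g \<in> hh ` A" if v: "v \<in> U" for v
    proof -
      have "wd (v + g) = wd g" using u(2)[OF v] unfolding z vact_wd .
      then obtain k where "v + g = g + hh k" using wd_eqD by metis
      then have "- g + (v + g) = - g + (g + hh k)" by simp
      then have k: "- g + v + g = hh k" by (simp only: grps)
      then show ?thesis using hh_W_D gv[OF v] by auto
    qed
    then show ?thesis using g(1) by blast
  next
    assume z: "take i (wd u) = wd (g + t)"
    have "- g + v + g \<in> tc C ` B" if v: "v \<in> U" for v
    proof -
      have "wd (v + (g + t)) = wd (g + t)" using u(2)[OF v] unfolding z vact_wd .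
      then obtain k where "v + (g + t) = g + t + hh k" using wd_eqD by metis
      then have "- g + (v + (g + t)) + - t = - g + (g + t + hh k) + - t" by simp
      then have k: "- g + v + g = tc C k" by (simp only: tc_def grps)
      then show ?thesis using tc_W_D gv[OF v] by auto
    qed
    then show ?thesis using g(1) by blast
  qed
qed

lemma B_not_conj_into_A:
  assumes g: "g \<in> W" and B: "\<And>b. b \<in> B \<Longrightarrow> - g + tc C b + g \<in> hh ` A"
  shows "B \<subseteq> C"
proof -
  obtain b0 v where b0: "b0 \<in> B" and v: "wd (- t + g) = ((False, (+) b0 ` C), False) # v"
    using wd_t_W[OF g] by blast
  have stab: "- b0 + (b + b0) \<in> C" if b: "b \<in> B" for b
  proof -
    obtain a where a: "- g + tc C b + g = hh a" using B[OF b] by blast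
    have "- t + g + (- g + tc C b + g) = - t + g + hh a" by (simp only: a)
    then have "hh b + (- t + g) = - t + g + hh a" by (simp only: tc_def grps)
    then have "wd (hh b + (- t + g)) = wd (- t + g + hh a)" by simp
    then have "map (lact b) (wd (- t + g)) = wd (- t + g)" by (simp add: wd_plus)
    then have "(+) (b + b0) ` C = (+) b0 ` C"
      unfolding v by (simp add: lact_def xact_def image_image add.assoc)
    from coset_eqD[OF sC this[symmetric]] show ?thesis .
  qed
  show ?thesis
  proof
    fix x assume x: "x \<in> B"
    have "b0 + x + - b0 \<in> B" using b0 x by (intro subgroupD[OF sB])
    from stab[OF this] show "x \<in> C" by (simp only: grps)
  qed
qed

end

text \<open>Either the vertex \<open>w\<close> lies behind the edge that leads to
  \<open>p @ [l]\<close>, or the path from \<open>p @ [l]\<close> to \<open>w\<close> starts by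
  going back along this edge.\<close>

lemma winv_prefix_cases:
  assumes "reduced (p @ [l])" "reduced w"
  shows "(\<exists>r. w = p @ l # r) \<or> (\<exists>r. lapp (winv (p @ [l])) w = linv l # r)"
  using assms
proof (induction p arbitrary: w)
  case Nil
  show ?case
  proof (cases w)
    case (Cons m w')
    then show ?thesis by (cases "m = l") auto
  qed simp
next
  case (Cons x p)
  have r: "reduced (p @ [l])" using Cons.prems by (simp add: reduced_Cons)
  show ?case
  proof (cases "\<exists>w'. w = x # w'")
    case True
    then obtain w' where w': "w = x # w'" by blast
    have "lapp (winv ((x # p) @ [l])) w = lapp (winv (p @ [l])) w'"
      using Cons.prems by (simp add: lapp_append w')
    then show ?thesis using Cons.IH[OF r, of w'] Cons.prems w' by (auto simp: reduced_Cons)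
  next
    case False
    have "reduced (winv ((x # p) @ [l]) @ w)"
    proof (cases w)
      case Nil
      then show ?thesis using Cons.prems(1) by (simp only: append_Nil2 reduced_winv)
    next
      case (Cons m w')
      have "reduced (winv (p @ [l]) @ [linv x])"
        using \<open>reduced ((x # p) @ [l])\<close> reduced_winv[of "(x # p) @ [l]"] by simp
      moreover have "reduced (linv x # m # w')"
        using False Cons \<open>reduced w\<close> by auto
      ultimately show ?thesis
        using reduced_append_Cons[of "winv (p @ [l])" "linv x" "m # w'"] Cons by simp
    qed
    then have "lapp (winv ((x # p) @ [l])) w = winv ((x # p) @ [l]) @ w" by (rule lapp_id)
    then show ?thesis by (simp add: winv_append)
  qed
qed

lemma prefix_if_winv:
  assumes "reduced (p @ [l])" "reduced w" "\<And>r. lapp (winv (p @ [l])) w \<noteq> linv l # r"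
  shows "\<exists>r. w = p @ l # r"
  using winv_prefix_cases assms by blast

subsection \<open>Generating pairs of vertex groups are adjacent\<close>

text \<open>If the two vertices were not adjacent, the two subgroups would play ping-pong on the tree and
  generate a proper subgroup, as seen on the second edge of root paths.\<close>

locale generating_pair = amalg A B C for A B C :: "'h::group_add set" +
  fixes d :: "'h gg" and q :: 'h and P0 Q0 S0 :: "'k::group_add set" and f :: "'k \<Rightarrow> 'h gg"
  assumes d: "d \<in> W"
    and q: "q \<in> B" "q \<notin> C" "normalizes q C" "q + q \<notin> C"
    and fin: "finite C"
    and hom: "\<And>x y. x \<in> gen (P0 \<union> Q0) \<Longrightarrow> y \<in> gen (P0 \<union> Q0) \<Longrightarrow> f (x + y) = f x + f y"
    and inj: "inj_on f (gen (P0 \<union> Q0))"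
    and surj: "W \<subseteq> f ` gen (P0 \<union> Q0)"
    and P0: "is_subgroup P0" "f ` P0 = hh ` A" and Q0: "is_subgroup Q0" "f ` Q0 = (\<lambda>b. d + tc C b + - d) ` B"
    and S0: "is_subgroup S0" "S0 \<subseteq> P0" "S0 \<subseteq> Q0" "card S0 = card C"
begin

definition z where "z = wd (d + t)"

lemma fPQ: "p \<in> P0 \<Longrightarrow> f p \<in> hh ` A" "k \<in> Q0 \<Longrightarrow> \<exists>b\<in>B. f k = d + tc C b + - d"
  using P0(2) Q0(2) by auto

lemma gen_PQ: "p \<in> P0 \<Longrightarrow> p \<in> gen (P0 \<union> Q0)" "k \<in> Q0 \<Longrightarrow> k \<in> gen (P0 \<union> Q0)"
  by (simp_all add: gen_base)

lemma fix_z: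
  assumes "r0 \<in> S0"
  obtains a b where "a \<in> A" "b \<in> B" "f r0 = hh a" "f r0 = d + tc C b + - d" "map (lact a) z = z" "a + hp d = hp d + b"
proof -
  obtain a where a: "a \<in> A" "f r0 = hh a" using assms S0 fPQ(1) by blast
  obtain b where b: "b \<in> B" "f r0 = d + tc C b + - d" using assms S0 fPQ(2) by blast
  have "hh a + (d + t) = d + tc C b + - d + (d + t)" using a b by simp
  also have "\<dots> = d + t + hh b" by (simp only: tc_def grps)
  finally have e: "hh a + (d + t) = d + t + hh b" .
  then have "wd (hh a + (d + t)) = wd (d + t + hh b)" by simp
  then have 1: "map (lact a) z = z" unfolding z_def by (simp add: wd_plus[of "hh a"])
  have "hp (hh a + (d + t)) = hp (d + t + hh b)" by (simp only: e)
  then have "a + hp d = hp d + b" by simp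
  then show ?thesis using that a b 1 by blast
qed

lemma z_first: obtains a0 v where "a0 \<in> A" "z = ((False, (+) a0 ` C), True) # v"
  using wd_W_t[OF d] unfolding z_def by blast

lemma card_conj: "card ((\<lambda>c. x + c + - x) ` C) = card C"
proof (rule card_image, rule inj_onI)
  fix c c' assume "x + c + - x = x + c' + - x"
  then have "- x + (x + c + - x) + x = - x + (x + c' + - x) + x" by simp
  then show "c = c'" by (simp only: grps)
qed

lemma inj_S0: "card (f ` S0) = card C"
proof -
  have "S0 \<subseteq> gen (P0 \<union> Q0)" using S0 gen_base by blast
  then show ?thesis using card_image[OF inj_on_subset[OF inj]] S0 by simp
qed

lemma S0_first:
  assumes p: "p \<in> P0" "f p = hh a" and l: "z = l # v" "lact a l = l"
  shows "p \<in> S0"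
proof -
  obtain a0 v0 where a0: "a0 \<in> A" "z = ((False, (+) a0 ` C), True) # v0" by (rule z_first)
  have st: "\<exists>c\<in>C. a = a0 + c + - a0" if "lact a l = l" for a
  proof -
    have "(+) (a + a0) ` C = (+) a0 ` C" using that l(1) a0(2)
      by (auto simp: lact_def xact_def image_image add.assoc)
    from coset_eqD[OF sC this[symmetric]] have "- a0 + (a + a0) \<in> C" .
    then show ?thesis by (intro bexI[of _ "- a0 + (a + a0)"]) (simp_all only: grps)
  qed
  let ?K = "hh ` ((\<lambda>c. a0 + c + - a0) ` C)"
  have "f ` S0 \<subseteq> ?K"
  proof
    fix y assume "y \<in> f ` S0"
    then obtain r0 where "r0 \<in> S0" "y = f r0" by blast
    then obtain a where a: "f r0 = hh a" "map (lact a) z = z" using fix_z by metis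
    then have "lact a l = l" using l by simp
    then show "y \<in> ?K" using st a \<open>y = f r0\<close> by auto
  qed
  moreover have "card ?K = card C"
    using card_conj[of a0] by (subst card_image) (auto simp: inj_on_def)
  ultimately have "f ` S0 = ?K" using inj_S0 fin by (intro card_subset_eq) auto
  moreover have "f p \<in> ?K" using st[OF l(2)] p by auto
  ultimately obtain r0 where "r0 \<in> S0" "f r0 = f p" by force
  then have "r0 = p" using inj_onD[OF inj] gen_PQ p S0 by (metis subsetD)
  then show ?thesis using \<open>r0 \<in> S0\<close> by simp
qed

lemma z_not_Nil: "z \<noteq> []"
  by (rule z_first) simp

lemma red_z: "reduced z" by (simp add: z_def)

text \<open>The last edge of \<open>z\<close> as it appears from the far end: the first letter of
  \<open>wd (- (d + t))\<close>.\<close>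

definition l1 where "l1 = lact (- hp d) (linv (last z))"

lemma l1: obtains b1 where "b1 \<in> B" "l1 = ((False, (+) b1 ` C), False)"
proof -
  have w: "wd (- (d + t)) = map (lact (- hp d)) (winv z)"
    by (simp add: wd_uminus z_def map_winv)
  have "winv z = linv (last z) # winv (butlast z)"
    using z_not_Nil by (metis append_butlast_last_id winv_append winv_simps append_Cons append_Nil)
  then have w: "wd (- (d + t)) = l1 # map (lact (- hp d)) (winv (butlast z))" unfolding w by (simp add: l1_def)
  have "- d \<in> W" using d by (rule subgroupD(3)[OF subgroup_W])
  then obtain b v where "b \<in> B" "wd (- t + - d) = ((False, (+) b ` C), False) # v" using wd_t_W by blast
  moreover have "- (d + t) = - t + - d" by (simp only: grps)
  ultimately show ?thesis using that w by simp
qed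

lemma S0_last:
  assumes k: "k \<in> Q0" "f k = d + tc C b + - d" and l: "lact b l1 = l1"
  shows "k \<in> S0"
proof -
  obtain b1 where b1: "b1 \<in> B" "l1 = ((False, (+) b1 ` C), False)" by (rule l1)
  have st: "\<exists>c\<in>C. b = b1 + c + - b1" if "lact b l1 = l1" for b
  proof -
    have "(+) (b + b1) ` C = (+) b1 ` C" using that b1(2)
      by (auto simp: lact_def xact_def image_image add.assoc)
    from coset_eqD[OF sC this[symmetric]] have "- b1 + (b + b1) \<in> C" .
    then show ?thesis by (intro bexI[of _ "- b1 + (b + b1)"]) (simp_all only: grps)
  qed
  let ?K = "(\<lambda>b. d + tc C b + - d) ` ((\<lambda>c. b1 + c + - b1) ` C)"
  have "f ` S0 \<subseteq> ?K"
  proof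
    fix y assume "y \<in> f ` S0"
    then obtain r0 where "r0 \<in> S0" "y = f r0" by blast
    then obtain a b where a: "f r0 = d + tc C b + - d" "map (lact a) z = z" "a + hp d = hp d + b" using fix_z by metis
    have "lact a (last z) = last z" using a(2) z_not_Nil by (metis last_map)
    then have "lact (- hp d) (lact a (linv (last z))) = l1" by (simp add: lact_linv l1_def)
    moreover have "- hp d + a = b + - hp d"
    proof -
      have "- hp d + (a + hp d) + - hp d = - hp d + (hp d + b) + - hp d" by (simp only: a(3))
      then show ?thesis by (simp only: grps)
    qed
    ultimately have "lact b l1 = l1" by (simp add: l1_def lact_add del: add_uminus_conv_diff)
    then have "b \<in> (\<lambda>c. b1 + c + - b1) ` C" using st by blast
    then show "y \<in> ?K" using a(1) \<open>y = f r0\<close> by (intro image_eqI[of y _ b]) simp_all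
  qed
  moreover have "card ?K = card C"
  proof -
    have "inj (\<lambda>b. d + tc C b + - d)"
    proof (rule injI)
      fix b b' assume "d + tc C b + - d = d + tc C b' + - d"
      then have "- d + (d + tc C b + - d) + d = - d + (d + tc C b' + - d) + d" by simp
      then have "tc C b = tc C b'" by (simp only: grps)
      then show "b = b'" by simp
    qed
    then show ?thesis using card_conj[of b1] by (subst card_image) (auto intro: inj_on_subset)
  qed
  ultimately have "f ` S0 = ?K" using inj_S0 fin by (intro card_subset_eq) auto
  moreover have "f k \<in> ?K" using st[OF l] k by auto
  ultimately obtain r0 where "r0 \<in> S0" "f r0 = f k" by force
  then have "r0 = k" using inj_onD[OF inj] gen_PQ k S0 by (metis subsetD)
  then show ?thesis using \<open>r0 \<in> S0\<close> by simp
qed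

text \<open>The ping-pong step. The element \<open>f k\<close> fixes the vertex \<open>z\<close> and
  moves the last edge before it. A vertex not behind \<open>z\<close> is joined to \<open>z\<close>
  through this edge, so its image is joined to \<open>z\<close> through another one and lies behind
  \<open>z\<close>.\<close>

lemma far:
  assumes k: "k \<in> Q0" "k \<notin> S0" and w: "reduced w" "\<nexists>r. w = z @ r"
  shows "\<exists>r. vact (f k) w = z @ r"
proof -
  obtain p l where z: "z = p @ [l]" using z_not_Nil by (metis rev_exhaust)
  have l1': "l1 = lact (- hp d) (linv l)" by (simp add: l1_def z)
  obtain b where b: "b \<in> B" "f k = d + tc C b + - d" using fPQ(2) k by blast
  have move: "lact b l1 \<noteq> l1" using S0_last[OF k(1) b(2)] k(2) by blast
  let ?e = "d + t"
  have bk: "vact (- ?e) v = map (lact (- hp d)) (lapp (winv z) v)" for v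
    by (simp add: vact_def wd_uminus z_def map_lapp map_winv)
  obtain r where r: "lapp (winv z) w = linv l # r"
    using winv_prefix_cases[of p l w] red_z w unfolding z by auto
  have "vact (- ?e) (vact (f k) w) = vact (- ?e + f k) w" using w by (simp add: vact_add)
  also have "- ?e + f k = hh b + - ?e" unfolding b(2) by (simp only: tc_def grps)
  also have "vact (hh b + - ?e) w = vact (hh b) (vact (- ?e) w)" by (rule vact_add[OF w(1)])
  also have "\<dots> = map (lact b) (vact (- ?e) w)" by (simp add: vact_def)
  also have "\<dots> = lact b l1 # map (lact b) (map (lact (- hp d)) r)" unfolding bk r by (simp add: l1')
  finally have e: "map (lact (- hp d)) (lapp (winv z) (vact (f k) w)) = lact b l1 # map (lact b) (map (lact (- hp d)) r)"
    unfolding bk .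
  have "lapp (winv (p @ [l])) (vact (f k) w) \<noteq> linv l # r'" for r'
  proof
    assume "lapp (winv (p @ [l])) (vact (f k) w) = linv l # r'"
    then have "lact b l1 = l1" using e unfolding z l1' by simp
    then show False using move by simp
  qed
  from prefix_if_winv[OF _ _ this] obtain r' where "vact (f k) w = p @ l # r'"
    using red_z w z by auto
  then show ?thesis by (simp add: z)
qed

lemma f_add: "x \<in> P0 \<union> Q0 \<or> x \<in> gen (P0 \<union> Q0) \<Longrightarrow> y \<in> P0 \<union> Q0 \<or> y \<in> gen (P0 \<union> Q0) \<Longrightarrow> f (x + y) = f x + f y"
  using hom gen_base by blast

lemma tails_gen: "x \<in> tails P0 Q0 S0 \<Longrightarrow> x \<in> gen (P0 \<union> Q0)"
  by (induction rule: tails.induct) (auto intro!: gen_plus intro: gen_base)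

lemma tails_far: "x \<in> tails P0 Q0 S0 \<Longrightarrow> \<exists>r. wd (f x) = z @ r"
proof (induction rule: tails.induct)
  case (tails_base k a)
  obtain a' where "f a = hh a'" using fPQ(1) tails_base by blast
  then have "wd (f (k + a)) = wd (f k)" using f_add tails_base by simp
  also have "\<dots> = vact (f k) []" by simp
  finally show ?case using far[of k "[]"] tails_base z_not_Nil by auto
next
  case (tails_step k a x)
  obtain a' where a': "f a = hh a'" using fPQ(1) tails_step by blast
  obtain l v where l: "z = l # v" using z_not_Nil by (cases z) auto
  have move: "lact a' l \<noteq> l" using S0_first[OF _ a' l] tails_step by blast
  obtain r where r: "wd (f x) = z @ r" using tails_step.IH by blast
  have "k + a \<in> gen (P0 \<union> Q0)" using tails_step gen_plus gen_PQ by blast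
  then have "f (k + a + x) = f (k + a) + f x" using tails_step tails_gen f_add by blast
  moreover have "f (k + a) = f k + f a" using tails_step f_add by blast
  ultimately have "f (k + a + x) = f k + (f a + f x)" by (simp add: add.assoc)
  then have "wd (f (k + a + x)) = vact (f k) (wd (f a + f x))" by (simp add: vact_wd)
  moreover have "wd (f a + f x) = map (lact a') (z @ r)" by (simp add: a' wd_plus r)
  moreover from this have "\<nexists>r'. wd (f a + f x) = z @ r'" using move l by auto
  ultimately show ?case using far[OF tails_step.hyps(1,2) reduced_wd, of "f a + f x"] by simp
qed

text \<open>By ping-pong every alternating product takes the root behind a translate of
  \<open>z\<close>, and \<open>surj\<close> says that \<open>W\<close> contains nothing
  else.\<close>

lemma W_far:
  assumes "y \<in> W" "wd y \<noteq> []"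
  shows "\<exists>a r. wd y = map (lact a) z @ r"
proof -
  obtain x where x: "x \<in> gen (P0 \<union> Q0)" "y = f x" using surj assms by blast
  from normal_form[OF P0(1) Q0(1) S0(1,2,3) x(1)] show ?thesis
  proof (elim disjE bexE)
    assume "x \<in> P0"
    then obtain a where "y = hh a" using fPQ(1) x by blast
    then show ?thesis using assms by simp
  next
    fix a x' assume h: "a \<in> P0" "x' \<in> tails P0 Q0 S0" "x = a + x'"
    obtain a' where a': "f a = hh a'" using fPQ(1) h by blast
    have "y = hh a' + f x'" using x h f_add tails_gen a' by simp
    then show ?thesis using tails_far[OF h(2)] by (auto simp: wd_plus)
  qed
qed

text \<open>If \<open>z\<close> had a second letter \<open>y\<close>, then by \<open>W_far\<close>
  the second letters of \<open>tc C q\<close> and \<open>tc C (- q)\<close> would both be translates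
  of \<open>y\<close>, by elements that agree on the first letter and hence differ by an element of
  \<open>C\<close>. So \<open>q\<close> and \<open>- q\<close> would have the same coset, against
  \<open>q + q\<close> outside \<open>C\<close>.\<close>

theorem adjacent: "length z = 1"
proof (rule ccontr)
  assume "length z \<noteq> 1"
  then obtain x y v where z: "z = x # y # v" using z_not_Nil by (metis length_Cons list.exhaust list.size(3) One_nat_def)
  obtain a0 v0 where a0: "z = ((False, (+) a0 ` C), True) # v0" by (rule z_first)
  have x: "x = ((False, (+) a0 ` C), True)" using z a0 by simp
  have "- q \<notin> C"
  proof
    assume "- q \<in> C"
    from subgroupD(3)[OF sC this] show False using q by simp
  qed
  have key: "\<exists>a. - a0 + - a \<in> C \<and> lact a y = ((False, (+) b ` C), False)" if b: "b \<in> B" "b \<notin> C" for b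
  proof -
    have "wd (tc C b) \<noteq> []" using wd_tc[OF b(2)] by simp
    from W_far[OF tcB_W[OF b(1)] this] obtain a r where "wd (tc C b) = map (lact a) z @ r" by blast
    then have h: "lact a x = ((False, C), True)" "lact a y = ((False, (+) b ` C), False)"
      unfolding wd_tc[OF b(2)] z by auto
    have "(+) (a + a0) ` C = C" using h(1) unfolding x by (simp add: lact_def xact_def image_image add.assoc)
    then have "(+) (a + a0) ` C = (+) 0 ` C" by simp
    from coset_eqD[OF sC this] have "- a0 + - a \<in> C" by (simp only: grps)
    then show ?thesis using h(2) by blast
  qed
  obtain a where a: "- a0 + - a \<in> C" "lact a y = ((False, (+) q ` C), False)" using key q by blast
  obtain a' where a': "- a0 + - a' \<in> C" "lact a' y = ((False, (+) (- q) ` C), False)"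
    using key[of "- q"] q \<open>- q \<notin> C\<close> subgroupD(3)[OF sB] by blast
  define c where "c = a' + - a"
  have "- (- a0 + - a') + (- a0 + - a) \<in> C" using subgroupD(2)[OF sC subgroupD(3)[OF sC a'(1)] a(1)] .
  then have c: "c \<in> C" unfolding c_def by (simp only: grps)
  have "lact c (lact a y) = lact a' y" unfolding lact_add c_def by (simp only: grps)
  then have "(+) (c + q) ` C = (+) (- q) ` C"
    unfolding a a' by (simp add: lact_def xact_def image_image add.assoc)
  from coset_eqD[OF sC this] have 1: "- (c + q) + - q \<in> C" .
  have "- q + c + q \<in> C" using q(3) c by (simp add: normalizes_def)
  from subgroupD(2)[OF sC this 1] have "- q + - q \<in> C" by (simp only: grps)
  from subgroupD(3)[OF sC this] have "q + q \<in> C" by (simp only: grps)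
  then show False using q by simp
qed

end

section \<open>An invariant that distinguishes the amalgams\<close>

definition five :: "'g::group_add set \<Rightarrow> 'g \<Rightarrow> bool" where
  "five U c \<longleftrightarrow> (\<exists>x\<in>U. x \<noteq> 0 \<and> x + x + x + x + x = 0 \<and> c + x = x + c)"

lemma conj_add: "- g + (x + y) + g = (- g + x + g) + (- g + y + (g :: 'g::group_add))"
  by (simp only: grps)

definition hom_on :: "('a::group_add \<Rightarrow> 'b::group_add) \<Rightarrow> 'a set \<Rightarrow> bool" where
  "hom_on k U \<longleftrightarrow> (\<forall>x\<in>U. \<forall>y\<in>U. k (x + y) = k x + k y)"

lemma hom_onD: "hom_on k U \<Longrightarrow> x \<in> U \<Longrightarrow> y \<in> U \<Longrightarrow> k (x + y) = k x + k y"
  by (simp add: hom_on_def)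

lemma hom_on_0:
  assumes "hom_on k U" "is_subgroup U"
  shows "k 0 = 0"
proof -
  have "k 0 + k 0 = k 0 + 0" using hom_onD[OF assms(1), of 0 0] subgroupD(1)[OF assms(2)] by simp
  then show ?thesis by (simp only: add_left_cancel)
qed

lemma hom_on_uminus:
  assumes "hom_on k U" "is_subgroup U" "x \<in> U"
  shows "k (- x) = - k x"
proof -
  have "k (- x) + k x = 0"
    using hom_onD[OF assms(1), of "- x" x] subgroupD(3)[OF assms(2)] assms hom_on_0[OF assms(1,2)] by simp
  then show ?thesis by (metis add.inverse_unique minus_minus)
qed

lemma subgroup_hom_on_image:
  assumes k: "hom_on k W" "is_subgroup W" and U: "is_subgroup U" "U \<subseteq> W"
  shows "is_subgroup (k ` U)"
  unfolding is_subgroup_def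
proof (intro conjI ballI)
  show "0 \<in> k ` U" using subgroupD(1)[OF U(1)] hom_on_0[OF k] by force
next
  fix x y assume "x \<in> k ` U" "y \<in> k ` U"
  then obtain x' y' where "x' \<in> U" "y' \<in> U" "x = k x'" "y = k y'" by auto
  then show "x + y \<in> k ` U" using hom_onD[OF k(1), of x' y'] U subgroupD(2)[OF U(1)] by (metis image_eqI subsetD)
next
  fix x assume "x \<in> k ` U"
  then obtain x' where "x' \<in> U" "x = k x'" by auto
  then show "- x \<in> k ` U" using hom_on_uminus[OF k] U subgroupD(3)[OF U(1)] by (metis image_eqI subsetD)
qed

locale nonisomorphic = V1: amalg A B C + V2: amalg A B' C
  for A B B' C :: "'h::group_add set" +
  fixes q :: 'h
  assumes fin: "finite A" "finite B" "finite B'" and card: "card B = card B'" and BC: "\<not> B \<subseteq> C"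
    and q: "q \<in> B'" "q \<notin> C" "normalizes q C" "q + q \<notin> C"
    and no_inj: "\<And>f. (\<And>x y. x \<in> A \<Longrightarrow> y \<in> A \<Longrightarrow> f (x + y) = f x + f y) \<Longrightarrow> inj_on f A \<Longrightarrow> f ` A \<subseteq> B' \<Longrightarrow> False"
    and five: "\<exists>c\<in>C. c \<noteq> 0 \<and> five A c \<and> five B c" and no_five: "\<not> (\<exists>c\<in>C. c \<noteq> 0 \<and> five A c \<and> five B' c)"
begin

lemma no_iso:
  assumes add: "hom_on f (WW A B C)"
    and bij: "bij_betw f (WW A B C) (WW A B' C)"
  shows False
proof -
  let ?W = "WW A B C" and ?W' = "WW A B' C"
  have W: "is_subgroup ?W" "is_subgroup ?W'" by (rule V1.subgroup_W V2.subgroup_W)+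
  have finC: "finite C" using fin V1.CA finite_subset by blast
  have sA: "is_subgroup (hh ` A)" "hh ` A \<subseteq> ?W" and sB: "is_subgroup (tc C ` B)" "tc C ` B \<subseteq> ?W"
    using V1.subgroup_hh[OF V1.sA] V1.subgroup_tc[OF V1.sB] V1.hhA_W V1.tcB_W by auto
  have fW: "f ` ?W = ?W'" "inj_on f ?W" using bij by (auto simp: bij_betw_def)
  have "\<exists>g\<in>?W'. (\<forall>v\<in>f ` hh ` A. - g + v + g \<in> hh ` A) \<or> (\<forall>v\<in>f ` hh ` A. - g + v + g \<in> tc C ` B')"
    using fin fW sA by (intro V2.finite_subgroup_conj subgroup_hom_on_image[OF add W(1)]) auto
  then obtain g where g: "g \<in> ?W'"
    "(\<forall>a\<in>A. - g + f (hh a) + g \<in> hh ` A) \<or> (\<forall>a\<in>A. - g + f (hh a) + g \<in> tc C ` B')" by auto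
  define f1 where "f1 x = - g + f x + g" for x
  have f1: "hom_on f1 ?W"
    unfolding hom_on_def f1_def by (intro ballI) (simp only: hom_onD[OF add] conj_add)
  note f1_add = hom_onD[OF f1]
  have f1_inj: "inj_on f1 ?W" using fW(2) by (auto simp: inj_on_def f1_def add.assoc)
  have f1_W: "f1 ` ?W = ?W'"
  proof
    show "f1 ` ?W \<subseteq> ?W'"
    proof clarify
      fix x assume "x \<in> ?W"
      then have "f x \<in> ?W'" using fW(1) by blast
      then show "f1 x \<in> ?W'" unfolding f1_def using g(1) by (intro subgroupD[OF W(2)])
    qed
    show "?W' \<subseteq> f1 ` ?W"
    proof
      fix y assume "y \<in> ?W'"
      then have "g + y + - g \<in> ?W'" using g(1) by (intro subgroupD[OF W(2)])
      then obtain x where "x \<in> ?W" "f x = g + y + - g" using fW(1) by (metis imageE)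
      moreover from this have "f1 x = y" by (simp only: f1_def grps)
      ultimately show "y \<in> f1 ` ?W" by blast
    qed
  qed
  have f1A: "f1 (hh a) \<in> hh ` A" if "a \<in> A" for a
  proof (rule ccontr)
    assume "f1 (hh a) \<notin> hh ` A"
    then have B': "\<And>a. a \<in> A \<Longrightarrow> f1 (hh a) \<in> tc C ` B'" using g(2) that by (auto simp: f1_def)
    define F where "F a = hp (f1 (hh a))" for a
    have F: "F a \<in> B'" "f1 (hh a) = tc C (F a)" if "a \<in> A" for a
      using B'[OF that] by (auto simp: F_def)
    show False
    proof (rule no_inj[of F])
      show "F (x + y) = F x + F y" if "x \<in> A" "y \<in> A" for x y
        using f1_add[of "hh x" "hh y"] V1.hhA_W that by (simp add: F_def hh_add)
      show "inj_on F A"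
      proof (rule inj_onI)
        fix x y assume "x \<in> A" "y \<in> A" "F x = F y"
        then have "f1 (hh x) = f1 (hh y)" using F by metis
        then show "x = y" using inj_onD[OF f1_inj] V1.hhA_W \<open>x \<in> A\<close> \<open>y \<in> A\<close> by fastforce
      qed
      show "F ` A \<subseteq> B'" using F by auto
    qed
  qed
  have f1_hhA: "f1 ` hh ` A = hh ` A"
  proof (rule card_subset_eq)
    show "finite (hh ` A)" using fin by simp
    show "f1 ` hh ` A \<subseteq> hh ` A" using f1A by auto
    show "card (f1 ` hh ` A) = card (hh ` A)"
      by (rule card_image) (rule inj_on_subset[OF f1_inj sA(2)])
  qed
  have "\<exists>d\<in>?W'. (\<forall>v\<in>f1 ` tc C ` B. - d + v + d \<in> hh ` A) \<or> (\<forall>v\<in>f1 ` tc C ` B. - d + v + d \<in> tc C ` B')"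
    using fin f1_W sB by (intro V2.finite_subgroup_conj subgroup_hom_on_image[OF f1 W(1)]) auto
  then obtain d where d: "d \<in> ?W'"
    "(\<forall>b\<in>B. - d + f1 (tc C b) + d \<in> hh ` A) \<or> (\<forall>b\<in>B. - d + f1 (tc C b) + d \<in> tc C ` B')" by auto
  have dB: "- d + f1 (tc C b) + d \<in> tc C ` B'" if "b \<in> B" for b
  proof (rule ccontr)
    assume "- d + f1 (tc C b) + d \<notin> tc C ` B'"
    then have dA: "\<And>b. b \<in> B \<Longrightarrow> - d + f1 (tc C b) + d \<in> hh ` A" using d(2) that by blast
    have "d \<in> f1 ` ?W" using d(1) by (simp only: f1_W)
    then obtain d0 where d0: "d0 \<in> ?W" "f1 d0 = d" by auto
    have md0: "- d0 \<in> ?W" using d0 by (intro subgroupD[OF W(1)])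
    have f1m: "f1 (- d0) = - d" using hom_on_uminus[OF f1 W(1) d0(1)] d0(2) by simp
    have "- d0 + tc C b + d0 \<in> hh ` A" if b: "b \<in> B" for b
    proof -
      have e: "f1 (- d0 + tc C b + d0) = - d + f1 (tc C b) + d"
        using f1_add[of "- d0 + tc C b" d0] f1_add[of "- d0" "tc C b"] md0 d0 b V1.tcB_W f1m subgroupD(2)[OF W(1)] by simp
      have "- d + f1 (tc C b) + d \<in> f1 ` hh ` A" using dA[OF b] by (simp only: f1_hhA)
      then obtain a where a: "a \<in> A" "f1 (hh a) = - d + f1 (tc C b) + d" by auto
      have "- d0 + tc C b + d0 \<in> ?W" using md0 d0 b V1.tcB_W by (intro subgroupD(2)[OF W(1)])
      moreover have "f1 (- d0 + tc C b + d0) = f1 (hh a)" by (simp only: e a(2))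
      ultimately have "- d0 + tc C b + d0 = hh a"
        using inj_onD[OF f1_inj _ _ V1.hhA_W[OF a(1)]] by blast
      then show ?thesis using a by blast
    qed
    then have "B \<subseteq> C" by (rule V1.B_not_conj_into_A[OF d0(1)])
    then show False using BC by simp
  qed
  have f1B: "f1 ` tc C ` B = (\<lambda>b. d + tc C b + - d) ` B'"
  proof (rule card_subset_eq)
    show "finite ((\<lambda>b. d + tc C b + - d) ` B')" using fin by simp
    show "f1 ` tc C ` B \<subseteq> (\<lambda>b. d + tc C b + - d) ` B'"
    proof clarify
      fix b assume "b \<in> B"
      then obtain b' where "b' \<in> B'" "- d + f1 (tc C b) + d = tc C b'" using dB by blast
      moreover from this have "f1 (tc C b) = d + tc C b' + - d" by (metis add.assoc add_minus_cancel right_minus add_0_right)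
      ultimately show "f1 (tc C b) \<in> (\<lambda>b. d + tc C b + - d) ` B'" by blast
    qed
    have "card (f1 ` tc C ` B) = card B"
      by (subst card_image[OF inj_on_subset[OF f1_inj sB(2)]], rule card_image) (simp add: inj_on_def V1.tc_inj)
    moreover have "card ((\<lambda>b. d + tc C b + - d) ` B') = card B'"
    proof (rule card_image, rule inj_onI)
      fix b b' assume "d + tc C b + - d = d + tc C b' + - d"
      then have "- d + (d + tc C b + - d) + d = - d + (d + tc C b' + - d) + d" by simp
      then have "tc C b = tc C b'" by (simp only: grps)
      then show "b = b'" by (simp add: V1.tc_inj)
    qed
    ultimately show "card (f1 ` tc C ` B) = card ((\<lambda>b. d + tc C b + - d) ` B')" using card by simp
  qed
  have genW: "gen (hh ` A \<union> tc C ` B) = ?W" by (simp add: WW_def)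
  have CB: "hh ` C \<subseteq> tc C ` B" using V1.tc_C V1.CB by (metis (no_types, lifting) image_subset_iff rev_image_eqI subsetD)
  interpret p: generating_pair A B' C d q "hh ` A" "tc C ` B" "hh ` C" f1
  proof unfold_locales
    show "card (hh ` C) = card C" by (rule card_image) (simp add: inj_on_def)
    show "is_subgroup (hh ` C)" by (rule V1.subgroup_hh[OF V1.sC])
    show "hh ` C \<subseteq> hh ` A" using V1.CA by blast
    show "f1 ` tc C ` B = (\<lambda>b. d + tc C b + - d) ` B'" by (rule f1B)
  qed (use d q finC f1_add f1_inj f1_W genW sA sB f1_hhA CB in \<open>simp_all\<close>)
  obtain a0 v where a0: "a0 \<in> A" "wd (d + tt C) = ((False, (+) a0 ` C), True) # v" using V2.wd_W_t[OF d(1)] by blast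
  \<comment> \<open>The vertex of \<open>d + tt C\<close> is a neighbour of the root. So
    \<open>d\<close> is an element of \<open>A\<close> followed by one of the second factor, and one
    more conjugation takes care of both factors at once.\<close>
  then have "wd (d + tt C) = [((False, (+) a0 ` C), True)]" using p.adjacent unfolding p.z_def by simp
  also have "\<dots> = wd (hh a0 + tt C)" by (simp add: wd_plus V1.wd_tt lact_def xact_def)
  finally obtain k where "d + tt C = hh a0 + tt C + hh k" using wd_eqD by metis
  then have "- hh a0 + (d + tt C) + - tt C = - hh a0 + (hh a0 + tt C + hh k) + - tt C" by simp
  then have k: "- hh a0 + d = tc C k" by (simp only: tc_def grps)
  have "- hh a0 + d \<in> ?W'" using d(1) a0(1) by (intro subgroupD[OF W(2)] V2.hhA_W)
  then have kB: "k \<in> B'" unfolding k by (rule V2.tc_W_D)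
  define f2 where "f2 x = - hh a0 + f1 x + hh a0" for x
  have f2: "hom_on f2 ?W"
    unfolding hom_on_def f2_def by (intro ballI) (simp only: hom_onD[OF f1] conj_add)
  have f2_inj: "inj_on f2 ?W" using f1_inj by (auto simp: inj_on_def f2_def add.assoc)
  have f2A: "\<exists>a'\<in>A. f2 (hh a) = hh a'" if "a \<in> A" for a
  proof -
    from f1A[OF that] obtain a' where "a' \<in> A" "f1 (hh a) = hh a'" by blast
    then have "f2 (hh a) = hh (- a0 + a' + a0)" "- a0 + a' + a0 \<in> A"
      using a0(1) by (auto simp only: f2_def hh_add hh_uminus intro!: subgroupD[OF V1.sA])
    then show ?thesis by blast
  qed
  have f2B: "\<exists>b'\<in>B'. f2 (tc C b) = tc C b'" if b: "b \<in> B" for b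
  proof -
    have "f1 (tc C b) \<in> f1 ` tc C ` B" using b by blast
    then have "f1 (tc C b) \<in> (\<lambda>b. d + tc C b + - d) ` B'" by (simp only: f1B)
    then obtain b' where b': "b' \<in> B'" "f1 (tc C b) = d + tc C b' + - d" by blast
    have "f2 (tc C b) = (- hh a0 + d) + tc C b' + - (- hh a0 + d)" unfolding f2_def b'(2) by (simp only: grps)
    also have "\<dots> = tc C (k + b' + - k)" unfolding k by (simp only: V1.tc_add V1.tc_uminus)
    finally show ?thesis using b'(1) kB by (intro bexI[of _ "k + b' + - k"] subgroupD[OF V2.sB])
  qed
  obtain c where c: "c \<in> C" "c \<noteq> 0" "five A c" "five B c" using five by blast
  obtain a where a: "a \<in> A" "f2 (hh c) = hh a" using f2A c V1.CA by blast
  obtain b where b: "b \<in> B'" "f2 (tc C c) = tc C b" using f2B c V1.CB by blast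
  \<comment> \<open>The image of \<open>c\<close> lies in both factors, hence in \<open>C\<close>;
    it is the element to which \<open>no_five\<close> applies.\<close>
  have ab: "hh a = tc C b" using a b V1.tc_C[OF c(1)] by simp
  then have "wd (tc C b) = []" by (metis wd_hh)
  then have bC: "b \<in> C" using V2.wd_tc by force
  then have "a = b" using ab V1.tc_C by simp
  have f20: "f2 0 = 0" by (rule hom_on_0[OF f2 W(1)])
  have hhW: "hh x \<in> ?W" if "x \<in> A" for x using V1.hhA_W that by blast
  have tcW: "tc C x \<in> ?W" if "x \<in> B" for x using V1.tcB_W that by blast
  have "a \<noteq> 0"
  proof
    assume "a = 0"
    then have "f2 (hh c) = f2 0" using a f20 by simp
    then have "hh c = 0" using inj_onD[OF f2_inj] hhW c V1.CA subgroupD(1)[OF W(1)] by blast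
    then show False using c by (metis hh_0 hh_inj)
  qed
  have "five A a"
  proof -
    obtain x where x: "x \<in> A" "x \<noteq> 0" "x + x + x + x + x = 0" "c + x = x + c" using c(3) by (auto simp: five_def)
    obtain x' where x': "x' \<in> A" "f2 (hh x) = hh x'" using f2A x by blast
    have cA: "c \<in> A" using c V1.CA by blast
    have add2: "f2 (hh (y + z)) = f2 (hh y) + f2 (hh z)" if "y \<in> A" "z \<in> A" for y z
      unfolding hh_add using hom_onD[OF f2] hhW that by blast
    have "f2 (hh (x + x + x + x + x)) = f2 (hh x) + f2 (hh x) + f2 (hh x) + f2 (hh x) + f2 (hh x)"
      using x(1) by (simp only: add2 subgroupD(2)[OF V1.sA])
    then have "hh (x' + x' + x' + x' + x') = f2 (hh (x + x + x + x + x))"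
      by (simp only: x'(2) hh_add)
    also have "\<dots> = hh 0" unfolding x(3) using f20 by simp
    finally have "x' + x' + x' + x' + x' = 0" by (simp only: hh_inj)
    moreover have "hh (a + x') = hh (x' + a)"
      using add2[OF cA x(1)] add2[OF x(1) cA] x(4) a(2) x'(2) by (simp add: hh_add)
    moreover have "x' \<noteq> 0"
    proof
      assume "x' = 0"
      then have "f2 (hh x) = f2 0" using x' f20 by simp
      then have "hh x = 0" using inj_onD[OF f2_inj] hhW x subgroupD(1)[OF W(1)] by blast
      then show False using x by (metis hh_0 hh_inj)
    qed
    ultimately show ?thesis using x'(1) unfolding five_def by auto
  qed
  moreover have "five B' a"
  proof -
    obtain x where x: "x \<in> B" "x \<noteq> 0" "x + x + x + x + x = 0" "c + x = x + c" using c(4) by (auto simp: five_def)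
    obtain x' where x': "x' \<in> B'" "f2 (tc C x) = tc C x'" using f2B x by blast
    have cB: "c \<in> B" using c V1.CB by blast
    have add2: "f2 (tc C (y + z)) = f2 (tc C y) + f2 (tc C z)" if "y \<in> B" "z \<in> B" for y z
      unfolding V1.tc_add[symmetric] using hom_onD[OF f2] tcW that by blast
    have "f2 (tc C (x + x + x + x + x)) = f2 (tc C x) + f2 (tc C x) + f2 (tc C x) + f2 (tc C x) + f2 (tc C x)"
      using x(1) by (simp only: add2 subgroupD(2)[OF V1.sB])
    then have "tc C (x' + x' + x' + x' + x') = f2 (tc C (x + x + x + x + x))"
      by (simp only: x'(2) V1.tc_add[symmetric])
    also have "\<dots> = tc C 0" unfolding x(3) using f20 by (simp add: V1.tc_0)
    finally have "x' + x' + x' + x' + x' = 0" by (simp only: V1.tc_inj)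
    moreover have "tc C (b + x') = tc C (x' + b)"
      using add2[OF cB x(1)] add2[OF x(1) cB] x(4) b(2) x'(2) by (simp add: V1.tc_add[symmetric])
    moreover have "x' \<noteq> 0"
    proof
      assume "x' = 0"
      then have "f2 (tc C x) = f2 0" using x' f20 by (simp add: V1.tc_0)
      then have "tc C x = tc C 0" using inj_onD[OF f2_inj] tcW x subgroupD(1)[OF W(1)] by (simp add: V1.tc_0)
      then have "x = 0" by (simp only: V1.tc_inj)
      then show False using x(2) by simp
    qed
    ultimately show ?thesis using x'(1) unfolding five_def \<open>a = b\<close> by (auto simp: V1.tc_inj)
  qed
  ultimately show False using no_five bC \<open>a = b\<close> \<open>a \<noteq> 0\<close> by blast
qed

theorem not_isomorphic: "\<not> gm (WW A B C) \<cong> gm (WW A B' C)"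
proof
  assume "gm (WW A B C) \<cong> gm (WW A B' C)"
  then obtain f where "f \<in> iso (gm (WW A B C)) (gm (WW A B' C))" by (auto simp: is_iso_def)
  then show False by (intro no_iso[of f]) (auto simp: iso_def hom_def hom_on_def)
qed

end

subsection \<open>Bijections as a group\<close>

text \<open>Serves for the concrete permutations of natural numbers and also, over sets of words, as
  the target of representations of presented groups.\<close>

typedef 'a bj = "{f :: 'a \<Rightarrow> 'a. bij f}"
  by (rule exI[of _ id]) simp

definition ap :: "'a bj \<Rightarrow> 'a \<Rightarrow> 'a" where "ap = Rep_bj"

lemma bij_ap [simp]: "bij (ap f)"
  using Rep_bj[of f] by (simp add: ap_def)

lemma ap_Abs: "bij f \<Longrightarrow> ap (Abs_bj f) = f" by (simp add: ap_def Abs_bj_inverse)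

lemma bj_eqI: "(\<And>x. ap f x = ap g x) \<Longrightarrow> f = g" unfolding ap_def by (metis Rep_bj_inject ext)

instantiation bj :: (type) group_add
begin

definition zero_bj :: "'a bj" where "0 = Abs_bj id"
definition plus_bj :: "'a bj \<Rightarrow> 'a bj \<Rightarrow> 'a bj" where "f + g = Abs_bj (ap f \<circ> ap g)"
definition uminus_bj :: "'a bj \<Rightarrow> 'a bj" where "- f = Abs_bj (inv_into UNIV (ap f))"
definition minus_bj :: "'a bj \<Rightarrow> 'a bj \<Rightarrow> 'a bj" where "f - (g :: 'a bj) = f + - g"

instance
proof
  fix a b c :: "'a bj"
  have [simp]: "ap (a + b) = ap a \<circ> ap b" "ap (- a) = inv_into UNIV (ap a)" "ap (0 :: 'a bj) = id" for a b :: "'a bj"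
    by (simp_all add: plus_bj_def uminus_bj_def zero_bj_def ap_Abs bij_comp bij_imp_bij_inv)
  show "a + b + c = a + (b + c)" "0 + a = a" "a + 0 = a" by (rule bj_eqI; simp)+
  show "- a + a = 0" by (rule bj_eqI) (simp add: bij_is_inj inv_f_f)
  show "a + - b = a - b" by (simp add: minus_bj_def)
qed

end

lemma ap_0 [simp]: "ap 0 x = x" by (simp add: zero_bj_def ap_Abs)
lemma ap_add [simp]: "ap (f + g) x = ap f (ap g x)" by (simp add: plus_bj_def ap_Abs bij_comp)
lemma ap_minus [simp]: "ap (- f) (ap f x) = x" "ap f (ap (- f) x) = x"
  by (metis ap_0 ap_add left_minus, metis ap_0 ap_add right_minus)
lemma ap_inj [simp]: "ap f x = ap f y \<longleftrightarrow> x = y" by (metis ap_minus(1))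

subsection \<open>Presented groups\<close>

lemma pres_eq_cong: "pres_eq R u v \<Longrightarrow> pres_eq R (a @ u @ b) (a @ v @ b)"
proof (induction rule: pres_eq.induct)
  case (pe_cancel u x c v)
  then show ?case using pres_eq.pe_cancel[of R "a @ u" x c "v @ b"] by simp
next
  case (pe_rel r u v)
  then show ?case using pres_eq.pe_rel[of r R "a @ u" "v @ b"] by simp
qed (auto intro: pres_eq.pe_refl pres_eq.pe_sym pres_eq.pe_trans)

lemma pres_eq_append: "pres_eq R u u' \<Longrightarrow> pres_eq R v v' \<Longrightarrow> pres_eq R (u @ v) (u' @ v')"
  using pres_eq_cong[of R u u' "[]" v] pres_eq_cong[of R v v' u' "[]"] by (auto intro: pres_eq.pe_trans)

lemma pres_class_eq_iff: "pres_class R u = pres_class R v \<longleftrightarrow> pres_eq R u v"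
proof
  assume "pres_class R u = pres_class R v"
  moreover have "v \<in> pres_class R v" by (simp add: pres_class_def pres_eq.pe_refl)
  ultimately have "v \<in> pres_class R u" by (simp only:)
  then show "pres_eq R u v" by (simp add: pres_class_def)
next
  assume "pres_eq R u v"
  then show "pres_class R u = pres_class R v"
    unfolding pres_class_def by (blast intro: pres_eq.pe_sym pres_eq.pe_trans)
qed

lemma pres_class_self: "u \<in> pres_class R u"
  by (simp add: pres_class_def pres_eq.pe_refl)

lemma pres_eq_winv: "pres_eq R (w @ winv w) []"
proof (induction w)
  case (Cons l w)
  have "pres_eq R ([l] @ (w @ winv w) @ [linv l]) ([l] @ [] @ [linv l])"
    by (rule pres_eq_cong[OF Cons])
  moreover have "pres_eq R ([] @ [(fst l, snd l), (fst l, \<not> snd l)] @ []) ([] @ [])"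
    by (rule pres_eq.pe_cancel)
  ultimately show ?case by (auto intro: pres_eq.pe_trans simp: linv_def)
qed (simp add: pres_eq.pe_refl)

lemma pres_eq_evt: "pres_eq R u v \<Longrightarrow> (\<And>r. r \<in> R \<Longrightarrow> evt f r = 0) \<Longrightarrow> evt f u = evt f v"
  by (induction rule: pres_eq.induct) (auto simp: add.assoc)

lemma evt_winv: "evt f (winv w) = - evt f w"
proof (induction w)
  case (Cons l w)
  then show ?case by (cases "snd l") (simp_all add: linv_def minus_add del: add_uminus_conv_diff)
qed simp

lemma pres_mult:
  "pres_class R u \<otimes>\<^bsub>pres_group Gens R\<^esub> pres_class R v = pres_class R (u @ v)"
proof -
  have "pres_eq R u (SOME x. x \<in> pres_class R u)" for u
    using someI[of "\<lambda>x. x \<in> pres_class R u", OF pres_class_self] by (simp add: pres_class_def)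
  then show ?thesis
    by (simp add: pres_group_def pres_class_eq_iff) (metis pres_eq.pe_sym pres_eq_append)
qed

lemma pres_one: "\<one>\<^bsub>pres_group Gens R\<^esub> = pres_class R []"
  and pres_carrier: "carrier (pres_group Gens R) = pres_class R ` {w. set w \<subseteq> Gens \<times> UNIV}"
  by (simp_all add: pres_group_def)

lemma set_winv: "set (winv w) \<subseteq> G \<times> UNIV \<longleftrightarrow> set w \<subseteq> G \<times> UNIV"
  by (force simp: winv_def linv_def)

lemma group_pres_group: "group (pres_group Gens R)"
proof (rule groupI)
  fix x assume "x \<in> carrier (pres_group Gens R)"
  then obtain w where w: "set w \<subseteq> Gens \<times> UNIV" "x = pres_class R w" by (auto simp: pres_carrier)
  show "\<exists>y\<in>carrier (pres_group Gens R). y \<otimes>\<^bsub>pres_group Gens R\<^esub> x = \<one>\<^bsub>pres_group Gens R\<^esub>"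
  proof (rule bexI)
    show "pres_class R (winv w) \<otimes>\<^bsub>pres_group Gens R\<^esub> x = \<one>\<^bsub>pres_group Gens R\<^esub>"
      unfolding w pres_mult pres_one pres_class_eq_iff using pres_eq_winv[of R "winv w"] by simp
    show "pres_class R (winv w) \<in> carrier (pres_group Gens R)"
      unfolding pres_carrier using w set_winv by blast
  qed
qed (auto simp: pres_carrier pres_mult pres_one intro!: imageI)

text \<open>The letters act on the classes by left multiplication and trivially on all other sets,
  which makes them bijections of the whole type. The relators act trivially, and a word takes the
  class of \<open>[]\<close> to its own class.\<close>

theorem pres_eq_Nil_if_killed:
  fixes w :: "'x word"
  assumes "\<And>f :: 'x \<Rightarrow> ('x word set) bj. (\<And>r. r \<in> R \<Longrightarrow> evt f r = 0) \<Longrightarrow> evt f w = 0"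
  shows "pres_eq R w []"
proof -
  define act where "act l Q = (if \<exists>v. Q = pres_class R v then pres_class R (l # (SOME v. Q = pres_class R v)) else Q)"
    for l :: "'x \<times> bool" and Q
  have act_class: "act l (pres_class R v) = pres_class R (l # v)" for l v
  proof -
    define k where "k = (SOME u. pres_class R v = pres_class R u)"
    have "\<exists>u. pres_class R v = pres_class R u" by blast
    then have "act l (pres_class R v) = pres_class R (l # k)" by (simp only: act_def k_def if_True)
    moreover have "pres_class R v = pres_class R k" unfolding k_def by (rule someI) (rule refl)
    then have "pres_eq R ([l] @ k) ([l] @ v)"
      by (intro pres_eq_append pres_eq.pe_refl) (metis pres_class_eq_iff)
    ultimately show ?thesis by (simp add: pres_class_eq_iff)
  qed
  have act_linv: "act (linv l) (act l Q) = Q" for l Q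
  proof (cases "\<exists>v. Q = pres_class R v")
    case True
    then obtain v where v: "Q = pres_class R v" by blast
    have "pres_eq R ([] @ [(fst l, \<not> snd l), (fst l, \<not> \<not> snd l)] @ v) ([] @ v)" by (rule pres_eq.pe_cancel)
    then show ?thesis by (simp add: v act_class pres_class_eq_iff linv_def)
  qed (simp add: act_def)
  have bij: "bij (act l)" for l
    by (rule o_bij[of "act (linv l)"]; rule ext; simp only: comp_apply id_apply act_linv act_linv[of "linv l", unfolded linv_linv])
  define f where "f x = Abs_bj (act (x, True))" for x
  have f: "ap (f x) = act (x, True)" for x by (simp add: f_def ap_Abs bij)
  have fm: "ap (- f x) = act (x, False)" for x
  proof
    fix Q
    have "ap (- f x) (ap (f x) (act (x, False) Q)) = act (x, False) Q" by simp
    moreover have "ap (f x) (act (x, False) Q) = Q"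
      using act_linv[of "(x, False)" Q] by (simp add: f linv_def)
    ultimately show "ap (- f x) Q = act (x, False) Q" by simp
  qed
  have letter: "ap (if b then f x else - f x) Q = act (x, b) Q" for x b Q
    by (simp add: f fm)
  have word: "ap (evt f u) (pres_class R v) = pres_class R (u @ v)" for u v
    by (induction u) (auto simp: letter f fm act_class)
  have word': "ap (evt f u) Q = Q" if "\<nexists>v. Q = pres_class R v" for u Q
    using that by (induction u) (auto simp: f fm act_def)
  have "evt f r = 0" if "r \<in> R" for r
  proof (rule bj_eqI)
    fix Q
    show "ap (evt f r) Q = ap 0 Q"
    proof (cases "\<exists>v. Q = pres_class R v")
      case True
      then obtain v where v: "Q = pres_class R v" by blast
      have "pres_eq R ([] @ r @ v) ([] @ v)" by (rule pres_eq.pe_rel[OF that])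
      then show ?thesis by (simp add: v word pres_class_eq_iff)
    qed (simp add: word')
  qed
  then have "evt f w = 0" by (rule assms)
  then have "pres_class R w = pres_class R []" using word[of w "[]"] by simp
  then show ?thesis by (simp add: pres_class_eq_iff)
qed

lemma evt_gen: "set w \<subseteq> S \<times> UNIV \<Longrightarrow> evt \<rho> w \<in> gen (\<rho> ` S)"
  by (induction w) (auto intro: gen.intros)

lemma gen_evt: "x \<in> gen (\<rho> ` S) \<Longrightarrow> \<exists>w. set w \<subseteq> S \<times> UNIV \<and> x = evt \<rho> w"
proof (induction rule: gen.induct)
  case gen_0
  then show ?case by (intro exI[of _ "[]"]) simp
next
  case (gen_add x y)
  then obtain a w where "a \<in> S" "x = \<rho> a" "set w \<subseteq> S \<times> UNIV" "y = evt \<rho> w" by auto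
  then show ?case by (intro exI[of _ "(a, True) # w"]) simp
next
  case (gen_minus x y)
  then obtain a w where "a \<in> S" "x = \<rho> a" "set w \<subseteq> S \<times> UNIV" "y = evt \<rho> w" by auto
  then show ?case by (intro exI[of _ "(a, False) # w"]) simp
qed

lemma evt_words: "evt \<rho> ` {w. set w \<subseteq> S \<times> UNIV} = gen (\<rho> ` S)"
  using evt_gen[of _ S \<rho>] gen_evt[of _ \<rho> S] by blast

theorem pres_iso:
  assumes R: "\<And>r. r \<in> R \<Longrightarrow> evt \<rho> r = 0"
    and faithful: "\<And>w. set w \<subseteq> Gens \<times> UNIV \<Longrightarrow> evt \<rho> w = 0 \<Longrightarrow> pres_eq R w []"
  obtains \<phi> where "\<phi> \<in> iso (pres_group Gens R) (gm (gen (\<rho> ` Gens)))" "\<And>w. \<phi> (pres_class R w) = evt \<rho> w"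
proof -
  define \<phi> where "\<phi> P = evt \<rho> (SOME w. w \<in> P)" for P
  have \<phi>: "\<phi> (pres_class R w) = evt \<rho> w" for w
  proof -
    have "pres_eq R w (SOME x. x \<in> pres_class R w)"
      using someI[of "\<lambda>x. x \<in> pres_class R w", OF pres_class_self] by (simp add: pres_class_def)
    then show ?thesis using pres_eq_evt[OF _ R] by (metis \<phi>_def)
  qed
  have inj: "pres_class R u = pres_class R v" if "set u \<subseteq> Gens \<times> UNIV" "set v \<subseteq> Gens \<times> UNIV" "evt \<rho> u = evt \<rho> v" for u v
  proof -
    have "pres_eq R (u @ winv v) []"
      by (rule faithful) (use that set_winv[of v Gens] in \<open>auto simp: evt_winv\<close>)
    then have "pres_eq R ([] @ (u @ winv v) @ v) ([] @ [] @ v)" by (rule pres_eq_cong)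
    moreover have "pres_eq R (u @ (winv v @ winv (winv v)) @ []) (u @ [] @ [])"
      by (rule pres_eq_cong[OF pres_eq_winv])
    ultimately show ?thesis by (simp add: pres_class_eq_iff) (metis pres_eq.pe_sym pres_eq.pe_trans)
  qed
  have "\<phi> \<in> iso (pres_group Gens R) (gm (gen (\<rho> ` Gens)))"
  proof -
    have "\<phi> \<in> hom (pres_group Gens R) (gm (gen (\<rho> ` Gens)))"
      by (rule homI) (auto simp: pres_carrier pres_mult \<phi> evt_gen)
    moreover have "inj_on \<phi> (carrier (pres_group Gens R))"
    proof (rule inj_onI)
      fix x y assume xy: "x \<in> carrier (pres_group Gens R)" "y \<in> carrier (pres_group Gens R)" "\<phi> x = \<phi> y"
      obtain u where u: "set u \<subseteq> Gens \<times> UNIV" "x = pres_class R u" using xy(1) by (auto simp: pres_carrier)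
      obtain v where v: "set v \<subseteq> Gens \<times> UNIV" "y = pres_class R v" using xy(2) by (auto simp: pres_carrier)
      have "evt \<rho> u = evt \<rho> v" using xy(3) by (simp only: u(2) v(2) \<phi>)
      then show "x = y" unfolding u(2) v(2) by (rule inj[OF u(1) v(1)])
    qed
    moreover have "\<phi> ` carrier (pres_group Gens R) = carrier (gm (gen (\<rho> ` Gens)))"
      by (simp only: pres_carrier image_image \<phi> evt_words gm_simps)
    ultimately show ?thesis by (simp add: iso_def bij_betw_def)
  qed
  then show ?thesis using \<phi> by (rule that)
qed

text \<open>Evaluation is moved along \<open>\<Theta>\<close> to an additive group. For completeness
  of the relators it is enough to consider maps \<open>f\<close> into the one permutation group that
  \<open>pres_eq_Nil_if_killed\<close> uses.\<close>

theorem coxeter_systemI: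
  fixes M :: "'m monoid" and \<Theta> :: "'m \<Rightarrow> 'g::group_add"
  assumes M: "group M" and \<Theta>: "\<Theta> \<in> iso M (gm U)" and U: "is_subgroup U" and S: "S \<subseteq> carrier M"
    and m: "coxeter_matrix S m" and rel: "\<And>r. r \<in> coxeter_relators S m \<Longrightarrow> evt \<Theta> r = 0"
    and gen: "gen (\<Theta> ` S) = U"
    and faithful: "\<And>(f :: 'm \<Rightarrow> ('m word set) bj) w. (\<And>r. r \<in> coxeter_relators S m \<Longrightarrow> evt f r = 0) \<Longrightarrow>
      set w \<subseteq> S \<times> UNIV \<Longrightarrow> evt \<Theta> w = 0 \<Longrightarrow> evt f w = 0"
  shows "coxeter_system M S m"
proof -
  have pe: "pres_eq (coxeter_relators S m) w []" if "set w \<subseteq> S \<times> UNIV" "evt \<Theta> w = 0" for w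
    by (rule pres_eq_Nil_if_killed) (rule faithful, use that in auto)
  obtain \<phi> where \<phi>: "\<phi> \<in> iso (coxeter_pres S m) (gm U)" "\<And>w. \<phi> (pres_class (coxeter_relators S m) w) = evt \<Theta> w"
    using pres_iso[of "coxeter_relators S m" \<Theta> S, OF rel pe] unfolding gen coxeter_pres_def by metis
  have inv: "inv_into (carrier M) \<Theta> \<in> iso (gm U) M" by (rule group.iso_set_sym[OF M \<Theta>])
  have "inv_into (carrier M) \<Theta> \<circ> \<phi> \<in> iso (coxeter_pres S m) M"
    by (rule iso_set_trans[OF \<phi>(1) inv])
  moreover have "(inv_into (carrier M) \<Theta> \<circ> \<phi>) (pres_class (coxeter_relators S m) [(s, True)]) = s" if "s \<in> S" for s
    using \<Theta> that S by (auto simp: \<phi> iso_def bij_betw_def intro!: inv_into_f_f)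
  ultimately show ?thesis using M S m unfolding coxeter_system_def by blast
qed

lemma evt_pair: "evt (\<lambda>x. (f x, g x)) w = (evt f w, evt g w)"
  by (induction w) (auto simp: zero_prod_def)

text \<open>This is the universal property of the amalgam: the graphs of the two maps generate the
  graph of a common extension. A normal form of pairs has a normal form of \<open>W\<close> as first
  component, which is nonzero as soon as a syllable from the second factor occurs.\<close>

lemma (in amalg) pair_faithful:
  assumes \<alpha>: "hom_on \<alpha> A" and \<beta>: "hom_on \<beta> B" and agree: "\<And>c. c \<in> C \<Longrightarrow> \<alpha> c = \<beta> c"
    and v: "(0, v) \<in> gen ((\<lambda>a. (hh a, \<alpha> a)) ` A \<union> (\<lambda>b. (tc C b, \<beta> b)) ` B)"
  shows "v = 0"
proof -
  let ?P = "(\<lambda>a. (hh a, \<alpha> a)) ` A" and ?Q = "(\<lambda>b. (tc C b, \<beta> b)) ` B" and ?S = "(\<lambda>c. (hh c, \<alpha> c)) ` C"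
  have 1: "hom_on (\<lambda>a. (hh a, \<alpha> a)) A" using \<alpha> by (auto simp: hom_on_def hh_add)
  have 2: "hom_on (\<lambda>b. (tc C b, \<beta> b)) B" using \<beta> by (auto simp: hom_on_def tc_add)
  have SQ: "(tc C c, \<beta> c) = (hh c, \<alpha> c)" if "c \<in> C" for c using tc_C agree that by simp
  have S: "?S \<subseteq> ?P" "?S \<subseteq> ?Q" using CA CB SQ by (auto simp: image_iff) (metis SQ subsetD)
  have sub: "is_subgroup ?P" "is_subgroup ?Q" "is_subgroup ?S"
    using subgroup_hom_on_image[OF 1 sA sA] subgroup_hom_on_image[OF 2 sB sB] subgroup_hom_on_image[OF 1 sA sC CA] by auto
  have notS: "(tc C b, \<beta> b) \<in> ?S" if "b \<in> B" "b \<in> C" for b using SQ[OF that(2)] that by auto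
  have tl: "x \<in> tails ?P ?Q ?S \<Longrightarrow> fst x \<in> T" for x
  proof (induction rule: tails.induct)
    case (tails_base k a)
    then obtain b a' where k: "k = (tc C b, \<beta> b)" "b \<in> B" "a = (hh a', \<alpha> a')" "a' \<in> A" by auto
    have "tc C b \<notin> hh ` C" using notS[OF k(2)] tails_base(2) tc_hh_C[OF k(2)] unfolding k(1) by blast
    then show ?case using k by (auto intro: tails.tails_base)
  next
    case (tails_step k a x)
    then obtain b a' where k: "k = (tc C b, \<beta> b)" "b \<in> B" "a = (hh a', \<alpha> a')" "a' \<in> A" by auto
    have "tc C b \<notin> hh ` C" using notS[OF k(2)] tails_step(2) tc_hh_C[OF k(2)] unfolding k(1) by blast
    moreover have "hh a' \<notin> hh ` C" using tails_step(4) unfolding k(3) by auto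
    ultimately show ?case using k tails_step.IH by (auto intro!: tails.tails_step)
  qed
  from normal_form[OF sub(1,2,3) S v] show ?thesis
  proof (elim disjE bexE)
    assume "(0, v) \<in> ?P"
    then obtain a where a: "hh a = 0" "v = \<alpha> a" by auto
    then have "a = 0" by (metis hh_0 hh_inj)
    then show ?thesis using hom_on_0[OF \<alpha> sA] a by simp
  next
    fix a x assume a: "a \<in> ?P" and x: "x \<in> tails ?P ?Q ?S" and e: "(0, v) = a + x"
    obtain a' where "fst a = hh a'" using a by auto
    then have "0 = hh a' + fst x" using e by (metis fst_add fst_conv)
    moreover have "wd (hh a' + fst x) \<noteq> []" using wd_hh_T[OF tl[OF x], of a'] by auto
    ultimately show ?thesis by (metis wd_0)
  qed
qed

lemma hom_on_gen_eq:
  assumes "hom_on \<alpha> (gen S)" "hom_on \<beta> (gen S)" "\<And>x. x \<in> S \<Longrightarrow> \<alpha> x = \<beta> x" "x \<in> gen S"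
  shows "\<alpha> x = \<beta> x"
  using assms(4)
proof (induction rule: gen.induct)
  case gen_0
  then show ?case using hom_on_0[OF assms(1)] hom_on_0[OF assms(2)] by simp
next
  case (gen_add x y)
  then show ?case using hom_onD[OF assms(1)] hom_onD[OF assms(2)] assms(3) gen_base by metis
next
  case (gen_minus x y)
  have x: "x \<in> gen S" "- x \<in> gen S" using gen_minus gen_base gen_uminus by blast+
  have "\<alpha> (- x) = \<beta> (- x)"
    using hom_on_uminus[OF assms(1) _ x(1)] hom_on_uminus[OF assms(2) _ x(1)] assms(3) gen_minus by simp
  then show ?case using gen_minus hom_onD[OF assms(1) x(2)] hom_onD[OF assms(2) x(2)] by metis
qed

section \<open>Copies of finite groups on natural numbers, and their amalgams\<close>

locale encoding =
  fixes e :: "'h::group_add \<Rightarrow> nat" and V :: "'h set"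
  assumes e: "inj_on e V"
begin

definition d :: "nat \<Rightarrow> 'h" where "d = inv_into V e"

definition natg :: "'h set \<Rightarrow> nat monoid" where
  "natg U = \<lparr>carrier = e ` U, monoid.mult = (\<lambda>x y. e (d x + d y)), one = e 0\<rparr>"

lemma natg_simps [simp]: "carrier (natg U) = e ` U" "x \<otimes>\<^bsub>natg U\<^esub> y = e (d x + d y)" "\<one>\<^bsub>natg U\<^esub> = e 0"
  by (simp_all add: natg_def)

lemma d_e [simp]: "x \<in> V \<Longrightarrow> d (e x) = x"
  by (simp add: d_def e inv_into_f_f)

lemma d_iso: 
  assumes "is_subgroup U" "U \<subseteq> V"
  shows "d \<in> iso (natg U) (gm U)"
proof -
  have "d (e x) = x" if "x \<in> U" for x using that assms by auto
  moreover have "d (e (x + y)) = x + y" if "x \<in> U" "y \<in> U" for x y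
    using that assms subgroupD(2)[OF assms(1)] by (intro d_e) blast
  ultimately show ?thesis by (auto simp: iso_def hom_def bij_betw_def inj_on_def image_image)
qed

lemma group_natg:
  assumes U: "is_subgroup U" "U \<subseteq> V"
  shows "group (natg U)"
proof (rule groupI)
  have d: "d (e x) = x" if "x \<in> U" for x using that U by auto
  note s = subgroupD[OF U(1)]
  fix x assume x: "x \<in> carrier (natg U)"
  then obtain a where a: "a \<in> U" "x = e a" by auto
  then show "\<exists>y\<in>carrier (natg U). y \<otimes>\<^bsub>natg U\<^esub> x = \<one>\<^bsub>natg U\<^esub>"
    using d s by (intro bexI[of _ "e (- a)"]) auto
  show "\<one>\<^bsub>natg U\<^esub> \<otimes>\<^bsub>natg U\<^esub> x = x" using a d s(1) by simp
  fix y assume "y \<in> carrier (natg U)"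
  then obtain b where b: "b \<in> U" "y = e b" by auto
  show "x \<otimes>\<^bsub>natg U\<^esub> y \<in> carrier (natg U)" using a b d s by auto
  fix z assume "z \<in> carrier (natg U)"
  then obtain c where "c \<in> U" "z = e c" by auto
  then show "x \<otimes>\<^bsub>natg U\<^esub> y \<otimes>\<^bsub>natg U\<^esub> z = x \<otimes>\<^bsub>natg U\<^esub> (y \<otimes>\<^bsub>natg U\<^esub> z)"
    using a b d s by (simp add: add.assoc)
qed (use subgroupD[OF U(1)] in auto)

end

locale amalg_encoding = amalg A B C + encoding e V for A B C :: "'h::group_add set" and e and V :: "'h set" +
  assumes AV: "A \<subseteq> V" and BV: "B \<subseteq> V"
begin

definition AM :: "((nat + nat) word set) monoid" where
  "AM = amalgam (natg A) (natg C) (natg B) (\<lambda>x. x) (\<lambda>x. x)"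

lemma group_AM: "group AM"
  unfolding AM_def amalgam_def by (rule group_pres_group)

lemma dA: "a \<in> A \<Longrightarrow> d (e a) = a" and dB: "b \<in> B \<Longrightarrow> d (e b) = b"
  using AV BV by auto

text \<open>A map that kills the relators of the amalgam is a pair of homomorphisms on the factors
  that agree on \<open>C\<close>, so completeness of the relators is
  \<open>pair_faithful\<close>.\<close>

theorem AM_iso: "\<exists>\<Theta>. \<Theta> \<in> iso AM (gm W)"
proof -
  define Gens where "Gens = e ` A <+> e ` B"
  define R :: "(nat + nat) word set" where "R = {[(Inl a, True), (Inl a', True), (Inl (e (d a + d a')), False)] | a a'. a \<in> e ` A \<and> a' \<in> e ` A}
      \<union> {[(Inr b, True), (Inr b', True), (Inr (e (d b + d b')), False)] | b b'. b \<in> e ` B \<and> b' \<in> e ` B}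
      \<union> {[(Inl c, True), (Inr c, False)] | c. c \<in> e ` C}"
  have AM: "AM = pres_group Gens R" by (simp add: AM_def amalgam_def Gens_def R_def)
  define \<rho> :: "nat + nat \<Rightarrow> 'h gg" where "\<rho> = case_sum (\<lambda>x. hh (d x)) (\<lambda>y. tc C (d y))"
  have \<rho>: "\<rho> (Inl (e a)) = hh a" "\<rho> (Inr (e b)) = tc C b" if "a \<in> A" "b \<in> B" for a b
    using that dA dB by (simp_all add: \<rho>_def)
  have \<rho>G: "\<rho> ` Gens = hh ` A \<union> tc C ` B"
    unfolding Gens_def using dA dB by (force simp: \<rho>_def image_iff)
  have rel: "evt \<rho> r = 0" if "r \<in> R" for r
    using that unfolding R_def
  proof (elim UnE CollectE exE conjE)
    fix a a' assume "r = [(Inl a, True), (Inl a', True), (Inl (e (d a + d a')), False)]" "a \<in> e ` A" "a' \<in> e ` A"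
    then show ?thesis using subgroupD(2)[OF sA] by (auto simp: \<rho>_def dA hh_add grp simp del: add_uminus_conv_diff)
  next
    fix a a' assume "r = [(Inr a, True), (Inr a', True), (Inr (e (d a + d a')), False)]" "a \<in> e ` B" "a' \<in> e ` B"
    then show ?thesis using subgroupD(2)[OF sB] by (auto simp: \<rho>_def dB tc_add[symmetric] grp simp del: add_uminus_conv_diff)
  next
    fix c assume "r = [(Inl c, True), (Inr c, False)]" "c \<in> e ` C"
    then show ?thesis using CA tc_C dA by (auto simp: \<rho>_def)
  qed
  have faithful: "pres_eq R w []" if w: "set w \<subseteq> Gens \<times> UNIV" "evt \<rho> w = 0" for w
  proof (rule pres_eq_Nil_if_killed)
    fix f :: "nat + nat \<Rightarrow> ((nat + nat) word set) bj" assume f: "\<And>r. r \<in> R \<Longrightarrow> evt f r = 0"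
    define \<alpha> where "\<alpha> a = f (Inl (e a))" for a
    define \<beta> where "\<beta> b = f (Inr (e b))" for b
    have eq: "x + y = z" if "x + (y + - z) = 0" for x y z :: "((nat + nat) word set) bj"
    proof -
      have "x + (y + - z) + z = 0 + z" using that by simp
      then show ?thesis by (simp only: grps)
    qed
    have \<alpha>: "hom_on \<alpha> A"
      unfolding hom_on_def
    proof (intro ballI)
      fix a a' assume a: "a \<in> A" "a' \<in> A"
      then have "[(Inl (e a), True), (Inl (e a'), True), (Inl (e (d (e a) + d (e a'))), False)] \<in> R"
        unfolding R_def by blast
      from f[OF this] have "\<alpha> a + (\<alpha> a' + - \<alpha> (a + a')) = 0" using a by (simp add: \<alpha>_def dA)
      then show "\<alpha> (a + a') = \<alpha> a + \<alpha> a'" using eq by metis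
    qed
    have \<beta>: "hom_on \<beta> B"
      unfolding hom_on_def
    proof (intro ballI)
      fix a a' assume a: "a \<in> B" "a' \<in> B"
      then have "[(Inr (e a), True), (Inr (e a'), True), (Inr (e (d (e a) + d (e a'))), False)] \<in> R"
        unfolding R_def by blast
      from f[OF this] have "\<beta> a + (\<beta> a' + - \<beta> (a + a')) = 0" using a by (simp add: \<beta>_def dB)
      then show "\<beta> (a + a') = \<beta> a + \<beta> a'" using eq by metis
    qed
    have agree: "\<alpha> c = \<beta> c" if "c \<in> C" for c
    proof -
      have "[(Inl (e c), True), (Inr (e c), False)] \<in> R" unfolding R_def using that by blast
      from f[OF this] show ?thesis by (simp add: \<alpha>_def \<beta>_def)
    qed
    have "evt (\<lambda>x. (\<rho> x, f x)) w \<in> gen ((\<lambda>x. (\<rho> x, f x)) ` Gens)" by (rule evt_gen[OF w(1)])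
    also have "(\<lambda>x. (\<rho> x, f x)) ` Gens = (\<lambda>a. (hh a, \<alpha> a)) ` A \<union> (\<lambda>b. (tc C b, \<beta> b)) ` B"
      unfolding Gens_def Plus_def image_Un image_image
      by (intro arg_cong2[where f = "(\<union>)"] image_cong refl) (simp_all add: \<rho>_def \<alpha>_def \<beta>_def dA dB)
    finally have "(0, evt f w) \<in> gen ((\<lambda>a. (hh a, \<alpha> a)) ` A \<union> (\<lambda>b. (tc C b, \<beta> b)) ` B)"
      by (simp add: evt_pair w(2))
    then show "evt f w = 0" using pair_faithful[OF \<alpha> \<beta> agree] by blast
  qed
  obtain \<phi> where "\<phi> \<in> iso (pres_group Gens R) (gm (gen (\<rho> ` Gens)))"
    using pres_iso[OF rel faithful] by metis
  then show ?thesis unfolding AM \<rho>G WW_def by blast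
qed

end

subsection \<open>Standard parabolic subgroups of symmetric groups\<close>

definition pw :: "nat \<Rightarrow> 'g::group_add \<Rightarrow> 'g" where "pw n x = ((+) x ^^ n) 0"

lemma pw_simps [simp]: "pw 0 x = 0" "pw (Suc n) x = x + pw n x"
  by (simp_all add: pw_def)

lemma evt_power: "evt f (concat (replicate k [(x, True), (y, True)])) = pw k (f x + f y)"
  by (induction k) (auto simp: add.assoc)

lemma pw_hom: "(\<And>x y. f (x + y) = f x + f y) \<Longrightarrow> f (pw n x) = pw n (f x)"
  using hom_0[of f] by (induction n) simp_all

text \<open>The Coxeter matrix of type A.\<close>

definition lab :: "nat \<Rightarrow> nat \<Rightarrow> nat" where
  "lab k l = (if k = l then 1 else if k = Suc l \<or> l = Suc k then 3 else 2)"

lemma lab_sym: "lab k l = lab l k" by (auto simp: lab_def)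

definition braid :: "nat set \<Rightarrow> (nat \<Rightarrow> 'g::group_add) \<Rightarrow> bool" where
  "braid J g \<longleftrightarrow> (\<forall>k\<in>J. \<forall>l\<in>J. pw (lab k l) (g k + g l) = 0)"

locale braided =
  fixes J :: "nat set" and g :: "nat \<Rightarrow> 'g::group_add"
  assumes braid: "braid J g"
begin

lemma sq: "k \<in> J \<Longrightarrow> g k + g k = 0"
  using braid by (force simp: braid_def lab_def)

lemma neg: "k \<in> J \<Longrightarrow> - g k = g k"
  using sq by (metis add.inverse_unique)

lemma sq': "k \<in> J \<Longrightarrow> g k + (g k + x) = x"
  by (metis sq add.assoc add_0)

lemma comm:
  assumes "k \<in> J" "l \<in> J" "k \<noteq> l" "k \<noteq> Suc l" "l \<noteq> Suc k"
  shows "g k + g l = g l + g k"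
proof -
  have "pw (lab k l) (g k + g l) = 0" using braid assms by (simp add: braid_def)
  moreover have "lab k l = Suc (Suc 0)" using assms by (simp add: lab_def)
  ultimately have "g k + g l + (g k + g l) = 0" by simp
  then have "g k + g l = - (g k + g l)" by (metis add.inverse_unique minus_minus)
  then show ?thesis using neg assms by (simp only: minus_add)
qed

lemma brd:
  assumes "k \<in> J" "Suc k \<in> J"
  shows "g (Suc k) + g k + g (Suc k) = g k + g (Suc k) + g k"
proof -
  have "pw (lab k (Suc k)) (g k + g (Suc k)) = 0" using braid assms by (simp add: braid_def)
  moreover have "lab k (Suc k) = Suc (Suc (Suc 0))" by (simp add: lab_def)
  ultimately have "(g k + g (Suc k) + g k) + (g (Suc k) + g k + g (Suc k)) = 0" by (simp add: add.assoc)
  then have "g (Suc k) + g k + g (Suc k) = - (g k + g (Suc k) + g k)" by (metis add.inverse_unique)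
  then show ?thesis using neg assms by (simp only: minus_add add.assoc)
qed

text \<open>The sum \<open>g (n - l + 1) + ... + g n\<close>. For the transpositions it takes the
  point \<open>n + 1\<close> down to \<open>n + 1 - l\<close>; these sums are the coset
  representatives of \<open>Hn n\<close> in \<open>Hn (Suc n)\<close>.\<close>

fun rl :: "nat \<Rightarrow> nat \<Rightarrow> 'g" where
  "rl n 0 = 0"
| "rl n (Suc l) = g (n - l) + rl n l"

definition Hn :: "nat \<Rightarrow> 'g set" where "Hn n = gen (g ` {k \<in> J. k < n})"

lemma rl_comm:
  assumes "i \<in> J" "\<And>k. k < l \<Longrightarrow> n - k \<in> J" "l \<le> Suc n" "Suc i < Suc n - l"
  shows "g i + rl n l = rl n l + g i"
  using assms(2-4)
proof (induction l)
  case (Suc l)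
  have c: "g i + g (n - l) = g (n - l) + g i"
    using Suc.prems assms(1) by (intro comm) auto
  have "g i + rl n (Suc l) = (g i + g (n - l)) + rl n l" by (simp add: add.assoc)
  also have "\<dots> = g (n - l) + (g i + rl n l)" by (simp add: c add.assoc)
  also have "g i + rl n l = rl n l + g i" using Suc.prems by (intro Suc.IH) auto
  finally show ?case by (simp add: add.assoc)
qed simp

text \<open>\<open>g i\<close> commutes with the factors of smaller index until it meets
  \<open>g (i - 1)\<close> followed by \<open>g i\<close>. The braid relation turns it into
  \<open>g (i - 1)\<close>, which commutes with the remaining factors.\<close>

lemma rl_braid:
  assumes "i \<in> J" "i \<le> n" "\<And>k. k < l \<Longrightarrow> n - k \<in> J" "l \<le> Suc n" "i + l > Suc n"
  shows "g i + rl n l = rl n l + g (i - 1)"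
  using assms(3-5)
proof (induction l)
  case (Suc l)
  show ?case
  proof (cases "i + l > Suc n")
    case True
    have c: "g i + g (n - l) = g (n - l) + g i"
      using Suc.prems assms(1,2) True by (intro comm) auto
    have "g i + rl n (Suc l) = (g i + g (n - l)) + rl n l" by (simp add: add.assoc)
    also have "\<dots> = g (n - l) + (g i + rl n l)" by (simp add: c add.assoc)
    also have "g i + rl n l = rl n l + g (i - 1)" using Suc.prems True by (intro Suc.IH) auto
    finally show ?thesis by (simp add: add.assoc)
  next
    case False
    then have il: "i + l = Suc n" using Suc.prems by simp
    then obtain l' where l': "l = Suc l'" using assms(2) by (cases l) auto
    obtain i' where i': "i = Suc i'" using il Suc.prems by (cases i) auto
    have n: "n - l = i'" "n - l' = i" using il i' l' by auto
    have J: "i \<in> J" "i' \<in> J" using assms(1) Suc.prems(1)[of l] n by auto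
    have rc: "g i' + rl n l' = rl n l' + g i'"
      using Suc.prems J il i' l' by (intro rl_comm) auto
    have "g i + rl n (Suc l) = (g i + g i' + g i) + rl n l'" by (simp add: l' n(2) n(1)[unfolded l'] add.assoc)
    also have "\<dots> = (g i' + g i + g i') + rl n l'" using brd[of i'] J by (simp add: i')
    also have "\<dots> = g i' + g i + (rl n l' + g i')" by (simp only: add.assoc rc)
    also have "\<dots> = rl n (Suc l) + g (i - 1)" using n by (simp add: l' i' add.assoc)
    finally show ?thesis .
  qed
qed (use assms in simp)

text \<open>Depending on its position, the new factor passes through unchanged, lengthens the
  representative, cancels its first factor, or passes through with its index lowered by one.\<close>

lemma rl_mult:
  assumes i: "i \<in> J" "i \<le> n" and l: "\<And>k. k < l \<Longrightarrow> n - k \<in> J" "l \<le> Suc n" and y: "y \<in> Hn n"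
  shows "\<exists>l'\<le>Suc n. (\<forall>k<l'. n - k \<in> J) \<and> (\<exists>y'\<in>Hn n. g i + (rl n l + y) = rl n l' + y')"
proof -
  have gH: "g j + y \<in> Hn n" if "j \<in> J" "j < n" for j
    using that y unfolding Hn_def by (intro gen.gen_add) auto
  consider "i + l < n" | "i + l = n" | "i + l = Suc n" | "i + l > Suc n" by linarith
  then show ?thesis
  proof cases
    case 1
    then have "g i + rl n l = rl n l + g i" using i l by (intro rl_comm) auto
    then have "g i + (rl n l + y) = rl n l + (g i + y)" by (metis add.assoc)
    then show ?thesis using l gH[of i] i 1 by (intro exI[of _ l]) auto
  next
    case 2
    then have "g i + (rl n l + y) = rl n (Suc l) + y" by (simp add: add.assoc) (metis add_diff_cancel_right')
    moreover have "\<forall>k<Suc l. n - k \<in> J" using l i 2 by (auto simp: less_Suc_eq)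
    ultimately show ?thesis using y 2 by (intro exI[of _ "Suc l"]) auto
  next
    case 3
    then obtain l' where l': "l = Suc l'" using i by (cases l) auto
    then have "n - l' = i" using 3 by simp
    then have "g i + (rl n l + y) = rl n l' + y" using sq'[OF i(1)] by (simp add: l' add.assoc)
    then show ?thesis using y l l' by (intro exI[of _ l']) auto
  next
    case 4
    have e: "g i + rl n l = rl n l + g (i - 1)" using i l 4 by (intro rl_braid) auto
    have "n - (n - (i - 1)) = i - 1" "n - (i - 1) < l" using i l 4 by auto
    then have "i - 1 \<in> J" using l(1)[of "n - (i - 1)"] by simp
    moreover have "i - 1 < n" using i l 4 by auto
    ultimately have "g (i - 1) + y \<in> Hn n" by (rule gH)
    moreover have "g i + (rl n l + y) = rl n l + (g (i - 1) + y)" using e by (metis add.assoc)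
    ultimately show ?thesis using l by (intro exI[of _ l]) auto
  qed
qed

lemma Hn_Suc:
  assumes "x \<in> Hn (Suc n)"
  shows "\<exists>l\<le>Suc n. (\<forall>k<l. n - k \<in> J) \<and> (\<exists>y\<in>Hn n. x = rl n l + y)"
  using assms unfolding Hn_def[of "Suc n"]
proof (induction rule: gen.induct)
  case gen_0
  then show ?case using gen.gen_0 by (intro exI[of _ 0]) (force simp: Hn_def)
next
  case (gen_add x y)
  then obtain i where i: "i \<in> J" "i \<le> n" "x = g i" by auto
  from gen_add.IH obtain l z where "l \<le> Suc n" "\<forall>k<l. n - k \<in> J" "z \<in> Hn n" "y = rl n l + z" by blast
  then show ?case using rl_mult[OF i(1,2), of l z] i by auto
next
  case (gen_minus x y)
  then obtain i where i: "i \<in> J" "i \<le> n" "- x = g i" using neg by auto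
  from gen_minus.IH obtain l z where "l \<le> Suc n" "\<forall>k<l. n - k \<in> J" "z \<in> Hn n" "y = rl n l + z" by blast
  then show ?case using rl_mult[OF i(1,2), of l z] i by auto
qed

lemma finite_Hn: "finite (Hn n)"
proof (induction n)
  case 0
  have "gen {} \<subseteq> {0 :: 'g}" by (rule gen_least) (auto simp: is_subgroup_def)
  then show ?case by (auto simp: Hn_def intro: finite_subset)
next
  case (Suc n)
  have "Hn (Suc n) \<subseteq> (\<lambda>(l, y). rl n l + y) ` ({..Suc n} \<times> Hn n)"
    using Hn_Suc[of _ n] by fastforce
  then show ?case using Suc finite_subset by blast
qed

end

definition sk :: "nat \<Rightarrow> nat bj" where
  "sk k = Abs_bj (\<lambda>x. if x = k then Suc k else if x = Suc k then k else x)"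

lemma ap_sk [simp]: "ap (sk k) x = (if x = k then Suc k else if x = Suc k then k else x)"
proof -
  have "bij (\<lambda>x. if x = k then Suc k else if x = Suc k then k else x)"
    by (rule o_bij[where g = "\<lambda>x. if x = k then Suc k else if x = Suc k then k else x"]) auto
  then show ?thesis by (simp add: sk_def ap_Abs)
qed

lemma sk_inj [simp]: "sk k = sk l \<longleftrightarrow> k = l"
proof
  assume "sk k = sk l"
  then have "ap (sk k) k = ap (sk l) k" "ap (sk k) l = ap (sk l) l" by simp_all
  then show "k = l" by (auto split: if_splits)
qed simp

lemma pw_sk_adjacent: "pw 3 (sk k + sk (Suc k)) = 0" "pw 3 (sk (Suc k) + sk k) = 0"
proof -
  have "ap (pw 3 (sk k + sk (Suc k))) x = ap 0 x \<and> ap (pw 3 (sk (Suc k) + sk k)) x = ap 0 x" for x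
  proof -
    consider "x = k" | "x = Suc k" | "x = Suc (Suc k)" | "x \<noteq> k" "x \<noteq> Suc k" "x \<noteq> Suc (Suc k)" by blast
    then show ?thesis by cases (simp_all add: numeral_3_eq_3)
  qed
  then show "pw 3 (sk k + sk (Suc k)) = 0" "pw 3 (sk (Suc k) + sk k) = 0"
    by (auto intro: bj_eqI)
qed

lemma pw_sk_far:
  assumes "k \<noteq> l" "k \<noteq> Suc l" "l \<noteq> Suc k"
  shows "pw 2 (sk k + sk l) = 0"
proof (rule bj_eqI)
  fix x
  consider "x = k" | "x = Suc k" | "x = l" | "x = Suc l" | "x \<noteq> k" "x \<noteq> Suc k" "x \<noteq> l" "x \<noteq> Suc l" by blast
  then show "ap (pw 2 (sk k + sk l)) x = ap 0 x"
    by cases (use assms in \<open>simp_all add: numeral_2_eq_2\<close>)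
qed

lemma braid_sk: "braid J sk"
  unfolding braid_def
proof (intro ballI)
  fix k l
  have "pw 1 (sk k + sk k) = 0" by (rule bj_eqI) simp
  then show "pw (lab k l) (sk k + sk l) = 0"
    using pw_sk_adjacent[of k] pw_sk_adjacent[of l] pw_sk_far[of k l] by (auto simp: lab_def)
qed

text \<open>The pairs satisfy the braid relations, so they have the same normal forms as the
  permutations. If the permutation is trivial it fixes \<open>n + 1\<close>, which forces the
  representative \<open>rl n l\<close> to have \<open>l = 0\<close>; thus the element descends from
  \<open>Hn (Suc n)\<close> to \<open>Hn n\<close> and finally to 0.\<close>

theorem parabolic_faithful:
  fixes f :: "nat \<Rightarrow> 'g::group_add"
  assumes f: "braid J f" and J: "J \<subseteq> {..<N}" and v: "(0, v) \<in> gen ((\<lambda>k. (sk k, f k)) ` J)"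
  shows "v = 0"
proof -
  have pw_pair: "pw n (x, y) = (pw n x, pw n y)" for n and x :: "nat bj" and y :: 'g
    by (induction n) (auto simp: zero_prod_def)
  interpret braided J "\<lambda>k. (sk k, f k)"
    using f braid_sk[of J] by unfold_locales (auto simp: braid_def pw_pair zero_prod_def)
  have fixn: "ap (fst y) x = x" if "y \<in> Hn n" "x > n" for y n x
    using that(1) unfolding Hn_def
  proof (induction rule: gen.induct)
    case (gen_add y z)
    then show ?case using that(2) by auto
  next
    case (gen_minus y z)
    then obtain k where k: "k \<in> J" "k < n" "- y = (sk k, f k)" using neg by auto
    then have "fst (- y + z) = sk k + fst z" by simp
    then show ?case using gen_minus that(2) k by auto
  qed simp
  have rl: "ap (fst (rl n l)) (Suc n) = Suc n - l" if "l \<le> Suc n" for n l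
    using that
  proof (induction l)
    case (Suc l)
    then show ?case by auto
  qed simp
  have "x = 0" if "x \<in> Hn n" "fst x = 0" for x n
    using that
  proof (induction n arbitrary: x)
    case 0
    have "gen {} \<subseteq> {0 :: nat bj \<times> 'g}" by (rule gen_least) (auto simp: is_subgroup_def)
    then show ?case using 0 by (auto simp: Hn_def)
  next
    case (Suc n)
    from Hn_Suc[OF Suc.prems(1)] obtain l y where l: "l \<le> Suc n" "y \<in> Hn n" "x = rl n l + y" by blast
    have "ap (fst x) (Suc n) = ap (fst (rl n l)) (ap (fst y) (Suc n))" by (simp add: l)
    also have "\<dots> = Suc n - l" using fixn[OF l(2)] rl[OF l(1)] by simp
    finally have "l = 0" using Suc.prems(2) l(1) by simp
    then show ?case using Suc l by simp
  qed
  moreover have "(0, v) \<in> Hn N" using v J unfolding Hn_def by (auto intro!: arg_cong[where f = gen] elim!: back_subst[where P = "\<lambda>S. _ \<in> gen S"])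
  ultimately show ?thesis by (metis fst_conv snd_conv snd_zero)
qed

lemma parabolic_finite: "J \<subseteq> {..<N} \<Longrightarrow> finite (gen (sk ` J))"
proof -
  assume J: "J \<subseteq> {..<N}"
  interpret braided J sk by unfold_locales (rule braid_sk)
  have "{k \<in> J. k < N} = J" using J by auto
  then show ?thesis using finite_Hn[of N] by (simp add: Hn_def)
qed

text \<open>By \<open>parabolic_faithful\<close> the subgroup generated by the pairs is the graph of
  a function.\<close>

lemma parabolic_extend:
  fixes f :: "nat \<Rightarrow> 'g::group_add"
  assumes f: "braid J f" and J: "J \<subseteq> {..<N}"
  shows "\<exists>\<alpha>. hom_on \<alpha> (gen (sk ` J)) \<and> (\<forall>k\<in>J. \<alpha> (sk k) = f k)"
proof -
  let ?G = "gen ((\<lambda>k. (sk k, f k)) ` J)"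
  note G = subgroupD[OF subgroup_gen[of "(\<lambda>k. (sk k, f k)) ` J"]]
  have uniq: "v = v'" if "(a, v) \<in> ?G" "(a, v') \<in> ?G" for a v v'
  proof -
    have "(a, v) + - (a, v') \<in> ?G" using that by (intro G)
    then have "(0, v + - v') \<in> ?G" by (simp add: zero_prod_def)
    then have "v + - v' = 0" by (rule parabolic_faithful[OF f J])
    then show ?thesis by simp
  qed
  have ex: "\<exists>v. (a, v) \<in> ?G" if "a \<in> gen (sk ` J)" for a
    using that
  proof (induction rule: gen.induct)
    case gen_0
    then show ?case using G(1) by (auto simp: zero_prod_def)
  next
    case (gen_add x y)
    then obtain k v where "k \<in> J" "x = sk k" "(y, v) \<in> ?G" by auto
    moreover from this have "(sk k, f k) \<in> ?G" by (intro gen_base) simp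
    ultimately have "(sk k, f k) + (y, v) \<in> ?G" by (intro G(2))
    then show ?case using \<open>x = sk k\<close> by auto
  next
    case (gen_minus x y)
    then obtain k v where "k \<in> J" "x = sk k" "(y, v) \<in> ?G" by auto
    moreover from this have "(sk k, f k) \<in> ?G" by (intro gen_base) simp
    ultimately have "- (sk k, f k) + (y, v) \<in> ?G" by (intro G(2,3))
    then show ?case using \<open>x = sk k\<close> by auto
  qed
  define \<alpha> where "\<alpha> a = (SOME v. (a, v) \<in> ?G)" for a
  have \<alpha>: "(a, \<alpha> a) \<in> ?G" if "a \<in> gen (sk ` J)" for a
    unfolding \<alpha>_def using someI_ex[OF ex[OF that]] .
  have "hom_on \<alpha> (gen (sk ` J))"
    unfolding hom_on_def
  proof (intro ballI)
    fix x y assume xy: "x \<in> gen (sk ` J)" "y \<in> gen (sk ` J)"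
    have "(x + y, \<alpha> x + \<alpha> y) \<in> ?G" using G(2)[OF \<alpha>[OF xy(1)] \<alpha>[OF xy(2)]] by simp
    then show "\<alpha> (x + y) = \<alpha> x + \<alpha> y" using uniq \<alpha>[OF gen_plus[OF xy]] by blast
  qed
  moreover have "\<alpha> (sk k) = f k" if "k \<in> J" for k
  proof (rule uniq)
    show "(sk k, \<alpha> (sk k)) \<in> ?G" using that by (intro \<alpha> gen_base) auto
    show "(sk k, f k) \<in> ?G" using that by (intro gen_base) auto
  qed
  ultimately show ?thesis by blast
qed

section \<open>Coxeter systems for the parabolic subgroups and their amalgams\<close>

definition ki :: "nat bj \<Rightarrow> nat" where "ki = inv_into UNIV sk"

lemma ki_sk [simp]: "ki (sk k) = k"
  unfolding ki_def by (rule inv_into_f_f) (auto simp: inj_on_def)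

lemma lab_1: "lab k l = 1 \<longleftrightarrow> k = l" and lab_pos: "lab k l \<ge> 1"
  by (auto simp: lab_def)

lemma coxeter_relatorsE:
  assumes "r \<in> coxeter_relators S m"
  obtains x y n where "x \<in> S" "y \<in> S" "m x y = enat n" "r = concat (replicate n [(x, True), (y, True)])"
  using assms unfolding coxeter_relators_def by blast

lemma coxeter_relatorsI:
  "x \<in> S \<Longrightarrow> y \<in> S \<Longrightarrow> m x y = enat n \<Longrightarrow>
    concat (replicate n [(x, True), (y, True)]) \<in> coxeter_relators S m"
  unfolding coxeter_relators_def by blast

locale bj_encoding = encoding e V for e :: "nat bj \<Rightarrow> nat" and V
begin

lemma coxeter_natg:
  assumes J: "J \<subseteq> {..<N}" and V: "gen (sk ` J) \<subseteq> V"
  shows "coxeter_system (natg (gen (sk ` J))) (e ` sk ` J) (\<lambda>x y. enat (lab (ki (d x)) (ki (d y))))"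
proof (rule coxeter_systemI[OF group_natg d_iso])
  let ?S = "e ` sk ` J" and ?m = "\<lambda>x y. enat (lab (ki (d x)) (ki (d y)))"
  have d: "d (e (sk k)) = sk k" if "k \<in> J" for k
    using that V gen_base[of "sk k" "sk ` J"] by (intro d_e) auto
  show "is_subgroup (gen (sk ` J))" "is_subgroup (gen (sk ` J))" "is_subgroup (gen (sk ` J))" by simp_all
  show "gen (sk ` J) \<subseteq> V" "gen (sk ` J) \<subseteq> V" by (rule V)+
  show "?S \<subseteq> carrier (natg (gen (sk ` J)))" by (auto intro: gen_base)
  show "coxeter_matrix ?S ?m"
    unfolding coxeter_matrix_def
  proof (intro ballI)
    fix x y assume "x \<in> ?S" "y \<in> ?S"
    then obtain k l where kl: "k \<in> J" "l \<in> J" "x = e (sk k)" "y = e (sk l)" by auto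
    then have dx: "d x = sk k" "d y = sk l" by (simp_all add: d)
    have m: "?m x y = enat (lab k l)" "?m y x = enat (lab k l)" by (simp_all only: dx ki_sk lab_sym[of l k])
    have "x = y \<longleftrightarrow> k = l" using kl dx by (metis sk_inj)
    then show "?m x y = ?m y x \<and> 1 \<le> ?m x y \<and> (?m x y = 1) = (x = y)"
      unfolding m using lab_1[of k l] lab_pos[of k l] by (simp add: one_enat_def)
  qed
  show "evt d r = 0" if r: "r \<in> coxeter_relators ?S ?m" for r
  proof -
    obtain x y n where xy: "x \<in> ?S" "y \<in> ?S" "?m x y = enat n" "r = concat (replicate n [(x, True), (y, True)])"
      using r by (rule coxeter_relatorsE)
    from xy(1,2) obtain k l where kl: "k \<in> J" "l \<in> J" "x = e (sk k)" "y = e (sk l)" by blast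
    then have dx: "d x = sk k" "d y = sk l" by (simp_all add: d)
    then have "n = lab k l" using xy(3) by simp
    moreover have "pw (lab k l) (sk k + sk l) = 0" using kl(1,2) braid_sk[of J] by (simp add: braid_def)
    ultimately show ?thesis unfolding xy(4) evt_power dx by simp
  qed
  have dS: "d ` ?S = sk ` J" using d by (force simp: image_iff)
  then show "gen (d ` ?S) = gen (sk ` J)" by simp
  fix f :: "nat \<Rightarrow> (nat word set) bj" and w
  assume f: "\<And>r. r \<in> coxeter_relators ?S ?m \<Longrightarrow> evt f r = 0" and w: "set w \<subseteq> ?S \<times> UNIV" "evt d w = 0"
  define F where "F k = f (e (sk k))" for k
  have F: "braid J F"
    unfolding braid_def
  proof (intro ballI)
    fix k l assume kl: "k \<in> J" "l \<in> J"
    have "concat (replicate (lab k l) [(e (sk k), True), (e (sk l), True)]) \<in> coxeter_relators ?S ?m"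
      by (rule coxeter_relatorsI) (use kl in \<open>simp_all add: d\<close>)
    from f[OF this] show "pw (lab k l) (F k + F l) = 0" by (simp add: evt_power F_def)
  qed
  have "evt (\<lambda>x. (d x, f x)) w \<in> gen ((\<lambda>x. (d x, f x)) ` ?S)" by (rule evt_gen[OF w(1)])
  also have "(\<lambda>x. (d x, f x)) ` ?S = (\<lambda>k. (sk k, F k)) ` J"
    unfolding image_image by (rule image_cong) (simp_all add: d F_def)
  finally have "(0, evt f w) \<in> gen ((\<lambda>k. (sk k, F k)) ` J)" by (simp add: evt_pair w(2))
  then show "evt f w = 0" by (rule parabolic_faithful[OF F J])
qed

lemma finite_coxeter_natg:
  assumes J: "J \<subseteq> {..<N}" and V: "gen (sk ` J) \<subseteq> V"
  shows "finite_coxeter_group (natg (gen (sk ` J)))"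
  using coxeter_natg[OF assms] parabolic_finite[OF J]
  by (auto simp: finite_coxeter_group_def is_coxeter_group_def)

lemma generate_natg:
  assumes U: "is_subgroup U" "U \<subseteq> V" and S: "S \<subseteq> U"
  shows "e ` gen S = generate (natg U) (e ` S)"
proof -
  interpret group "natg U" by (rule group_natg[OF U])
  have GU: "gen S \<subseteq> U" by (rule gen_least[OF U(1) S])
  have d: "d (e x) = x" if "x \<in> U" for x using that U by auto
  have inv: "inv\<^bsub>natg U\<^esub> (e x) = e (- x)" if "x \<in> U" for x
    by (rule inv_equality) (use that d subgroupD[OF U(1)] in auto)
  show ?thesis
  proof (intro equalityI subsetI)
    fix x assume "x \<in> e ` gen S"
    then obtain y where y: "y \<in> gen S" "x = e y" by blast
    have "e y \<in> generate (natg U) (e ` S)"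
      using y(1)
    proof (induction rule: gen.induct)
      case gen_0
      then show ?case using generate.one[of "natg U" "e ` S"] by simp
    next
      case (gen_add a b)
      then have "a \<in> U" "b \<in> U" using S GU by auto
      moreover have "e a \<in> generate (natg U) (e ` S)" using gen_add by (intro generate.incl) auto
      ultimately show ?case using generate.eng[of "e a" "natg U" "e ` S" "e b"] gen_add.IH d by simp
    next
      case (gen_minus a b)
      then have ab: "a \<in> U" "- a \<in> U" "b \<in> U" using S GU subgroupD(3)[OF U(1)] by auto
      moreover have "e (- a) \<in> generate (natg U) (e ` S)"
        using generate.inv[of "e a" "e ` S" "natg U"] gen_minus inv[OF ab(1)] by simp
      ultimately show ?case using generate.eng[of "e (- a)" "natg U" "e ` S" "e b"] gen_minus.IH d by simp
    qed
    then show "x \<in> generate (natg U) (e ` S)" by (simp add: y)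
  next
    fix x assume "x \<in> generate (natg U) (e ` S)"
    then show "x \<in> e ` gen S"
    proof (induction rule: generate.induct)
      case one
      then show ?case using gen_0 by auto
    next
      case (incl h)
      then show ?case using gen_base by blast
    next
      case (inv h)
      then obtain a where a: "a \<in> S" "h = e a" by blast
      then have "inv\<^bsub>natg U\<^esub> h = e (- a)" "- a \<in> gen S" using inv S gen_uminus[OF gen_base[OF a(1)]] \<open>\<And>x. x \<in> U \<Longrightarrow> inv\<^bsub>natg U\<^esub> (e x) = e (- x)\<close> by auto
      then show ?case by simp
    next
      case (eng h1 h2)
      then obtain a b where ab: "a \<in> gen S" "b \<in> gen S" "h1 = e a" "h2 = e b" by auto
      then have "a \<in> U" "b \<in> U" using GU by auto
      then have "h1 \<otimes>\<^bsub>natg U\<^esub> h2 = e (a + b)" using ab d by simp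
      then show ?case using gen_plus[OF ab(1,2)] by simp
    qed
  qed
qed

lemma special_natg:
  assumes J: "J \<subseteq> {..<N}" and V: "gen (sk ` J) \<subseteq> V" and I: "I \<subseteq> J"
  shows "special_embedding (natg (gen (sk ` I))) (natg (gen (sk ` J))) (\<lambda>x. x)"
  unfolding special_embedding_def
proof (intro conjI exI)
  have sub: "gen (sk ` I) \<subseteq> gen (sk ` J)" using I by (intro gen_mono) auto
  then show "(\<lambda>x. x) \<in> hom (natg (gen (sk ` I))) (natg (gen (sk ` J)))"
    by (auto simp: hom_def)
  show "coxeter_system (natg (gen (sk ` J))) (e ` sk ` J) (\<lambda>x y. enat (lab (ki (d x)) (ki (d y))))"
    by (rule coxeter_natg[OF J V])
  show "e ` sk ` I \<subseteq> e ` sk ` J" using I by blast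
  have "sk ` I \<subseteq> gen (sk ` J)" using I by (auto intro: gen_base)
  then show "(\<lambda>x. x) ` carrier (natg (gen (sk ` I))) = generate (natg (gen (sk ` J))) (e ` sk ` I)"
    using generate_natg[OF subgroup_gen V] by simp
qed simp

end

locale parabolic_amalgam = amalg_encoding "gen (sk ` JA)" "gen (sk ` JB)" "gen (sk ` JC)" e V
  for JA JB JC :: "nat set" and e and V :: "(nat bj) set" +
  fixes N :: nat
  assumes N: "JA \<subseteq> {..<N}" "JB \<subseteq> {..<N}" and JC: "JC \<subseteq> JA" "JC \<subseteq> JB"
begin

abbreviation "CC \<equiv> gen (sk ` JC)"

text \<open>The simple reflections of the two factors are united along \<open>JC\<close>. A map that
  satisfies the relations extends to both factors by \<open>parabolic_extend\<close>, the extensions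
  agree on the reflections of \<open>JC\<close>, and \<open>pair_faithful\<close> does the
  rest.\<close>

theorem coxeter_AM: "is_coxeter_group AM"
proof -
  obtain \<Theta> where \<Theta>: "\<Theta> \<in> iso AM (gm W)" using AM_iso by blast
  then have bij: "bij_betw \<Theta> (carrier AM) W" by (simp add: iso_def)
  define \<Psi> where "\<Psi> = inv_into (carrier AM) \<Theta>"
  have \<Theta>\<Psi>: "\<Theta> (\<Psi> x) = x" "\<Psi> x \<in> carrier AM" if "x \<in> W" for x
    using bij that unfolding \<Psi>_def by (auto simp: bij_betw_def f_inv_into_f inv_into_into)
  have \<Psi>\<Theta>: "\<Psi> (\<Theta> x) = x" if "x \<in> carrier AM" for x
    using bij that unfolding \<Psi>_def by (auto simp: bij_betw_def)
  define SA where "SA = (\<lambda>k. hh (sk k)) ` JA"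
  define SB where "SB = (\<lambda>k. tc CC (sk k)) ` JB"
  have SW: "SA \<union> SB \<subseteq> W" using hhA_W tcB_W by (auto simp: SA_def SB_def intro: gen_base)
  define S where "S = \<Psi> ` (SA \<union> SB)"
  \<comment> \<open>The index of a reflection is read off with \<open>hp\<close>, which gives
    \<open>sk k\<close> for both copies, so the label is unambiguous on the common part. Reflections
    without a common factor get no relation.\<close>
  define m where "m x y = (if \<Theta> x \<in> SA \<and> \<Theta> y \<in> SA \<or> \<Theta> x \<in> SB \<and> \<Theta> y \<in> SB
    then enat (lab (ki (hp (\<Theta> x))) (ki (hp (\<Theta> y)))) else \<infinity>)" for x y
  have \<Theta>S: "\<Theta> ` S = SA \<union> SB" using \<Theta>\<Psi> SW by (force simp: S_def image_iff)
  have SAM: "S \<subseteq> carrier AM" using \<Theta>\<Psi> SW by (auto simp: S_def)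
  have "coxeter_system AM S m"
  proof (rule coxeter_systemI[OF group_AM \<Theta> subgroup_W SAM])
    show "coxeter_matrix S m"
      unfolding coxeter_matrix_def
    proof (intro ballI conjI)
      fix x y assume xy: "x \<in> S" "y \<in> S"
      have \<Theta>xy: "\<Theta> x \<in> SA \<union> SB" "\<Theta> y \<in> SA \<union> SB" using xy \<Theta>S by auto
      show "m x y = m y x" using lab_sym by (auto simp: m_def)
      show "1 \<le> m x y" using lab_pos by (auto simp: m_def one_enat_def)
      show "(m x y = 1) = (x = y)"
      proof
        assume "m x y = 1"
        then have h: "\<Theta> x \<in> SA \<and> \<Theta> y \<in> SA \<or> \<Theta> x \<in> SB \<and> \<Theta> y \<in> SB" "ki (hp (\<Theta> x)) = ki (hp (\<Theta> y))"
          using lab_1 by (auto simp: m_def one_enat_def split: if_splits)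
        then have "\<Theta> x = \<Theta> y" by (auto simp: SA_def SB_def)
        then have "\<Psi> (\<Theta> x) = \<Psi> (\<Theta> y)" by (rule arg_cong)
        moreover have "x \<in> carrier AM" "y \<in> carrier AM" using xy SAM by auto
        ultimately show "x = y" using \<Psi>\<Theta> by simp
      next
        assume "x = y"
        then show "m x y = 1" using \<Theta>xy lab_1 by (auto simp: m_def one_enat_def)
      qed
    qed
    show "evt \<Theta> r = 0" if r: "r \<in> coxeter_relators S m" for r
    proof -
      obtain x y k where xy: "x \<in> S" "y \<in> S" "m x y = enat k" "r = concat (replicate k [(x, True), (y, True)])"
        using r by (rule coxeter_relatorsE)
      have e: "evt \<Theta> r = pw k (\<Theta> x + \<Theta> y)" by (simp add: xy evt_power)
      from xy(3) consider "\<Theta> x \<in> SA" "\<Theta> y \<in> SA" "k = lab (ki (hp (\<Theta> x))) (ki (hp (\<Theta> y)))"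
        | "\<Theta> x \<in> SB" "\<Theta> y \<in> SB" "k = lab (ki (hp (\<Theta> x))) (ki (hp (\<Theta> y)))"
        by (auto simp: m_def split: if_splits)
      then show ?thesis
      proof cases
        case 1
        then obtain i j where ij: "i \<in> JA" "j \<in> JA" "\<Theta> x = hh (sk i)" "\<Theta> y = hh (sk j)" by (auto simp: SA_def)
        then have "evt \<Theta> r = pw (lab i j) (hh (sk i + sk j))" using e 1 by (simp add: hh_add)
        also have "\<dots> = hh (pw (lab i j) (sk i + sk j))" by (rule pw_hom[symmetric]) (rule hh_add)
        also have "pw (lab i j) (sk i + sk j) = 0" using braid_sk[of UNIV] by (simp add: braid_def)
        finally show ?thesis by simp
      next
        case 2
        then obtain i j where ij: "i \<in> JB" "j \<in> JB" "\<Theta> x = tc CC (sk i)" "\<Theta> y = tc CC (sk j)" by (auto simp: SB_def)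
        then have "evt \<Theta> r = pw (lab i j) (tc CC (sk i + sk j))" using e 2 by (simp add: tc_add)
        also have "\<dots> = tc CC (pw (lab i j) (sk i + sk j))" by (rule pw_hom[symmetric]) (rule tc_add[symmetric])
        also have "pw (lab i j) (sk i + sk j) = 0" using braid_sk[of UNIV] by (simp add: braid_def)
        finally show ?thesis by simp
      qed
    qed
    show "gen (\<Theta> ` S) = W"
      unfolding \<Theta>S
    proof
      show "gen (SA \<union> SB) \<subseteq> W" by (rule gen_least[OF subgroup_W SW])
      have A: "hh a \<in> gen (SA \<union> SB)" if "a \<in> gen (sk ` JA)" for a
        by (rule hom_gen[where f = hh, OF hh_add _ subgroup_gen that]) (auto simp: SA_def intro: gen_base)
      have B: "tc CC b \<in> gen (SA \<union> SB)" if "b \<in> gen (sk ` JB)" for b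
        by (rule hom_gen[where f = "tc CC", OF tc_add[symmetric] _ subgroup_gen that]) (auto simp: SB_def intro: gen_base)
      show "W \<subseteq> gen (SA \<union> SB)" unfolding WW_def by (rule gen_least) (use A B in auto)
    qed
    fix f :: "(nat + nat) word set \<Rightarrow> (((nat + nat) word set) word set) bj" and w
    assume f: "\<And>r. r \<in> coxeter_relators S m \<Longrightarrow> evt f r = 0" and w: "set w \<subseteq> S \<times> UNIV" "evt \<Theta> w = 0"
    have rel: "pw k (f x + f y) = 0" if "x \<in> S" "y \<in> S" "m x y = enat k" for x y k
    proof -
      have "concat (replicate k [(x, True), (y, True)]) \<in> coxeter_relators S m"
        using that by (rule coxeter_relatorsI)
      from f[OF this] show ?thesis by (simp add: evt_power)
    qed
    have \<Psi>A: "\<Psi> (hh (sk k)) \<in> S" "\<Theta> (\<Psi> (hh (sk k))) = hh (sk k)" if "k \<in> JA" for k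
      using that \<Theta>\<Psi>(1) SW by (auto simp: S_def SA_def)
    have \<Psi>B: "\<Psi> (tc CC (sk k)) \<in> S" "\<Theta> (\<Psi> (tc CC (sk k))) = tc CC (sk k)" if "k \<in> JB" for k
      using that \<Theta>\<Psi>(1) SW by (auto simp: S_def SB_def)
    have "braid JA (\<lambda>k. f (\<Psi> (hh (sk k))))"
      unfolding braid_def
      by (intro ballI rel \<Psi>A) (auto simp: m_def \<Psi>A SA_def)
    then obtain \<alpha> where \<alpha>: "hom_on \<alpha> (gen (sk ` JA))" "\<And>k. k \<in> JA \<Longrightarrow> \<alpha> (sk k) = f (\<Psi> (hh (sk k)))"
      using parabolic_extend N by blast
    have "braid JB (\<lambda>k. f (\<Psi> (tc CC (sk k))))"
      unfolding braid_def
      by (intro ballI rel \<Psi>B) (auto simp: m_def \<Psi>B SB_def)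
    then obtain \<beta> where \<beta>: "hom_on \<beta> (gen (sk ` JB))" "\<And>k. k \<in> JB \<Longrightarrow> \<beta> (sk k) = f (\<Psi> (tc CC (sk k)))"
      using parabolic_extend N by blast
    have agree: "\<alpha> c = \<beta> c" if "c \<in> CC" for c
    proof (rule hom_on_gen_eq[OF _ _ _ that])
      show "hom_on \<alpha> CC" using \<alpha>(1) CA by (auto simp: hom_on_def)
      show "hom_on \<beta> CC" using \<beta>(1) CB by (auto simp: hom_on_def)
      fix x assume "x \<in> sk ` JC"
      then obtain k where k: "x = sk k" "k \<in> JC" "k \<in> JA" "k \<in> JB" using JC by auto
      then have "tc CC (sk k) = hh (sk k)" using k by (intro tc_C gen_base) auto
      then show "\<alpha> x = \<beta> x" using k \<alpha>(2) \<beta>(2) by simp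
    qed
    have "evt (\<lambda>x. (\<Theta> x, f x)) w \<in> gen ((\<lambda>x. (\<Theta> x, f x)) ` S)" by (rule evt_gen[OF w(1)])
    also have "\<dots> \<subseteq> gen ((\<lambda>a. (hh a, \<alpha> a)) ` gen (sk ` JA) \<union> (\<lambda>b. (tc CC b, \<beta> b)) ` gen (sk ` JB))"
    proof (rule gen_mono)
      show "(\<lambda>x. (\<Theta> x, f x)) ` S \<subseteq> (\<lambda>a. (hh a, \<alpha> a)) ` gen (sk ` JA) \<union> (\<lambda>b. (tc CC b, \<beta> b)) ` gen (sk ` JB)"
    proof
      fix p assume "p \<in> (\<lambda>x. (\<Theta> x, f x)) ` S"
      then obtain y where y: "y \<in> SA \<union> SB" "p = (\<Theta> (\<Psi> y), f (\<Psi> y))" by (auto simp: S_def)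
      then consider k where "k \<in> JA" "y = hh (sk k)" | k where "k \<in> JB" "y = tc CC (sk k)" by (auto simp: SA_def SB_def)
      then show "p \<in> (\<lambda>a. (hh a, \<alpha> a)) ` gen (sk ` JA) \<union> (\<lambda>b. (tc CC b, \<beta> b)) ` gen (sk ` JB)"
      proof cases
        case 1
        then have "p = (hh (sk k), \<alpha> (sk k))" using y \<Psi>A \<alpha> by simp
        moreover have "sk k \<in> gen (sk ` JA)" using 1 by (intro gen_base) auto
        ultimately show ?thesis by blast
      next
        case 2
        then have "p = (tc CC (sk k), \<beta> (sk k))" using y \<Psi>B \<beta> by simp
        moreover have "sk k \<in> gen (sk ` JB)" using 2 by (intro gen_base) auto
        ultimately show ?thesis by blast
      qed
    qed
    qed
    finally have "(0, evt f w) \<in> gen ((\<lambda>a. (hh a, \<alpha> a)) ` gen (sk ` JA) \<union> (\<lambda>b. (tc CC b, \<beta> b)) ` gen (sk ` JB))"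
      by (simp only: evt_pair w(2))
    then show "evt f w = 0" using pair_faithful[OF \<alpha>(1) \<beta>(1) agree] by blast
  qed
  then show ?thesis by (auto simp: is_coxeter_group_def)
qed

end

subsection \<open>Permutations of order five\<close>

definition stab :: "'a set \<Rightarrow> 'a bj set" where "stab S = {f. ap f ` S = S}"

lemma subgroup_stab: "is_subgroup (stab S)"
proof -
  have plus: "f + g \<in> stab S" if "f \<in> stab S" "g \<in> stab S" for f g
  proof -
    have "ap (f + g) ` S = ap f ` ap g ` S" by (simp add: image_image)
    then show ?thesis using that by (simp add: stab_def)
  qed
  have uminus: "- f \<in> stab S" if "f \<in> stab S" for f
  proof -
    have "ap (- f) ` S = ap (- f) ` ap f ` S" using that by (simp add: stab_def)
    then show ?thesis by (simp add: image_image stab_def)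
  qed
  show ?thesis unfolding is_subgroup_def using plus uminus by (auto simp: stab_def)
qed

lemma sk_stab: "(k \<in> S \<longleftrightarrow> Suc k \<in> S) \<Longrightarrow> sk k \<in> stab S"
proof -
  assume h: "k \<in> S \<longleftrightarrow> Suc k \<in> S"
  have "ap (sk k) x \<in> S" if "x \<in> S" for x using h that by auto
  moreover have "ap (sk k) (ap (sk k) x) = x" for x by simp
  ultimately have "ap (sk k) ` S = S" by (metis (no_types, lifting) image_eqI image_subsetI subsetI subset_antisym)
  then show ?thesis by (simp add: stab_def)
qed

lemma stabD: "f \<in> stab S \<Longrightarrow> x \<in> S \<Longrightarrow> ap f x \<in> S"
  by (auto simp: stab_def)

lemma gen_stab: "x \<in> gen (sk ` J) \<Longrightarrow> (\<And>k. k \<in> J \<Longrightarrow> k \<in> S \<longleftrightarrow> Suc k \<in> S) \<Longrightarrow> x \<in> stab S"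
  using gen_least[OF subgroup_stab, of "sk ` J" S] sk_stab by blast

lemma orbit5:
  assumes p: "p + p + p + p + p = 0" and a: "ap p a \<noteq> a"
  defines "b \<equiv> ap p a"
  defines "c \<equiv> ap p b"
  defines "d \<equiv> ap p c"
  defines "e \<equiv> ap p d"
  shows "ap p e = a" "card {a, b, c, d, e} = 5"
proof -
  have "ap (p + p + p + p + p) a = a" using p by simp
  then show e: "ap p e = a" by (simp add: b_def c_def d_def e_def)
  have "b \<noteq> a" using a by (simp add: b_def)
  moreover have "c \<noteq> a" using a e by (metis b_def c_def d_def e_def)
  moreover have "d \<noteq> a" using a e by (metis b_def c_def d_def e_def)
  moreover have "e \<noteq> a" using a e by (metis b_def)
  ultimately show "card {a, b, c, d, e} = 5"
    by (auto simp: b_def c_def d_def e_def card_insert_if)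
qed

lemma order5_small:
  assumes p: "p + p + p + p + p = 0" and S: "p \<in> stab S" "finite S" "card S \<le> 4" and x: "x \<in> S"
  shows "ap p x = x"
proof (rule ccontr)
  assume a: "ap p x \<noteq> x"
  have "{x, ap p x, ap p (ap p x), ap p (ap p (ap p x)), ap p (ap p (ap p (ap p x)))} \<subseteq> S"
    using x stabD[OF S(1)] by auto
  from card_mono[OF S(2) this] show False using orbit5(2)[OF p a] S(3) by simp
qed

text \<open>On at most six points \<open>p\<close> is a 5-cycle with at most one further point. Then
  \<open>r\<close> preserves this cycle and acts on it as a power of \<open>p\<close>, hence
  trivially, because its order divides 4; a remaining point is fixed as well.\<close>

lemma order5_centralizer:
  assumes p: "p + p + p + p + p = 0" and r: "r + r + r + r = 0" and XZ: "p + r = r + p"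
    and S: "p \<in> stab S" "r \<in> stab S" "finite S" "card S \<le> 6" and a: "a \<in> S" "ap p a \<noteq> a" and x: "x \<in> S"
  shows "ap r x = x"
proof -
  define b where "b = ap p a"
  define c where "c = ap p b"
  define d where "d = ap p c"
  define e where "e = ap p d"
  have e: "ap p e = a" and card: "card {a, b, c, d, e} = 5"
    using orbit5[OF p a(2)] by (simp_all add: b_def c_def d_def e_def)
  let ?O = "{a, b, c, d, e}"
  have O: "?O \<subseteq> S" using a stabD[OF S(1)] by (auto simp: b_def c_def d_def e_def)
  define R where "R = S - ?O"
  have "card R \<le> Suc 0" "finite R" unfolding R_def using card_Diff_subset[of ?O S] O S(3,4) card by simp_all
  then have "\<forall>y\<in>R. \<forall>z\<in>R. y = z" using card_le_Suc0_iff_eq by blast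
  then have one: "y = z" if "y \<in> S" "z \<in> S" "y \<notin> ?O" "z \<notin> ?O" for y z
    using that unfolding R_def by blast
  have comm: "ap r (ap p y) = ap p (ap r y)" for y using XZ by (metis ap_add)
  have XO: "ap p y \<in> ?O \<longleftrightarrow> y \<in> ?O" for y
  proof
    assume "ap p y \<in> ?O"
    then have "ap p y = ap p e \<or> ap p y = ap p a \<or> ap p y = ap p b \<or> ap p y = ap p c \<or> ap p y = ap p d"
      using e by (auto simp: b_def c_def d_def e_def)
    then show "y \<in> ?O" by auto
  qed (use e in \<open>auto simp: b_def c_def d_def e_def\<close>)
  have Z4: "ap r (ap r (ap r (ap r a))) = a"
  proof -
    have "ap (r + r + r + r) a = a" using r by simp
    then show ?thesis by simp
  qed
  have dist: "a \<noteq> b" "a \<noteq> c" "a \<noteq> d" "a \<noteq> e"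
    using card by (auto simp: card_insert_if split: if_splits)
  have Za: "ap r a \<in> ?O"
  proof (rule ccontr)
    assume n: "ap r a \<notin> ?O"
    then have "ap p (ap r a) \<notin> ?O" using XO by blast
    then have "ap p (ap r a) = ap r a"
      using one[OF _ _ _ n] stabD[OF S(1)] stabD[OF S(2)] a by blast
    then have "ap r (ap p a) = ap r a" using comm by simp
    then show False using a by simp
  qed
  have Zb: "ap r b = ap p (ap r a)" and Zc: "ap r c = ap p (ap r b)" and Zd: "ap r d = ap p (ap r c)" and Ze: "ap r e = ap p (ap r d)"
    by (simp_all add: b_def c_def d_def e_def comm)
  have bcde: "ap p a = b" "ap p b = c" "ap p c = d" "ap p d = e" by (simp_all add: b_def c_def d_def e_def)
  have "ap r a = a"
  proof -
    from Za consider "ap r a = a" | "ap r a = b" | "ap r a = c" | "ap r a = d" | "ap r a = e" by blast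
    then show ?thesis
      by cases (use Z4 dist e bcde Zb Zc Zd Ze in auto)
  qed
  then have Zfix: "ap r y = y" if "y \<in> ?O" for y using that e Zb Zc Zd Ze bcde by auto
  show ?thesis
  proof (cases "x \<in> ?O")
    case False
    have "ap r x \<notin> ?O"
    proof
      assume "ap r x \<in> ?O"
      then have "ap r (ap r x) = ap r x" by (rule Zfix)
      then show False using False \<open>ap r x \<in> ?O\<close> by simp
    qed
    then show ?thesis using one[OF _ x _ False] stabD[OF S(2) x] by blast
  qed (rule Zfix)
qed


subsection \<open>The two amalgams\<close>

text \<open>The index \<open>k\<close> stands for the transposition of \<open>k\<close> and
  \<open>k + 1\<close>, so a missing index separates two blocks of points. The blocks are
  \<open>{0..3}\<close>, \<open>{4..8}\<close> for \<open>jA\<close>, then \<open>{0, 1}\<close>,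
  \<open>{2..7}\<close> for \<open>jB\<close>, and \<open>{0..5}\<close>, \<open>{6, 7}\<close> for
  \<open>jB'\<close>.\<close>

definition jA :: "nat set" where "jA = {0, 1, 2, 4, 5, 6, 7}"
definition jB :: "nat set" where "jB = {0, 2, 3, 4, 5, 6}"
definition jB' :: "nat set" where "jB' = {0, 1, 2, 3, 4, 6}"
definition jC :: "nat set" where "jC = {0, 2, 4, 6}"

lemmas j_defs = jA_def jB_def jB'_def jC_def

lemma jC_sub: "jC \<subseteq> jA" "jC \<subseteq> jB" "jC \<subseteq> jB'"
  and j_less: "jA \<subseteq> {..<8}" "jB \<subseteq> {..<8}" "jB' \<subseteq> {..<8}" "jC \<subseteq> {..<8}"
  by (auto simp: j_defs)

definition gA :: "(nat bj) set" where "gA = gen (sk ` jA)"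
definition gB :: "(nat bj) set" where "gB = gen (sk ` jB)"
definition gB' :: "(nat bj) set" where "gB' = gen (sk ` jB')"
definition gC :: "(nat bj) set" where "gC = gen (sk ` jC)"

lemmas g_defs = gA_def gB_def gB'_def gC_def

lemma gC_sub: "gC \<subseteq> gA" "gC \<subseteq> gB" "gC \<subseteq> gB'"
  unfolding g_defs using jC_sub by (auto intro!: gen_mono)

lemma finite_g: "finite gA" "finite gB" "finite gB'"
  unfolding g_defs by (rule parabolic_finite[where N = 8], rule j_less)+

lemma amalg_B: "amalg gA gB gC" and amalg_B': "amalg gA gB' gC"
  by (unfold_locales; use gC_sub in \<open>simp add: g_defs\<close>)+

text \<open>The permutations \<open>w0\<close>, \<open>w1\<close>, \<open>w2\<close> interchange neighbours among the four pairs
  \<open>{0, 1}\<close>, \<open>{2, 3}\<close>, \<open>{4, 5}\<close>, \<open>{6, 7}\<close>.\<close>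

definition w0 :: "nat bj" where "w0 = sk 1 + sk 0 + sk 2 + sk 1"
definition w1 :: "nat bj" where "w1 = sk 3 + sk 2 + sk 4 + sk 3"
definition w2 :: "nat bj" where "w2 = sk 5 + sk 4 + sk 6 + sk 5"

lemma bj9_eqI:
  assumes "ap f 0 = ap g 0" "ap f (Suc 0) = ap g (Suc 0)" "ap f 2 = ap g 2" "ap f 3 = ap g 3" "ap f 4 = ap g 4"
    "ap f 5 = ap g 5" "ap f 6 = ap g 6" "ap f 7 = ap g 7" "ap f 8 = ap g 8"
    and "\<And>x. \<lbrakk>x \<noteq> 0; x \<noteq> Suc 0; x \<noteq> 2; x \<noteq> 3; x \<noteq> 4; x \<noteq> 5; x \<noteq> 6; x \<noteq> 7; x \<noteq> 8\<rbrakk> \<Longrightarrow> ap f x = ap g x"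
  shows "f = (g :: nat bj)"
proof (rule bj_eqI)
  fix x
  show "ap f x = ap g x" using assms by metis
qed

lemma ap_w0 [simp]: "ap w0 x = (if x = 0 then 2 else if x = Suc 0 then 3 else if x = 2 then 0 else if x = 3 then Suc 0 else x)"
  by (simp add: w0_def)

lemma ap_w1 [simp]: "ap w1 x = (if x = 2 then 4 else if x = 3 then 5 else if x = 4 then 2 else if x = 5 then 3 else x)"
  by (simp add: w1_def)

lemma ap_w2 [simp]: "ap w2 x = (if x = 4 then 6 else if x = 5 then 7 else if x = 6 then 4 else if x = 7 then 5 else x)"
  by (simp add: w2_def)

lemma w_sq: "w0 + w0 = 0" "w1 + w1 = 0" "w2 + w2 = 0"
  by (rule bj9_eqI; simp)+

lemma w_uminus: "- w0 = w0" "- w1 = w1" "- w2 = w2"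
  using w_sq by (metis add.inverse_unique)+

lemma w_mem: "w0 \<in> gA" "w2 \<in> gA" "w1 \<in> gB" "w2 \<in> gB" "w0 \<in> gB'" "w1 \<in> gB'"
  unfolding w0_def w1_def w2_def g_defs j_defs by (intro gen_plus gen_base; simp)+

text \<open>Division by 2 gives the number of the pair. An element that moves some pair is therefore
  outside \<open>gC\<close>, which settles \<open>not_gC\<close>.\<close>

lemma gC_div: "c \<in> gC \<Longrightarrow> ap c x div 2 = x div 2"
  unfolding gC_def
proof (induction rule: gen.induct)
  case (gen_add a b)
  then have "ap a y div 2 = y div 2" for y by (auto simp: jC_def)
  then show ?case using gen_add by simp
next
  case (gen_minus a b)
  then have "ap a y div 2 = y div 2" for y by (auto simp: jC_def)
  from this[of "ap (- a) (ap b x)"] show ?case using gen_minus by simp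
qed simp

lemma not_gC: "w0 \<notin> gC" "w1 \<notin> gC" "w2 \<notin> gC" "w1 + w2 \<notin> gC" "w0 + w1 \<notin> gC"
  "w1 + w2 + (w1 + w2) \<notin> gC" "w0 + w1 + (w0 + w1) \<notin> gC" "- w0 + w2 \<notin> gC" "- w2 + w0 \<notin> gC"
  using gC_div[of w0 0] gC_div[of w1 2] gC_div[of w2 4] gC_div[of "w1 + w2" 2] gC_div[of "w0 + w1" 0]
    gC_div[of "w1 + w2 + (w1 + w2)" 2] gC_div[of "w0 + w1 + (w0 + w1)" 0]
    gC_div[of "w0 + w2" 4] gC_div[of "w2 + w0" 4]
  by (auto simp: w_uminus simp del: ap_sk)

lemma conj_gen:
  assumes "\<And>x. x \<in> S \<Longrightarrow> u + x + - u \<in> gen U" "x \<in> gen S"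
  shows "u + x + - (u :: 'g::group_add) \<in> gen U"
  by (rule hom_gen[where f = "\<lambda>x. u + x + - u", OF _ assms(1) subgroup_gen assms(2)]) (simp_all only: grps)

lemma conj_sk: "u + sk k = sk k' + u \<Longrightarrow> u + sk k + - u = sk k'"
  by (simp only: grps)

lemma conj_sk': "u + sk k = sk k' + u \<Longrightarrow> - u + sk k' + - (- u) = sk k"
  by (metis (no_types) add.assoc left_minus add_0 minus_minus right_minus add_0_right)

lemma w_conj:
  "w0 + sk 0 = sk 2 + w0" "w0 + sk 2 = sk 0 + w0" "w0 + sk 4 = sk 4 + w0" "w0 + sk 6 = sk 6 + w0"
  "w1 + sk 0 = sk 0 + w1" "w1 + sk 2 = sk 4 + w1" "w1 + sk 4 = sk 2 + w1" "w1 + sk 6 = sk 6 + w1"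
  "w2 + sk 0 = sk 0 + w2" "w2 + sk 2 = sk 2 + w2" "w2 + sk 4 = sk 6 + w2" "w2 + sk 6 = sk 4 + w2"
  by (rule bj9_eqI; simp)+

lemma normalizes_gC: "normalizes w0 gC" "normalizes w1 gC" "normalizes w2 gC"
proof -
  have *: "normalizes w gC" if "- w = w" "\<And>k. k \<in> jC \<Longrightarrow> w + sk k + - w \<in> gC" for w
    using conj_gen[of "sk ` jC" w "sk ` jC"] that by (auto simp: normalizes_def gC_def simp del: add_uminus_conv_diff)
  have mem: "sk 0 \<in> gC" "sk 2 \<in> gC" "sk 4 \<in> gC" "sk 6 \<in> gC" by (auto simp: gC_def jC_def intro!: gen_base)
  show "normalizes w0 gC" by (rule *, rule w_uminus) (auto simp: jC_def mem w_conj[THEN conj_sk] simp del: add_uminus_conv_diff)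
  show "normalizes w1 gC" by (rule *, rule w_uminus) (auto simp: jC_def mem w_conj[THEN conj_sk] simp del: add_uminus_conv_diff)
  show "normalizes w2 gC" by (rule *, rule w_uminus) (auto simp: jC_def mem w_conj[THEN conj_sk] simp del: add_uminus_conv_diff)
qed

text \<open>On the four pairs, \<open>w1 + w2\<close> is a 3-cycle, so its double is outside
  \<open>gC\<close>; \<open>w0 + (w1 + w2)\<close> is a 4-cycle and \<open>w2 + (w1 + w2)\<close> an
  involution, so both have fourth power 0.\<close>

lemma merz_B: "merz gA gB gC w0 w2 (w1 + w2)"
proof -
  interpret amalg gA gB gC by (rule amalg_B)
  show ?thesis
  proof unfold_locales
    show "w1 + w2 \<in> gB" using w_mem by (simp add: gB_def gen_plus)
    show "w0 + (w1 + w2) + (w0 + (w1 + w2)) + (w0 + (w1 + w2)) + (w0 + (w1 + w2)) = 0"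
      by (rule bj9_eqI; simp)
    show "w2 + (w1 + w2) + (w2 + (w1 + w2)) + (w2 + (w1 + w2)) + (w2 + (w1 + w2)) = 0"
      by (rule bj9_eqI; simp)
  qed (rule w_mem normalizes_gC not_gC normalizes_add | rule normalizes_gC)+
qed

text \<open>The mirror image: \<open>w0 + w1\<close> is a 3-cycle of pairs,
  \<open>w2 + (w0 + w1)\<close> a 4-cycle, and \<open>w0 + (w0 + w1)\<close> equals
  \<open>w1\<close>.\<close>

lemma merz_B': "merz gA gB' gC w2 w0 (w0 + w1)"
proof -
  interpret amalg gA gB' gC by (rule amalg_B')
  show ?thesis
  proof unfold_locales
    show "w0 + w1 \<in> gB'" using w_mem by (simp add: gB'_def gen_plus)
    show "w2 + (w0 + w1) + (w2 + (w0 + w1)) + (w2 + (w0 + w1)) + (w2 + (w0 + w1)) = 0"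
      by (rule bj9_eqI; simp)
    show "w0 + (w0 + w1) + (w0 + (w0 + w1)) + (w0 + (w0 + w1)) + (w0 + (w0 + w1)) = 0"
      by (rule bj9_eqI; simp)
  qed (rule w_mem normalizes_gC not_gC normalizes_add | rule normalizes_gC)+
qed

text \<open>The permutation \<open>w2 + w1 + w0\<close> takes the pair \<open>{0, 1}\<close> to
  \<open>{6, 7}\<close> and shifts the other points down by 2. So it takes the blocks of
  \<open>jB\<close> to those of \<open>jB'\<close>.\<close>

lemma u_conj:
  "w2 + w1 + w0 + sk 0 = sk 6 + (w2 + w1 + w0)" "w2 + w1 + w0 + sk 2 = sk 0 + (w2 + w1 + w0)"
  "w2 + w1 + w0 + sk 3 = sk 1 + (w2 + w1 + w0)" "w2 + w1 + w0 + sk 4 = sk 2 + (w2 + w1 + w0)"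
  "w2 + w1 + w0 + sk 5 = sk 3 + (w2 + w1 + w0)" "w2 + w1 + w0 + sk 6 = sk 4 + (w2 + w1 + w0)"
  by (rule bj9_eqI; simp)+

lemma u_uminus: "- (w2 + w1 + w0) = w0 + w1 + w2"
  by (simp only: minus_add w_uminus add.assoc)

lemma u_gB: "b \<in> gB \<Longrightarrow> w2 + w1 + w0 + b + - (w2 + w1 + w0) \<in> gB'"
  unfolding gB_def gB'_def
proof (rule conj_gen)
  fix x assume "x \<in> sk ` jB"
  then show "w2 + w1 + w0 + x + - (w2 + w1 + w0) \<in> gen (sk ` jB')"
    unfolding j_defs by (auto simp only: image_iff insert_iff empty_iff u_conj[THEN conj_sk] intro!: gen_base)
qed

lemma u_gB': "b \<in> gB' \<Longrightarrow> - (w2 + w1 + w0) + b + (w2 + w1 + w0) \<in> gB"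
proof -
  have "- (w2 + w1 + w0) + b + - (- (w2 + w1 + w0)) \<in> gB" if "b \<in> gB'"
    using that unfolding gB_def gB'_def
  proof (rule conj_gen[rotated])
    fix x assume "x \<in> sk ` jB'"
    then show "- (w2 + w1 + w0) + x + - (- (w2 + w1 + w0)) \<in> gen (sk ` jB)"
      unfolding j_defs by (auto simp only: image_iff insert_iff empty_iff u_conj[THEN conj_sk'] intro!: gen_base)
  qed
  then show "b \<in> gB' \<Longrightarrow> - (w2 + w1 + w0) + b + (w2 + w1 + w0) \<in> gB" by (simp only: minus_minus)
qed

lemma hh_conj: "hh x + hh c = hh (x + c + - x) + hh x"
  by (simp only: hh_add[symmetric] grps)

lemma (in amalg) tc_conj:
  assumes "normalizes x C" "c \<in> C"
  shows "tc C x + hh c = hh (x + c + - x) + tc C x"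
proof -
  have "x + c + - x \<in> C" using assms unfolding normalizes_def by blast
  then have "tc C x + tc C c = tc C (x + c + - x) + tc C x" by (simp only: tc_add grps)
  then show ?thesis by (simp only: tc_C[OF assms(2)] tc_C[OF \<open>x + c + - x \<in> C\<close>])
qed

lemma (in amalg) conj_word:
  assumes "normalizes x C" "normalizes y C" "c \<in> C"
  shows "hh z + tc C y + hh x + hh c = hh (z + y + x + c + - (z + y + x)) + (hh z + tc C y + hh x)"
proof -
  define d where "d = x + c + - x"
  have d: "d \<in> C" unfolding d_def using assms unfolding normalizes_def by blast
  have "hh z + tc C y + hh x + hh c = hh z + (tc C y + hh d) + hh x"
    unfolding d_def by (simp only: add.assoc hh_conj[of x c])
  also have "\<dots> = (hh z + hh (y + d + - y)) + tc C y + hh x"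
    by (simp only: tc_conj[OF assms(2) d]) (simp only: add.assoc)
  also have "\<dots> = hh (z + (y + d + - y) + - z) + (hh z + tc C y + hh x)"
    by (simp only: hh_conj[of z "y + d + - y"]) (simp only: add.assoc)
  also have "z + (y + d + - y) + - z = z + y + x + c + - (z + y + x)"
    unfolding d_def by (simp only: grps)
  finally show ?thesis .
qed

text \<open>\<open>w0\<close> and \<open>w2\<close> lie in \<open>gA\<close>, and \<open>w1\<close>
  lies in both \<open>gB\<close> and \<open>gB'\<close>. So the product that defines the twist, and
  its inverse, can be spelled in each amalgam with \<open>w1\<close> taken from the second
  factor.\<close>

lemma twist_B: "twist gA gB gB' gC (w2 + w1 + w0) (hh w2 + tc gC w1 + hh w0) (hh w0 + tc gC w1 + hh w2)"
proof -
  interpret V1: amalg gA gB gC by (rule amalg_B)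
  interpret V2: amalg gA gB' gC by (rule amalg_B')
  show ?thesis
  proof unfold_locales
    show "normalizes (w2 + w1 + w0) gC" by (intro normalizes_add normalizes_gC)
    show "hh w2 + tc gC w1 + hh w0 \<in> WW gA gB gC"
      using V1.hhA_W V1.tcB_W w_mem subgroupD(2)[OF V1.subgroup_W] by blast
    show "hh w0 + tc gC w1 + hh w2 \<in> WW gA gB' gC"
      using V2.hhA_W V2.tcB_W w_mem subgroupD(2)[OF V2.subgroup_W] by blast
    fix c assume c: "c \<in> gC"
    show "hh w2 + tc gC w1 + hh w0 + hh c = hh (w2 + w1 + w0 + c + - (w2 + w1 + w0)) + (hh w2 + tc gC w1 + hh w0)"
      by (intro V1.conj_word normalizes_gC c)
    have e: "w2 + w1 + w0 = - (w0 + w1 + w2)" unfolding u_uminus[symmetric] by (simp only: minus_minus)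
    show "hh w0 + tc gC w1 + hh w2 + hh c = hh (- (w2 + w1 + w0) + c + (w2 + w1 + w0)) + (hh w0 + tc gC w1 + hh w2)"
      unfolding u_uminus using V1.conj_word[OF normalizes_gC(3,2) c, of w0] unfolding e .
  qed (simp_all only: u_gB u_gB')
qed

lemma g_stab:
  "x \<in> gA \<Longrightarrow> x \<in> stab {0..<4}" "x \<in> gA \<Longrightarrow> x \<in> stab {4..<9}"
  "x \<in> gB' \<Longrightarrow> x \<in> stab {0..<6}" "x \<in> gB' \<Longrightarrow> x \<in> stab {6, 7}"
  unfolding g_defs by (erule gen_stab; auto simp: j_defs)+

lemma g_fix: "x \<in> gA \<Longrightarrow> y \<ge> 9 \<Longrightarrow> ap x y = y" "x \<in> gB' \<Longrightarrow> y \<ge> 8 \<Longrightarrow> ap x y = y"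
proof -
  show "ap x y = y" if "x \<in> gA" "y \<ge> 9"
  proof -
    have "x \<in> stab {y}"
      by (rule gen_stab[OF that(1)[unfolded gA_def]]) (use that(2) in \<open>auto simp: jA_def\<close>)
    then show ?thesis by (simp add: stab_def)
  qed
  show "ap x y = y" if "x \<in> gB'" "y \<ge> 8"
  proof -
    have "x \<in> stab {y}"
      by (rule gen_stab[OF that(1)[unfolded gB'_def]]) (use that(2) in \<open>auto simp: jB'_def\<close>)
    then show ?thesis by (simp add: stab_def)
  qed
qed

lemma gA_moves:
  assumes x: "x \<in> gA" "x \<noteq> 0" "x + x + x + x + x = 0"
  shows "\<exists>a\<in>{4..<9}. ap x a \<noteq> a"
proof (rule ccontr)
  assume n: "\<not> (\<exists>a\<in>{4..<9}. ap x a \<noteq> a)"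
  have "ap x y = ap 0 y" for y
  proof -
    consider "y \<in> {0..<4}" | "y \<in> {4..<9}" | "y \<ge> 9" by fastforce
    then show ?thesis
    proof cases
      case 1
      then show ?thesis using order5_small[OF x(3) g_stab(1)[OF x(1)]] by simp
    next
      case 2
      then show ?thesis using n by auto
    next
      case 3
      then show ?thesis using g_fix(1)[OF x(1)] by simp
    qed
  qed
  then show False using x(2) bj_eqI by blast
qed

lemma gB'_moves:
  assumes x: "x \<in> gB'" "x \<noteq> 0" "x + x + x + x + x = 0"
  shows "\<exists>a\<in>{0..<6}. ap x a \<noteq> a"
proof (rule ccontr)
  assume n: "\<not> (\<exists>a\<in>{0..<6}. ap x a \<noteq> a)"
  have "ap x y = ap 0 y" for y
  proof -
    consider "y \<in> {0..<6}" | "y \<in> {6, 7}" | "y \<ge> 8" by fastforce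
    then show ?thesis
    proof cases
      case 2
      then show ?thesis using order5_small[OF x(3) g_stab(4)[OF x(1)]] by simp
    next
      case 1
      then show ?thesis using n by auto
    next
      case 3
      then show ?thesis using g_fix(2)[OF x(1)] by simp
    qed
  qed
  then show False using x(2) bj_eqI by blast
qed

lemma gB'_centralizer:
  assumes x: "x \<in> gB'" "x \<noteq> 0" "x + x + x + x + x = 0" and r: "r \<in> gB'" "r + r + r + r = 0" "x + r = r + x"
    and y: "y < 6"
  shows "ap r y = y"
proof -
  obtain a where "a \<in> {0..<6}" "ap x a \<noteq> a" using gB'_moves[OF x] by blast
  from order5_centralizer[OF x(3) r(2,3) g_stab(3)[OF x(1)] g_stab(3)[OF r(1)] _ _ this, of y] y
  show ?thesis by simp
qed

lemma gC_sq: "c \<in> gC \<Longrightarrow> c + c = 0"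
proof (rule bj_eqI)
  fix x assume c: "c \<in> gC"
  define y where "y = ap c x"
  define z where "z = ap c y"
  have "y div 2 = x div 2" "z div 2 = y div 2" unfolding y_def z_def by (rule gC_div[OF c])+
  moreover have "y = x \<longleftrightarrow> z = y" unfolding z_def by (subst (3) y_def) simp
  ultimately have "z = x" by presburger
  then show "ap (c + c) x = ap 0 x" by (simp add: z_def y_def)
qed

text \<open>Commuting with an element of order five in \<open>gA\<close> fixes all points of
  \<open>{4..8}\<close>, and in \<open>gB'\<close> all points of \<open>{0..5}\<close>. Together
  these are all points that \<open>c\<close> could move.\<close>

lemma no_five_gB': "\<not> (\<exists>c\<in>gC. c \<noteq> 0 \<and> five gA c \<and> five gB' c)"
proof
  assume "\<exists>c\<in>gC. c \<noteq> 0 \<and> five gA c \<and> five gB' c"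
  then obtain c x y where c: "c \<in> gC" "c \<noteq> 0"
    and x: "x \<in> gA" "x \<noteq> 0" "x + x + x + x + x = 0" "c + x = x + c"
    and y: "y \<in> gB'" "y \<noteq> 0" "y + y + y + y + y = 0" "c + y = y + c" by (auto simp: five_def)
  have c4: "c + c + c + c = 0" using gC_sq[OF c(1)] by simp
  have cg: "c \<in> gA" "c \<in> gB'" using c gC_sub by auto
  obtain a where a: "a \<in> {4..<9}" "ap x a \<noteq> a" using gA_moves[OF x(1-3)] by blast
  have "ap c z = ap 0 z" for z
  proof -
    consider "z < 6" | "z \<in> {4..<9}" | "z \<ge> 9" by fastforce
    then show ?thesis
    proof cases
      case 1
      then show ?thesis using gB'_centralizer[OF y(1-3) cg(2) c4 y(4)[symmetric]] by simp
    next
      case 2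
      then show ?thesis
        using order5_centralizer[OF x(3) c4 x(4)[symmetric] g_stab(2)[OF x(1)] g_stab(2)[OF cg(1)] _ _ a, of z] by simp
    next
      case 3
      then show ?thesis using g_fix(1)[OF cg(1)] by simp
    qed
  qed
  then show False using c(2) bj_eqI by blast
qed

text \<open>The transposition of 0 and 1 is disjoint from a 5-cycle on \<open>{4..8}\<close> in
  \<open>gA\<close> and from one on \<open>{2..6}\<close> in \<open>gB\<close>.\<close>

lemma five_gB: "\<exists>c\<in>gC. c \<noteq> 0 \<and> five gA c \<and> five gB c"
proof (intro bexI conjI)
  show "sk 0 \<in> gC" by (auto simp: gC_def jC_def intro: gen_base)
  have ne: "f \<noteq> g" if "ap f x \<noteq> ap g x" for f g :: "nat bj" and x using that by auto
  show "sk 0 \<noteq> 0" by (rule ne[of _ 0]) simp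
  show "five gA (sk 0)"
    unfolding five_def
  proof (intro bexI conjI)
    let ?x = "sk 4 + sk 5 + sk 6 + sk 7"
    show "?x \<in> gA" unfolding gA_def jA_def by (intro gen_plus gen_base; simp)
    show "?x \<noteq> 0" by (rule ne[of _ 8]) simp
    show "?x + ?x + ?x + ?x + ?x = 0" "sk 0 + ?x = ?x + sk 0" by (rule bj9_eqI; simp)+
  qed
  show "five gB (sk 0)"
    unfolding five_def
  proof (intro bexI conjI)
    let ?x = "sk 2 + sk 3 + sk 4 + sk 5"
    show "?x \<in> gB" unfolding gB_def jB_def by (intro gen_plus gen_base; simp)
    show "?x \<noteq> 0" by (rule ne[of _ 6]) simp
    show "?x + ?x + ?x + ?x + ?x = 0" "sk 0 + ?x = ?x + sk 0" by (rule bj9_eqI; simp)+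
  qed
qed

text \<open>\<open>gA\<close> contains commuting elements of orders 5 and 4. In \<open>gB'\<close>
  an element commuting with one of order five and with fourth power 0 fixes \<open>{0..5}\<close>,
  hence moves at most 6 and 7, and its square is already 0.\<close>

lemma no_inj_gA:
  assumes f: "\<And>x y. x \<in> gA \<Longrightarrow> y \<in> gA \<Longrightarrow> f (x + y) = f x + f y" and inj: "inj_on f gA" and im: "f ` gA \<subseteq> gB'"
  shows False
proof -
  let ?x = "sk 4 + sk 5 + sk 6 + sk 7" and ?y = "sk 0 + sk 1 + sk 2"
  have gA: "is_subgroup gA" by (simp add: gA_def)
  have x: "?x \<in> gA" and y: "?y \<in> gA" unfolding gA_def jA_def by (intro gen_plus gen_base; simp)+
  note plus = subgroupD(2)[OF gA]
  have f0: "f 0 = 0" using hom_on_0[of f gA] f gA by (simp add: hom_on_def)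
  have f_eq_0: "z = 0" if "z \<in> gA" "f z = 0" for z
    using inj_onD[OF inj _ that(1) subgroupD(1)[OF gA]] that f0 by simp
  have ne: "f \<noteq> g" if "ap f x \<noteq> ap g x" for f g :: "nat bj" and x using that by auto
  have x0: "?x \<noteq> 0" by (rule ne[of _ 8]) simp
  have y0: "?y + ?y \<noteq> 0" by (rule ne[of _ 0]) simp
  have x5: "?x + ?x + ?x + ?x + ?x = 0" and y4: "?y + ?y + ?y + ?y = 0" and xy: "?x + ?y = ?y + ?x"
    by (rule bj9_eqI; simp)+
  define p where "p = f ?x"
  define r where "r = f ?y"
  have p: "p \<in> gB'" "p \<noteq> 0" using im x x0 f_eq_0 by (auto simp: p_def)
  have r: "r \<in> gB'" using im y by (auto simp: r_def)
  have p5: "p + p + p + p + p = 0"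
    using arg_cong[OF x5, of f] by (simp only: f f0 p_def plus x)
  have r4: "r + r + r + r = 0"
    using arg_cong[OF y4, of f] by (simp only: f f0 r_def plus y)
  have pr: "p + r = r + p"
    using arg_cong[OF xy, of f] by (simp only: f p_def r_def x y)
  have "ap (r + r) z = ap 0 z" for z
  proof -
    consider "z < 6" | "z \<in> {6, 7}" | "z \<ge> 8" by fastforce
    then show ?thesis
    proof cases
      case 1
      then show ?thesis using gB'_centralizer[OF p p5 r r4 pr] by simp
    next
      case 2
      have "ap r 6 \<in> {6, 7}" "ap r 7 \<in> {6, 7}" using stabD[OF g_stab(4)[OF r]] by auto
      moreover have "ap r 6 \<noteq> ap r 7" by simp
      ultimately show ?thesis using 2 by (auto simp del: ap_inj)
    next
      case 3
      then show ?thesis using g_fix(2)[OF r] by simp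
    qed
  qed
  then have "f (?y + ?y) = 0" using bj_eqI f[OF y y] unfolding r_def by metis
  then show False using f_eq_0[OF plus[OF y y]] y0 by simp
qed

lemma card_gB: "card gB = card gB'"
proof (rule bij_betw_same_card, rule bij_betw_byWitness)
  let ?u = "w2 + w1 + w0"
  show "(\<lambda>b. ?u + b + - ?u) ` gB \<subseteq> gB'" "(\<lambda>b. - ?u + b + ?u) ` gB' \<subseteq> gB" using u_gB u_gB' by auto
  show "\<forall>b\<in>gB. - ?u + (?u + b + - ?u) + ?u = b" "\<forall>b\<in>gB'. ?u + (- ?u + b + ?u) + - ?u = b"
    by (simp_all only: grps) simp_all
qed

lemma nonisomorphic_B: "nonisomorphic gA gB gB' gC (w0 + w1)"
proof -
  interpret V1: amalg gA gB gC by (rule amalg_B)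
  interpret V2: amalg gA gB' gC by (rule amalg_B')
  show ?thesis
  proof unfold_locales
    show "w0 + w1 \<in> gB'" using w_mem by (simp add: gB'_def gen_plus)
    show "\<not> gB \<subseteq> gC" using w_mem(3) not_gC(2) by blast
    show "normalizes (w0 + w1) gC" by (intro normalizes_add normalizes_gC)
  qed (rule finite_g card_gB not_gC five_gB no_five_gB' no_inj_gA; assumption?)+
qed

theorem theorem1p7:
  shows "\<exists>(C :: nat monoid) (A1 :: nat monoid) (B1 :: nat monoid) (A2 :: nat monoid) (B2 :: nat monoid)
           (i1 :: nat \<Rightarrow> nat) (j1 :: nat \<Rightarrow> nat) (i2 :: nat \<Rightarrow> nat) (j2 :: nat \<Rightarrow> nat).
     finite_coxeter_group C \<and> finite_coxeter_group A1 \<and> finite_coxeter_group B1 \<and>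
     finite_coxeter_group A2 \<and> finite_coxeter_group B2 \<and>
     special_embedding C A1 i1 \<and> special_embedding C B1 j1 \<and>
     special_embedding C A2 i2 \<and> special_embedding C B2 j2 \<and>
     is_coxeter_group (amalgam A1 C B1 i1 j1) \<and> is_coxeter_group (amalgam A2 C B2 i2 j2) \<and>
     AE_equivalent (amalgam A1 C B1 i1 j1) (amalgam A2 C B2 i2 j2) \<and>
     \<not> (amalgam A1 C B1 i1 j1 \<cong> amalgam A2 C B2 i2 j2)"
proof -
  define V where "V = gA \<union> gB \<union> gB'"
  have "finite V" using finite_g by (simp add: V_def)
  \<comment> \<open>One injection serves all the factors, so that the copies of \<open>gC\<close>
    inside them coincide and every embedding is the identity.\<close>
  then obtain e :: "nat bj \<Rightarrow> nat" where e: "inj_on e V" using finite_imp_inj_to_nat_seg by blast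
  have sub: "gA \<subseteq> V" "gB \<subseteq> V" "gB' \<subseteq> V" "gC \<subseteq> V" using gC_sub by (auto simp: V_def)
  interpret bj_encoding e V by unfold_locales (rule e)
  interpret V1: amalg_encoding gA gB gC e V
    by (intro amalg_encoding.intro amalg_B amalg_encoding_axioms.intro encoding.intro e sub)
  interpret V2: amalg_encoding gA gB' gC e V
    by (intro amalg_encoding.intro amalg_B' amalg_encoding_axioms.intro encoding.intro e sub)
  have cox1: "is_coxeter_group V1.AM"
    using parabolic_amalgam.coxeter_AM[of jA jB jC e V 8] V1.amalg_encoding_axioms j_less jC_sub
    by (simp add: g_defs parabolic_amalgam_def parabolic_amalgam_axioms_def)
  have cox2: "is_coxeter_group V2.AM"
    using parabolic_amalgam.coxeter_AM[of jA jB' jC e V 8] V2.amalg_encoding_axioms j_less jC_sub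
    by (simp add: g_defs parabolic_amalgam_def parabolic_amalgam_axioms_def)
  have fin: "finite_coxeter_group (natg gA)" "finite_coxeter_group (natg gB)" "finite_coxeter_group (natg gB')"
    "finite_coxeter_group (natg gC)"
    using j_less[THEN finite_coxeter_natg] sub unfolding g_defs by blast+
  have emb: "special_embedding (natg gC) (natg gA) (\<lambda>x. x)" "special_embedding (natg gC) (natg gB) (\<lambda>x. x)"
    "special_embedding (natg gC) (natg gB') (\<lambda>x. x)"
    using special_natg[OF j_less(1) _ jC_sub(1)] special_natg[OF j_less(2) _ jC_sub(2)]
      special_natg[OF j_less(3) _ jC_sub(3)] sub
    unfolding g_defs by blast+
  obtain \<Theta>1 \<Theta>2 where \<Theta>: "\<Theta>1 \<in> iso V1.AM (gm (WW gA gB gC))" "\<Theta>2 \<in> iso V2.AM (gm (WW gA gB' gC))"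
    using V1.AM_iso V2.AM_iso by blast
  note gr = group_gm[OF V1.subgroup_W] group_gm[OF V2.subgroup_W] group_gm[OF V1.subgroup_E] group_gm[OF V2.subgroup_E]
  note [trans] = AE_equivalent_trans
  have "AE_equivalent V1.AM (gm (WW gA gB gC))"
    by (rule AE_equivalent_iso[OF V1.group_AM gr(1) \<Theta>(1)])
  also have "AE_equivalent \<dots> (gm (EE gA gB gC))"
    by (rule merz.AE_equivalent_W_E[OF merz_B finite_g(1,2)])
  also have "AE_equivalent \<dots> (gm (EE gA gB' gC))"
    by (rule AE_equivalent_sym) (rule AE_equivalent_iso[OF gr(4,3) twist.psi_iso[OF twist_B]])
  also have "AE_equivalent \<dots> (gm (WW gA gB' gC))"
    by (rule AE_equivalent_sym) (rule merz.AE_equivalent_W_E[OF merz_B' finite_g(1,3)])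
  also have "AE_equivalent \<dots> V2.AM"
    by (rule AE_equivalent_sym) (rule AE_equivalent_iso[OF V2.group_AM gr(2) \<Theta>(2)])
  finally have AE: "AE_equivalent V1.AM V2.AM" .
  have "\<not> V1.AM \<cong> V2.AM"
  proof
    assume "V1.AM \<cong> V2.AM"
    moreover have "gm (WW gA gB gC) \<cong> V1.AM"
      using group.iso_set_sym[OF V1.group_AM \<Theta>(1)] by (auto simp: is_iso_def)
    moreover have "V2.AM \<cong> gm (WW gA gB' gC)" using \<Theta>(2) by (auto simp: is_iso_def)
    ultimately have "gm (WW gA gB gC) \<cong> gm (WW gA gB' gC)" by (blast intro: iso_trans)
    then show False using nonisomorphic.not_isomorphic[OF nonisomorphic_B] by blast
  qed
  with fin emb cox1 cox2 AE show ?thesis unfolding V1.AM_def V2.AM_def by blast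
qed

end
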